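(* Suppose that every $n$-vertex undirected weighted graph (nonnegative weights) admits an interactive $\alpha$-spanner with query time $q$ and size $h(n)$. Then for every real $t\geq1$, every $n$-vertex undirected weighted graph $G$ also admits an interactive $O(\alpha\cdot t)$-spanner with query time $O(q)$ and size $O(h(\frac{n}{t})+n)$.
   Context: An interactive $\alpha$-spanner of $G=(V,E,w)$ is a pair $(S,D)$ with $S\subseteq E$ and $D$ an oracle that answers every query $(u,v)\in V^2$ with a $u$–$v$ path $P\subseteq S$ satisfying $d_G(u,v)\leq w(P)\leq\alpha\, d_G(u,v)$. Its size is $\max\{|S|,|D|\}$ where $|D|$ is the storage of $D$ in words; query time $q$ means each query is answered in time $O(q+|P|)$. *)

theory Defs
  imports Complex_Main
begin

subsection \<open>Weighted graphs\<close>

text \<open>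
  The vertices of an \<open>n\<close>-vertex graph are the numbers below \<open>n\<close>, since they have to be passed to
  and reported by a machine. Edges are two-element sets; only the weights of edges matter.
\<close>

definition weighted_graph :: "nat \<Rightarrow> nat set set \<Rightarrow> (nat set \<Rightarrow> real) \<Rightarrow> bool" where
  "weighted_graph n E w \<longleftrightarrow>
     (\<forall>e\<in>E. \<exists>u v. u < n \<and> v < n \<and> u \<noteq> v \<and> e = {u, v}) \<and> (\<forall>e\<in>E. 0 \<le> w e)"

fun path_edges :: "nat list \<Rightarrow> nat set list" where
  "path_edges (x # y # xs) = {x, y} # path_edges (y # xs)"
| "path_edges _ = []"

definition paths :: "nat \<Rightarrow> nat set set \<Rightarrow> nat \<Rightarrow> nat \<Rightarrow> nat list set" where
  "paths n E u v = {P. P \<noteq> [] \<and> hd P = u \<and> last P = v \<and> distinct P \<and>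
     set P \<subseteq> {..<n} \<and> set (path_edges P) \<subseteq> E}"

definition path_weight :: "(nat set \<Rightarrow> real) \<Rightarrow> nat list \<Rightarrow> real" where
  "path_weight w P = sum_list (map w (path_edges P))"

text \<open>The distance is only meaningful (and only used below) for pairs joined by a path.\<close>

definition graph_dist :: "nat \<Rightarrow> nat set set \<Rightarrow> (nat set \<Rightarrow> real) \<Rightarrow> nat \<Rightarrow> nat \<Rightarrow> real" where
  "graph_dist n E w u v = (INF P\<in>paths n E u v. path_weight w P)"


subsection \<open>A unit-cost word RAM\<close>

text \<open>
  Query procedures are programs in structured form over finitely many registers, a random access
  scratch memory, a read-only list of words (the stored data structure) and an output stream.
\<close>

datatype binop = Plus | Minus | Times | Divide | Modulo | BitAnd | BitOr | BitXor | ShiftL | ShiftR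
  | Eq | Less

fun binop_sem :: "binop \<Rightarrow> nat \<Rightarrow> nat \<Rightarrow> nat" where
  "binop_sem Plus a b = a + b"
| "binop_sem Minus a b = a - b"
| "binop_sem Times a b = a * b"
| "binop_sem Divide a b = a div b"
| "binop_sem Modulo a b = a mod b"
| "binop_sem BitAnd a b = Bit_Operations.and a b"
| "binop_sem BitOr a b = Bit_Operations.or a b"
| "binop_sem BitXor a b = Bit_Operations.xor a b"
| "binop_sem ShiftL a b = push_bit b a"
| "binop_sem ShiftR a b = drop_bit b a"
| "binop_sem Eq a b = of_bool (a = b)"
| "binop_sem Less a b = of_bool (a < b)"

datatype prog =
    Skip
  | Const nat nat
  | Bin binop nat nat nat
  | Load nat nat
  | Store nat nat
  | Probe nat nat
  | Emit nat
  | Seq prog prog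
  | Cond nat prog prog
  | While nat prog

record state =
  regs :: "nat \<Rightarrow> nat"
  mem :: "nat \<Rightarrow> nat"
  out :: "nat list"

text \<open>
  \<open>exec B D p s k s'\<close>: on a machine whose words are the numbers below \<open>B\<close>, with stored data \<open>D\<close>,
  the program \<open>p\<close> leads from \<open>s\<close> to \<open>s'\<close> in exactly \<open>k \<ge> 1\<close> steps. A computation that
  produces a value that is not a word, or that probes outside of \<open>D\<close>, is stuck and has no
  result; there is no modular wraparound. All addresses come from registers and are thus words.
\<close>

inductive exec :: "nat \<Rightarrow> nat list \<Rightarrow> prog \<Rightarrow> state \<Rightarrow> nat \<Rightarrow> state \<Rightarrow> bool"
  for B :: nat and D :: "nat list" where
  Skip: "exec B D Skip s 1 s"
| Const: "a < B \<Longrightarrow> exec B D (Const r a) s 1 (s\<lparr>regs := (regs s)(r := a)\<rparr>)"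
| Bin: "a = binop_sem f (regs s i) (regs s j) \<Longrightarrow> a < B \<Longrightarrow>
    exec B D (Bin f r i j) s 1 (s\<lparr>regs := (regs s)(r := a)\<rparr>)"
| Load: "exec B D (Load r i) s 1 (s\<lparr>regs := (regs s)(r := mem s (regs s i))\<rparr>)"
| Store: "exec B D (Store i j) s 1 (s\<lparr>mem := (mem s)(regs s i := regs s j)\<rparr>)"
| Probe: "regs s i < length D \<Longrightarrow>
    exec B D (Probe r i) s 1 (s\<lparr>regs := (regs s)(r := D ! regs s i)\<rparr>)"
| Emit: "exec B D (Emit i) s 1 (s\<lparr>out := out s @ [regs s i]\<rparr>)"
| Seq: "exec B D p s k s' \<Longrightarrow> exec B D p' s' k' s'' \<Longrightarrow> exec B D (Seq p p') s (k + k') s''"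
| CondTrue: "regs s i \<noteq> 0 \<Longrightarrow> exec B D p s k s' \<Longrightarrow> exec B D (Cond i p p') s (Suc k) s'"
| CondFalse: "regs s i = 0 \<Longrightarrow> exec B D p' s k s' \<Longrightarrow> exec B D (Cond i p p') s (Suc k) s'"
| WhileFalse: "regs s i = 0 \<Longrightarrow> exec B D (While i p) s 1 s"
| WhileTrue: "regs s i \<noteq> 0 \<Longrightarrow> exec B D p s k s' \<Longrightarrow> exec B D (While i p) s' k' s'' \<Longrightarrow>
    exec B D (While i p) s (Suc (k + k')) s''"

definition query_state :: "nat \<Rightarrow> nat \<Rightarrow> state" where
  "query_state u v = \<lparr>regs = (\<lambda>_. 0)(0 := u, 1 := v), mem = (\<lambda>_. 0), out = []\<rparr>"

definition answers :: "nat \<Rightarrow> prog \<Rightarrow> nat list \<Rightarrow> nat \<Rightarrow> nat \<Rightarrow> nat list \<Rightarrow> nat \<Rightarrow> bool" where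
  "answers B Q D u v P k \<longleftrightarrow> (\<exists>s. exec B D Q (query_state u v) k s \<and> out s = P)"


subsection \<open>Interactive spanners\<close>

text \<open>
  Words have \<open>\<kappa> * log 2 (n + 2)\<close> bits, where \<open>\<kappa>\<close> is the constant hidden in the usual word size
  \<open>O(log n)\<close>.
\<close>

definition word_bound :: "nat \<Rightarrow> nat \<Rightarrow> nat" where
  "word_bound \<kappa> n = (n + 2) ^ \<kappa>"

text \<open>
  The oracle consists of the query procedure \<open>Q\<close> and of the stored words \<open>D\<close>; \<open>c\<close> is the constant
  hidden in the bound \<open>O(q + |P|)\<close> for the time of a query, where \<open>|P|\<close> counts edges. Pairs in
  different components of the graph (distance infinity) are answered by the empty list, which is
  not a path; the path from \<open>u\<close> to \<open>u\<close> is \<open>[u]\<close>.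
\<close>

definition interactive_spanner ::
  "prog \<Rightarrow> nat \<Rightarrow> real \<Rightarrow> nat \<Rightarrow> nat set set \<Rightarrow> (nat set \<Rightarrow> real) \<Rightarrow> real \<Rightarrow> real \<Rightarrow>
   nat set set \<Rightarrow> nat list \<Rightarrow> bool" where
  "interactive_spanner Q \<kappa> c n E w \<alpha> q S D \<longleftrightarrow>
     S \<subseteq> E \<and> (\<forall>d\<in>set D. d < word_bound \<kappa> n) \<and>
     (\<forall>u<n. \<forall>v<n. \<exists>P k. answers (word_bound \<kappa> n) Q D u v P k \<and>
        real k \<le> c * (q + real (length (path_edges P))) \<and>
        (if paths n E u v = {} then P = []
         else P \<in> paths n S u v \<and>
              graph_dist n E w u v \<le> path_weight w P \<and>
              path_weight w P \<le> \<alpha> * graph_dist n E w u v))"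

definition spanner_size :: "nat set set \<Rightarrow> nat list \<Rightarrow> nat" where
  "spanner_size S D = max (card S) (length D)"

text \<open>
  The query procedure is the same for all graphs; otherwise it could contain the graph without
  this being accounted for in the size.
\<close>

definition all_graphs_admit ::
  "prog \<Rightarrow> nat \<Rightarrow> real \<Rightarrow> real \<Rightarrow> real \<Rightarrow> (nat \<Rightarrow> real) \<Rightarrow> bool" where
  "all_graphs_admit Q \<kappa> c \<alpha> q h \<longleftrightarrow>
     (\<forall>n E w. weighted_graph n E w \<longrightarrow>
        (\<exists>S D. interactive_spanner Q \<kappa> c n E w \<alpha> q S D \<and> real (spanner_size S D) \<le> h n))"

end

theory Submission
  imports Defs
begin

text \<open>
  Let \<open>s = \<lceil>t\<rceil>\<close>. Processing the edges in increasing order as in Kruskal's algorithm, small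
  components are merged until they have at least \<open>s\<close> vertices; a small component that meets a big
  one is hung onto it, and big ones are never merged. Apart from components of the graph with fewer
  than \<open>s\<close> vertices, this gives at most \<open>n / t\<close> clusters. They have rooted spanning trees of depth
  below \<open>3 s\<close>, and the edge from a vertex \<open>x\<close> to its parent is no heavier than any edge that leaves
  the set of the descendants of \<open>x\<close>. Hence a tree path costs at most \<open>O(s)\<close> times the distance of
  its ends, and the detours through the clusters that are needed to lift a path of the quotient graph
  cost at most \<open>O(s)\<close> times its weight.

  The oracle stores parents, depths and cluster numbers, the given oracle for the quotient graph, and
  a perfect hash table that translates the edges of the quotient spanner into edges of the graph.
  A query simulates the given query program and lifts its answer cluster by cluster.
\<close>

subsection \<open>Perfect hashing of pairs\<close>

text \<open>A bound on the number of edges of a cluster tree says nothing about its weight: the tree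
  may contain edges far heavier than the path to be approximated. Descendant sets remove this
  obstacle. A tree edge on the way between two vertices separates them, so every path between them
  leaves a descendant set and already pays for that edge; and an edge leaving a cluster leaves every
  descendant set that contains its end, so quotient edges pay for the detours next to them. This
  property survives if a whole component is hung by its root along an edge that is the heaviest so
  far, which is why small components keep a free choice of root. Merging big parts would destroy the
  depth bound: \<open>3 * s\<close> is \<open>2 * s\<close> for a union of two small parts plus
  \<open>s\<close> for a small part hung onto it. The quotient graph is padded with isolated
  vertices to exactly \<open>nat \<lfloor>real n / t\<rfloor>\<close> vertices, so the hypothesis is
  applied at that very number.\<close>

lemma add_mod_cancel:
  fixes x y b r :: nat
  assumes "(x + b) mod r = (y + b) mod r" "x < r" "y < r"
  shows "x = y"
proof -
  have "(int x + int b) mod int r = (int y + int b) mod int r"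
    using assms(1) by (metis of_nat_add zmod_int)
  then have "(int x + int b - int b) mod int r = (int y + int b - int b) mod int r"
    by (metis mod_diff_left_eq)
  then show ?thesis using assms(2,3) by simp
qed

lemma sum_le_exists:
  fixes f :: "nat \<Rightarrow> nat"
  assumes "(\<Sum>s<r. f s) \<le> c" "0 < r"
  shows "\<exists>s<r. r * f s \<le> c"
proof (rule ccontr)
  assume "\<not> ?thesis"
  then have "c + 1 \<le> r * f s" if "s < r" for s using that by (simp add: not_le Suc_leI)
  then have "(\<Sum>s<r. c + 1) \<le> (\<Sum>s<r. r * f s)" by (intro sum_mono) auto
  also have "\<dots> = r * (\<Sum>s<r. f s)" by (simp add: sum_distrib_left)
  also have "\<dots> \<le> r * c" using assms(1) by simp
  finally show False using assms(2) by simp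
qed

definition bucket :: "nat \<Rightarrow> (nat \<Rightarrow> nat) \<Rightarrow> nat \<times> nat \<Rightarrow> nat" where
  "bucket r T x = (T (fst x) + snd x) mod r"

text \<open>Ordered pairs without the diagonal: every clash is counted twice, which fits the square
  of the cardinality in the averaging bound.\<close>

definition collisions :: "('a \<Rightarrow> 'b) \<Rightarrow> 'a set \<Rightarrow> ('a \<times> 'a) set" where
  "collisions f K = {(x, y). x \<in> K \<and> y \<in> K \<and> x \<noteq> y \<and> f x = f y}"

lemma finite_collisions: "finite K \<Longrightarrow> finite (collisions f K)"
  by (rule finite_subset[of _ "K \<times> K"]) (auto simp: collisions_def)

text \<open>Rows receive their shifts one after the other. An old entry and an entry of row
  \<open>j\<close> clash for at most one of the \<open>r\<close> shifts, so some shift causes at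
  most \<open>card (Kj j) * card L / r\<close> unordered clashes; twice the numerator is the mixed
  term of the square of \<open>card (Kj j) + card L\<close>. Inside one row nothing clashes because
  \<open>N \<le> r\<close>.\<close>

lemma few_collisions:
  assumes K: "finite K" "K \<subseteq> {..<N} \<times> {..<N}" and r: "N \<le> r" "0 < r"
  shows "\<exists>T. (\<forall>a. T a < r) \<and> r * card (collisions (bucket r T) K) \<le> (card K)\<^sup>2"
proof -
  define Kj where "Kj j = {x \<in> K. fst x < j}" for j
  have fin: "finite (Kj j)" for j using K(1) by (simp add: Kj_def)
  have "\<exists>T. (\<forall>a. T a < r) \<and> r * card (collisions (bucket r T) (Kj j)) \<le> (card (Kj j))\<^sup>2" for j
  proof (induction j)
    case 0
    then show ?case using r by (intro exI[of _ "\<lambda>_. 0"]) (simp add: Kj_def collisions_def)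
  next
    case (Suc j)
    then obtain T where T: "\<And>a. T a < r"
      "r * card (collisions (bucket r T) (Kj j)) \<le> (card (Kj j))\<^sup>2" by blast
    define L where "L = {x \<in> K. fst x = j}"
    have finL: "finite L" using K(1) by (simp add: L_def)
    have KS: "Kj (Suc j) = Kj j \<union> L" "Kj j \<inter> L = {}" by (auto simp: Kj_def L_def)
    \<comment> \<open>The pairs of an old and a new entry that clash once row \<open>j\<close> is
      shifted by \<open>s\<close>; exchanging the order of summation bounds their total over all
      \<open>s\<close>.\<close>
    define A where "A s = {p \<in> Kj j \<times> L. bucket r T (fst p) = (s + snd (snd p)) mod r}" for s
    have finA: "finite (A s)" for s using fin finL by (simp add: A_def)
    have "(\<Sum>s<r. card (A s))
        = (\<Sum>s<r. \<Sum>p\<in>Kj j \<times> L. of_bool (bucket r T (fst p) = (s + snd (snd p)) mod r))"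
      using fin finL by (simp add: A_def Int_def)
    also have "\<dots> = (\<Sum>p\<in>Kj j \<times> L. \<Sum>s<r. of_bool (bucket r T (fst p) = (s + snd (snd p)) mod r))"
      by (rule sum.swap)
    also have "\<dots> \<le> (\<Sum>p\<in>Kj j \<times> L. 1)"
    proof (rule sum_mono)
      fix p
      have "card ({..<r} \<inter> {s. bucket r T (fst p) = (s + snd (snd p)) mod r}) \<le> 1"
        by (rule card_le_Suc0_iff_eq[THEN iffD2, folded One_nat_def])
           (auto dest!: add_mod_cancel[OF trans[OF sym]])
      then show "(\<Sum>s<r. of_bool (bucket r T (fst p) = (s + snd (snd p)) mod r)) \<le> (1::nat)"
        by simp
    qed
    also have "\<dots> = card (Kj j) * card L" by (simp add: card_cartesian_product)
    finally obtain s where s: "s < r" "r * card (A s) \<le> card (Kj j) * card L"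
      using sum_le_exists r(2) by blast
    define T' where "T' = T(j := s)"
    have old: "bucket r T' x = bucket r T x" if "x \<in> Kj j" for x
      using that by (auto simp: T'_def bucket_def Kj_def)
    have new: "bucket r T' x = (s + snd x) mod r" if "x \<in> L" for x
      using that by (auto simp: T'_def bucket_def L_def)
    have newinj: "x = y" if "x \<in> L" "y \<in> L" "bucket r T' x = bucket r T' y" for x y
    proof -
      have "snd x = snd y"
        using that new K(2) r(1) add_mod_cancel[of "snd x" s r "snd y"]
        by (fastforce simp: L_def add.commute)
      then show ?thesis using that by (auto simp: L_def intro: prod_eqI)
    qed
    \<comment> \<open>Collisions are ordered, so a new clash appears in \<open>A s\<close> and once
      more mirrored.\<close>
    have "collisions (bucket r T') (Kj (Suc j))
        \<subseteq> collisions (bucket r T) (Kj j) \<union> A s \<union> prod.swap ` A s"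
    proof
      fix p assume p: "p \<in> collisions (bucket r T') (Kj (Suc j))"
      obtain x y where [simp]: "p = (x, y)" by (cases p)
      have xy: "x \<in> Kj j \<union> L" "y \<in> Kj j \<union> L" "x \<noteq> y" "bucket r T' x = bucket r T' y"
        using p KS by (auto simp: collisions_def)
      consider "x \<in> Kj j" "y \<in> Kj j" | "x \<in> Kj j" "y \<in> L" | "x \<in> L" "y \<in> Kj j"
        using xy newinj by blast
      then show "p \<in> collisions (bucket r T) (Kj j) \<union> A s \<union> prod.swap ` A s"
      proof cases
        case 3
        then have "(y, x) \<in> A s" using xy old new by (simp add: A_def)
        then show ?thesis by force
      qed (use xy old new in \<open>auto simp: A_def collisions_def\<close>)
    qed
    then have "card (collisions (bucket r T') (Kj (Suc j)))
        \<le> card (collisions (bucket r T) (Kj j) \<union> A s \<union> prod.swap ` A s)"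
      using finite_collisions[OF fin] finA by (intro card_mono) auto
    also have "\<dots> \<le> card (collisions (bucket r T) (Kj j)) + card (A s) + card (A s)"
      by (meson add_mono card_Un_le card_image_le finA le_trans order_refl)
    finally have "r * card (collisions (bucket r T') (Kj (Suc j)))
        \<le> r * card (collisions (bucket r T) (Kj j)) + 2 * (r * card (A s))"
      by (metis (no_types, lifting) add_mult_distrib2 group_cancel.add1 mult_2 mult_le_mono2
          mult.left_commute)
    also have "\<dots> \<le> (card (Kj j))\<^sup>2 + 2 * (card (Kj j) * card L)" using T(2) s(2) by simp
    also have "\<dots> \<le> (card (Kj (Suc j)))\<^sup>2"
      using KS fin finL by (simp add: card_Un_disjoint power2_eq_square algebra_simps)
    finally show ?case using T(1) s(1) using T'_def
        by (intro exI[of _ T']) (simp del: fun_upd_apply, simp)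
  qed
  moreover have "Kj N = K" using K(2) by (auto simp: Kj_def)
  ultimately show ?thesis by metis
qed

text \<open>
  Double displacement: row \<open>a\<close> of a sparse table is first shifted by \<open>T a\<close>, then every column \<open>g\<close> of
  the result is shifted by \<open>d g\<close>. Both shifts are chosen greedily, \<open>T\<close> by averaging over the
  possible shifts of a row, \<open>d\<close> by treating the fullest columns first.
\<close>

definition slot :: "nat \<Rightarrow> (nat \<Rightarrow> nat) \<Rightarrow> (nat \<Rightarrow> nat) \<Rightarrow> nat \<times> nat \<Rightarrow> nat" where
  "slot r T d x = (fst x + d (bucket r T x)) mod r"

text \<open>The squares count ordered pairs of keys with equal value: the diagonal contributes at
  most \<open>card K\<close>, the rest are collisions.\<close>

lemma sum_bucket_squares:
  assumes K: "finite K" and V: "finite V"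
  shows "(\<Sum>v\<in>V. (card {x\<in>K. f x = v})\<^sup>2) \<le> card K + card (collisions f K)"
proof -
  let ?B = "\<lambda>v. {x\<in>K. f x = v}"
  have "(\<Sum>v\<in>V. (card (?B v))\<^sup>2) = (\<Sum>v\<in>V. card (?B v \<times> ?B v))"
    by (simp add: card_cartesian_product power2_eq_square)
  also have "\<dots> = card (\<Union>v\<in>V. ?B v \<times> ?B v)"
    using K V by (intro card_UN_disjoint[symmetric]) auto
  also have "\<dots> \<le> card ((\<lambda>x. (x, x)) ` K \<union> collisions f K)"
    using K finite_collisions[OF K] by (intro card_mono) (auto simp: collisions_def)
  also have "\<dots> \<le> card ((\<lambda>x. (x, x)) ` K) + card (collisions f K)" by (rule card_Un_le)
  also have "\<dots> \<le> card K + card (collisions f K)" using card_image_le[OF K] by simp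
  finally show ?thesis .
qed

text \<open>After the first shift at most \<open>card K / 2\<close> collisions remain, so the
  squared column sizes add up to at most \<open>3/2 * card K\<close> and stay below
  \<open>r\<close>. If a column is placed after columns that are all at least as full, its size
  times the number of occupied slots is at most the sum of the squared sizes of those columns. Fewer
  than \<open>r\<close> shifts are therefore forbidden and one is left.\<close>

lemma perfect_displacement:
  assumes K: "finite K" "K \<subseteq> {..<N} \<times> {..<N}" and r: "N \<le> r" "2 * card K \<le> r" "0 < r"
  shows "\<exists>T d. (\<forall>a. T a < r) \<and> (\<forall>v. d v < r) \<and> inj_on (slot r T d) K"
proof -
  obtain T where T: "\<And>a. T a < r" "r * card (collisions (bucket r T) K) \<le> (card K)\<^sup>2"
    using few_collisions[OF K r(1,3)] by blast
  let ?f = "bucket r T"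
  define B where "B v = {x\<in>K. ?f x = v}" for v
  have finB: "finite (B v)" for v using K by (simp add: B_def)
  have small: "(\<Sum>v\<in>V. (card (B v))\<^sup>2) < r" if "finite V" for V
  proof (cases "card K = 0")
    case True
    then have "B v = {}" for v using K(1) by (simp add: B_def)
    then show ?thesis using r(3) by simp
  next
    case False
    have "r * (2 * card (collisions ?f K)) \<le> (2 * card K) * card K"
      using T(2) by (simp add: power2_eq_square)
    also have "\<dots> \<le> r * card K" using r(2) by (rule mult_right_mono) simp
    finally have "2 * card (collisions ?f K) \<le> card K" using r(3) by simp
    then show ?thesis using sum_bucket_squares[OF K(1) that, of ?f] False r(2)
      unfolding B_def by linarith
  qed
  have "\<exists>d. (\<forall>v. d v < r) \<and> inj_on (slot r T d) (\<Union>v\<in>V. B v)" if "finite V" for V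
    using that
  proof (induction "card V" arbitrary: V)
    case 0
    then show ?case using r(3) by (intro exI[of _ "\<lambda>_. 0"]) simp
  next
    case (Suc m)
    then have "V \<noteq> {}" by auto
    \<comment> \<open>The induction removes the least full column, so it is placed last and all
      columns placed before it are at least as large.\<close>
    define v where "v = arg_min_on (\<lambda>v. card (B v)) V"
    have v: "v \<in> V" "\<And>u. u \<in> V \<Longrightarrow> card (B v) \<le> card (B u)"
      using Suc.prems \<open>V \<noteq> {}\<close> arg_min_if_finite[of V "\<lambda>v. card (B v)"]
      unfolding v_def by (auto simp: not_less)
    define U where "U = V - {v}"
    have U: "finite U" "V = insert v U" "v \<notin> U" "card U = m"
      using Suc v(1) by (auto simp: U_def)
    obtain d where d: "\<And>v. d v < r" "inj_on (slot r T d) (\<Union>v\<in>U. B v)"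
      using Suc.hyps(1)[of U] U by metis
    define C where "C = (\<Union>v\<in>U. B v)"
    have finC: "finite C" using U(1) finB by (simp add: C_def)
    \<comment> \<open>The shifts that send some entry of column \<open>v\<close> to an occupied
      slot: at most one for each entry and each occupied slot.\<close>
    define bad where "bad = (\<Union>p\<in>B v \<times> C. {s. s < r \<and> (fst (fst p) + s) mod r = slot r T d (snd p)})"
    have "card bad \<le> (\<Sum>p\<in>B v \<times> C. card {s. s < r \<and> (fst (fst p) + s) mod r = slot r T d (snd p)})"
      unfolding bad_def using finB finC by (intro card_UN_le) auto
    also have "\<dots> \<le> (\<Sum>p\<in>B v \<times> C. 1)"
    proof (rule sum_mono)
      fix p :: "(nat \<times> nat) \<times> (nat \<times> nat)"
      let ?S = "{s. s < r \<and> (fst (fst p) + s) mod r = slot r T d (snd p)}"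
      have "\<forall>s\<in>?S. \<forall>s'\<in>?S. s = s'"
      proof (intro ballI)
        fix s s' assume "s \<in> ?S" "s' \<in> ?S"
        then show "s = s'" using add_mod_cancel[of s "fst (fst p)" r s'] by (simp add: add.commute)
      qed
      moreover have "finite ?S" by (rule finite_subset[of _ "{..<r}"]) blast+
      ultimately show "card ?S \<le> 1" unfolding One_nat_def
          by (rule card_le_Suc0_iff_eq[THEN iffD2, rotated])
    qed
    also have "\<dots> = card (B v) * card C" by (simp add: card_cartesian_product)
    also have "\<dots> \<le> card (B v) * (\<Sum>u\<in>U. card (B u))"
      unfolding C_def using U(1) finB by (intro mult_left_mono card_UN_le) auto
    also have "\<dots> = (\<Sum>u\<in>U. card (B v) * card (B u))" by (simp add: sum_distrib_left)
    also have "\<dots> \<le> (\<Sum>u\<in>U. (card (B u))\<^sup>2)"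
      using v U by (intro sum_mono) (auto simp: power2_eq_square intro!: mult_right_mono)
    also have "\<dots> < r" using small U(1) by blast
    finally have "card bad < card {..<r}" by simp
    moreover have "finite bad" unfolding bad_def using finB finC by auto
    ultimately obtain s where s: "s < r" "s \<notin> bad"
      by (metis card_mono leD lessThan_iff subsetI)
    define d' where "d' = d(v := s)"
    have oldC: "slot r T d' x = slot r T d x" if "x \<in> C" for x
      using that U(3) by (auto simp: slot_def d'_def C_def B_def)
    have new: "slot r T d' x = (fst x + s) mod r" if "x \<in> B v" for x
      using that by (auto simp: slot_def d'_def B_def)
    have "inj_on (slot r T d') (B v \<union> C)"
    proof (rule inj_onI)
      fix x y assume xy: "x \<in> B v \<union> C" "y \<in> B v \<union> C" "slot r T d' x = slot r T d' y"
      have cross: "slot r T d' x \<noteq> slot r T d' y" if "x \<in> B v" "y \<in> C" for x y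
        using that s new[of x] oldC[of y] by (auto simp: bad_def)
      consider "x \<in> C" "y \<in> C" | "x \<in> B v" "y \<in> B v" using xy cross by (metis Un_iff)
      then show "x = y"
      proof cases
        case 1
        then show ?thesis using d(2) xy(3) oldC by (auto simp: C_def[symmetric] dest: inj_onD)
      next
        case 2
        \<comment> \<open>Two entries of one column share the second shift, so equal slots force
          equal rows; within one row, equal buckets force equal entries. Both cancellations use
          \<open>N \<le> r\<close>.\<close>
        then have inK: "x \<in> K" "y \<in> K" "?f x = ?f y" by (auto simp: B_def)
        have "fst x = fst y"
          using add_mod_cancel[of "fst x" s r "fst y"] xy(3) new 2 inK K(2) r(1) by fastforce
        moreover from this have "snd x = snd y"
          using add_mod_cancel[of "snd x" "T (fst x)" r "snd y"] inK K(2) r(1)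
          by (fastforce simp: bucket_def add.commute)
        ultimately show ?thesis by (rule prod_eqI)
      qed
    qed
    moreover have "(\<Union>v\<in>V. B v) = B v \<union> C" using U(2) by (auto simp: C_def)
    ultimately show ?case using d(1) s(1) by (intro exI[of _ d']) (auto simp: d'_def)
  qed
  from this[of "?f ` K"] obtain d where "\<And>v. d v < r" "inj_on (slot r T d) (\<Union>v\<in>?f ` K. B v)"
    using K(1) by blast
  moreover have "(\<Union>v\<in>?f ` K. B v) = K" by (auto simp: B_def)
  ultimately show ?thesis using T(1) by auto
qed

subsection \<open>Clusters\<close>

text \<open>The descendant sets \<open>D x\<close> are a parameter, pinned down by recursion along
  parents, so that trees can be combined by giving the new sets explicitly. The last clause is the
  cut property, relative to the edges \<open>E\<close> inserted so far.\<close>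

definition rooted_tree ::
  "nat set set \<Rightarrow> (nat set \<Rightarrow> real) \<Rightarrow> nat set \<Rightarrow> nat \<Rightarrow> (nat \<Rightarrow> nat) \<Rightarrow> (nat \<Rightarrow> nat) \<Rightarrow> (nat \<Rightarrow> nat set) \<Rightarrow>
      bool"
  where
  "rooted_tree E w A r par dep D \<longleftrightarrow>
     finite A \<and> r \<in> A \<and> par r = r \<and> dep r = 0 \<and>
     (\<forall>x\<in>A. x \<noteq> r \<longrightarrow> par x \<in> A \<and> {x, par x} \<in> E \<and> dep x = Suc (dep (par x))) \<and>
     (\<forall>x\<in>A. dep x < card A \<and> D x \<subseteq> A) \<and>
     (\<forall>x\<in>A. \<forall>u\<in>A. u \<in> D x \<longleftrightarrow> u = x \<or> u \<noteq> r \<and> par u \<in> D x) \<and>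
     (\<forall>x\<in>A. x \<noteq> r \<longrightarrow> (\<forall>u v. {u, v} \<in> E \<longrightarrow> u \<in> D x \<longrightarrow> v \<notin> D x \<longrightarrow> w {x, par x} \<le> w {u, v}))"

lemma rooted_tree_cong:
  assumes "rooted_tree E w A r par dep D"
    "\<And>x. x \<in> A \<Longrightarrow> par' x = par x \<and> dep' x = dep x \<and> D' x = D x"
  shows "rooted_tree E w A r par' dep' D'"
  using assms unfolding rooted_tree_def by auto

text \<open>Tree edges are old and thus no heavier than \<open>e\<close>, so \<open>e\<close> may
  cross any cut.\<close>

lemma rooted_tree_insert_edge:
  assumes "rooted_tree E w A r par dep D" "\<And>f. f \<in> E \<Longrightarrow> w f \<le> w e"
  shows "rooted_tree (insert e E) w A r par dep D"
  using assms unfolding rooted_tree_def by auto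

lemma rooted_tree_root_desc:
  assumes "rooted_tree E w A r par dep D"
  shows "D r = A"
proof -
  have "u \<in> D r" if "u \<in> A" for u
    using that
  proof (induction "dep u" arbitrary: u)
    case 0
    then show ?case using assms unfolding rooted_tree_def by (metis nat.distinct(1))
  next
    case (Suc k)
    then show ?case using assms unfolding rooted_tree_def
      by (metis nat.distinct(1) old.nat.inject)
  qed
  then show ?thesis using assms unfolding rooted_tree_def by blast
qed

text \<open>\<open>A\<close> is hung by its root, so its other parents and its descendant sets stay
  as they are. No old edge leaves \<open>A\<close>: a subtree of \<open>B\<close> that absorbs
  \<open>A\<close> gains no old outgoing edge, and the subtree of \<open>a\<close> can only be left
  along the new edge. That edge is at least as heavy as every tree edge.\<close>

lemma rooted_tree_join:
  assumes B: "rooted_tree E w B r pB dB DB" and A: "rooted_tree E w A a pA dA DA"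
    and AB: "A \<inter> B = {}" "b \<in> B"
    and closed: "\<forall>u v. {u, v} \<in> E \<longrightarrow> u \<in> A \<longrightarrow> v \<in> A"
    and heavy: "\<forall>f\<in>E. w f \<le> w {a, b}"
  shows "rooted_tree (insert {a, b} E) w (A \<union> B) r
     (\<lambda>x. if x = a then b else if x \<in> A then pA x else pB x)
     (\<lambda>x. if x \<in> A then Suc (dB b + dA x) else dB x)
     (\<lambda>x. if x \<in> A then DA x else if b \<in> DB x then DB x \<union> A else DB x)"
    (is "rooted_tree ?E w _ r ?p ?d ?D")
proof -
  have fin: "finite A" "finite B" using A B unfolding rooted_tree_def by auto
  have rab: "a \<in> A" "r \<in> B" "r \<notin> A" "b \<notin> A" "a \<noteq> r" "a \<noteq> b"
    using A B AB unfolding rooted_tree_def by auto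
  have a: "dA a = 0" "pA a = a" "DA a = A"
    using A rooted_tree_root_desc[OF A] unfolding rooted_tree_def by auto
  have pA: "pA x \<in> A \<and> {x, pA x} \<in> E \<and> dA x = Suc (dA (pA x))" if "x \<in> A" "x \<noteq> a" for x
    using A that unfolding rooted_tree_def by auto
  have pB: "pB x \<in> B \<and> {x, pB x} \<in> E \<and> dB x = Suc (dB (pB x))" if "x \<in> B" "x \<noteq> r" for x
    using B that unfolding rooted_tree_def by auto
  have r: "pB r = r" "dB r = 0" using B unfolding rooted_tree_def by auto
  have DA: "dA x < card A" "DA x \<subseteq> A" if "x \<in> A" for x
    using A that unfolding rooted_tree_def by auto
  have DB: "dB x < card B" "DB x \<subseteq> B" if "x \<in> B" for x
    using B that unfolding rooted_tree_def by auto
  have DAc: "u \<in> DA x \<longleftrightarrow> u = x \<or> u \<noteq> a \<and> pA u \<in> DA x" if "x \<in> A" "u \<in> A" for x u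
    using A that unfolding rooted_tree_def by auto
  have DBc: "u \<in> DB x \<longleftrightarrow> u = x \<or> u \<noteq> r \<and> pB u \<in> DB x" if "x \<in> B" "u \<in> B" for x u
    using B that unfolding rooted_tree_def by auto
  have cA: "w {x, pA x} \<le> w {u, v}" if "x \<in> A" "x \<noteq> a" "{u, v} \<in> E" "u \<in> DA x" "v \<notin> DA x" for x u v
    using A that unfolding rooted_tree_def by blast
  have cB: "w {x, pB x} \<le> w {u, v}" if "x \<in> B" "x \<noteq> r" "{u, v} \<in> E" "u \<in> DB x" "v \<notin> DB x" for x u v
    using B that unfolding rooted_tree_def by blast
  have card: "card (A \<union> B) = card A + card B" using fin AB(1) by (simp add: card_Un_disjoint)
  have notA: "x \<notin> A" if "x \<in> B" for x using that AB(1) by auto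
  show ?thesis
    unfolding rooted_tree_def
  proof (intro conjI ballI impI allI)
    show "finite (A \<union> B)" "r \<in> A \<union> B" using fin rab by auto
    show "?p r = r" "?d r = 0" using rab r by auto
    fix x assume x: "x \<in> A \<union> B"
    show "?d x < card (A \<union> B)"
      using x DA(1)[of x] DB(1)[of x] DB(1)[OF AB(2)] notA card by (auto simp: not_less)
    show "?D x \<subseteq> A \<union> B" using x DA(2)[of x] DB(2)[of x] by auto
    show "?p x \<in> A \<union> B" if "x \<noteq> r" using that x pA[of x] pB[of x] AB(2) by auto
    show "{x, ?p x} \<in> ?E" if "x \<noteq> r" using that x pA[of x] pB[of x] by auto
    show "?d x = Suc (?d (?p x))" if "x \<noteq> r"
      using that x pA[of x] pB[of x] rab a notA by auto
    show "u \<in> ?D x \<longleftrightarrow> u = x \<or> u \<noteq> r \<and> ?p u \<in> ?D x" if u: "u \<in> A \<union> B" for u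
    proof (cases "x \<in> A")
      case xA: True
      show ?thesis
      proof (cases "u \<in> A")
        case True
        then show ?thesis using xA DAc[of x u] DA(2)[of x] rab by auto
      next
        case False
        then have "u \<in> B" "u \<noteq> a" using u rab by auto
        moreover have "pB u \<notin> A" if "u \<noteq> r" using pB[of u] notA that \<open>u \<in> B\<close> by auto
        ultimately show ?thesis using xA False DA(2)[of x] by auto
      qed
    next
      case xA: False
      then have xB: "x \<in> B" using x by auto
      have sub: "DB x \<subseteq> B" using DB(2)[OF xB] .
      show ?thesis
      proof (cases "u \<in> A")
        case True
        then have "u \<notin> B" using notA by blast
        then have "u \<notin> DB x" "u \<noteq> x" "u \<noteq> r" using sub xB rab by auto
        moreover have "pA u \<in> A" "pA u \<notin> DB x" if "u \<noteq> a"
          using pA[OF True that] notA sub by auto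
        ultimately show ?thesis using xA True rab by auto
      next
        case False
        then have uB: "u \<in> B" "u \<noteq> a" using u rab by auto
        have "pB u \<notin> A" using pB[OF uB(1)] r notA rab by (cases "u = r") auto
        then show ?thesis using DBc[OF xB uB(1)] xA False uB by auto
      qed
    qed
    show "w {x, ?p x} \<le> w {u, v}"
      if "x \<noteq> r" and uv: "{u, v} \<in> ?E" "u \<in> ?D x" "v \<notin> ?D x" for u v
    proof (cases "{u, v} = {a, b}")
      case True
      have "{x, ?p x} \<in> ?E" using that(1) x pA[of x] pB[of x] by auto
      then show ?thesis using True heavy by auto
    next
      case False
      then have E: "{u, v} \<in> E" "{v, u} \<in> E" using uv by (auto simp: insert_commute)
      show ?thesis
      proof (cases "x \<in> A")
        case xA: True
        then have "u \<in> A" using uv(2) DA(2)[of x] by auto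
        then have "v \<in> A" using closed E by blast
        then have "x \<noteq> a" using uv(3) a(3) xA by auto
        then show ?thesis using cA[of x u v] xA E uv by auto
      next
        case xA: False
        then have xB: "x \<in> B" "x \<noteq> a" using x rab by auto
        \<comment> \<open>Had \<open>u\<close> entered the subtree with \<open>A\<close>, the other
          end of the old edge would lie in \<open>A\<close> as well, hence inside the
          subtree.\<close>
        have "u \<in> DB x"
        proof (rule ccontr)
          assume "u \<notin> DB x"
          then have *: "b \<in> DB x" "u \<in> A" using uv(2) xA by (auto split: if_splits)
          then have "v \<in> A" using closed E by blast
          then show False using uv(3) xA * by auto
        qed
        moreover have "v \<notin> DB x" using uv(3) xA by (auto split: if_splits)
        ultimately show ?thesis using cB[OF xB(1) that(1) E(1)] xA xB by auto
      qed
    qed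
  qed
qed

text \<open>
  The parts of \<open>partial_clustering\<close> are the sets \<open>P v\<close>. A part in \<open>Fr\<close> is a small connected
  component and may still be rooted anywhere. The root of any other part remains the same; if the
  part has fewer than \<open>s\<close> vertices, then it is to be attached by the edge from its root to
  \<open>hook (rt v)\<close>, which lies in a part with at least \<open>s\<close> vertices.
\<close>

definition partial_clustering ::
  "nat \<Rightarrow> nat \<Rightarrow> (nat set \<Rightarrow> real) \<Rightarrow> nat set set \<Rightarrow> (nat \<Rightarrow> nat set) \<Rightarrow> nat set \<Rightarrow> (nat \<Rightarrow> nat) \<Rightarrow>
   (nat \<Rightarrow> nat) \<Rightarrow> (nat \<Rightarrow> nat) \<Rightarrow> (nat \<Rightarrow> nat set) \<Rightarrow> (nat \<Rightarrow> nat) \<Rightarrow> bool" where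
  "partial_clustering s n w E P Fr rt par dep D hook \<longleftrightarrow>
     (\<forall>v<n. v \<in> P v \<and> P v \<subseteq> {..<n} \<and> (\<forall>u\<in>P v. P u = P v) \<and> card (P v) < 2 * s) \<and>
     (\<forall>v<n. v \<in> Fr \<longrightarrow> P v \<subseteq> Fr \<and> card (P v) < s \<and>
        (\<forall>x y. {x, y} \<in> E \<longrightarrow> x \<in> P v \<longrightarrow> y \<in> P v) \<and>
        (\<forall>r\<in>P v. \<exists>par dep D. rooted_tree E w (P v) r par dep D)) \<and>
     (\<forall>v<n. (\<forall>u\<in>P v. rt u = rt v) \<and> rooted_tree E w (P v) (rt v) par dep D) \<and>
     (\<forall>v<n. v \<notin> Fr \<longrightarrow> card (P v) < s \<longrightarrow>
        hook (rt v) < n \<and> hook (rt v) \<notin> Fr \<and> s \<le> card (P (hook (rt v))) \<and>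
        {rt v, hook (rt v)} \<in> E \<and>
        (\<forall>x y. {x, y} \<in> E \<longrightarrow> x \<in> P v \<longrightarrow> y \<notin> P v \<longrightarrow> w {rt v, hook (rt v)} \<le> w {x, y}) \<and>
        (\<forall>x\<in>P (hook (rt v)). x \<noteq> rt (hook (rt v)) \<longrightarrow>
           w {x, par x} \<le> w {rt v, hook (rt v)}))"

lemma
  assumes "partial_clustering s n w E P Fr rt par dep D hook" "v < n"
  shows part_self: "v \<in> P v" and part_sub: "P v \<subseteq> {..<n}"
    and part_eq: "u \<in> P v \<Longrightarrow> P u = P v" and part_card: "card (P v) < 2 * s"
    and part_free: "v \<in> Fr \<Longrightarrow> P v \<subseteq> Fr" "v \<in> Fr \<Longrightarrow> card (P v) < s"
      "v \<in> Fr \<Longrightarrow> {x, y} \<in> E \<Longrightarrow> x \<in> P v \<Longrightarrow> y \<in> P v"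
      "v \<in> Fr \<Longrightarrow> r \<in> P v \<Longrightarrow> \<exists>par dep D. rooted_tree E w (P v) r par dep D"
    and part_root: "u \<in> P v \<Longrightarrow> rt u = rt v" and part_tree: "rooted_tree E w (P v) (rt v) par dep D"
    and part_hook: "v \<notin> Fr \<Longrightarrow> card (P v) < s \<Longrightarrow>
        hook (rt v) < n \<and> hook (rt v) \<notin> Fr \<and> s \<le> card (P (hook (rt v))) \<and> {rt v, hook (rt v)} \<in> E"
      "v \<notin> Fr \<Longrightarrow> card (P v) < s \<Longrightarrow> {x, y} \<in> E \<Longrightarrow> x \<in> P v \<Longrightarrow> y \<notin> P v \<Longrightarrow>
        w {rt v, hook (rt v)} \<le> w {x, y}"
      "v \<notin> Fr \<Longrightarrow> card (P v) < s \<Longrightarrow> x \<in> P (hook (rt v)) \<Longrightarrow> x \<noteq> rt (hook (rt v)) \<Longrightarrow>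
        w {x, par x} \<le> w {rt v, hook (rt v)}"
proof -
  note d = assms(1)[unfolded partial_clustering_def]
  note d1 = d[THEN conjunct1, rule_format, OF assms(2)]
    and d2 = d[THEN conjunct2, THEN conjunct1, rule_format, OF assms(2)]
    and d3 = d[THEN conjunct2, THEN conjunct2, THEN conjunct1, rule_format, OF assms(2)]
    and d4 = d[THEN conjunct2, THEN conjunct2, THEN conjunct2, rule_format, OF assms(2)]
  show "v \<in> P v" "P v \<subseteq> {..<n}" "u \<in> P v \<Longrightarrow> P u = P v" "card (P v) < 2 * s" using d1 by blast+
  show "v \<in> Fr \<Longrightarrow> P v \<subseteq> Fr" "v \<in> Fr \<Longrightarrow> card (P v) < s"
    "v \<in> Fr \<Longrightarrow> {x, y} \<in> E \<Longrightarrow> x \<in> P v \<Longrightarrow> y \<in> P v"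
    "v \<in> Fr \<Longrightarrow> r \<in> P v \<Longrightarrow> \<exists>par dep D. rooted_tree E w (P v) r par dep D" using d2 by blast+
  show "u \<in> P v \<Longrightarrow> rt u = rt v" "rooted_tree E w (P v) (rt v) par dep D" using d3 by blast+
  show "v \<notin> Fr \<Longrightarrow> card (P v) < s \<Longrightarrow>
      hook (rt v) < n \<and> hook (rt v) \<notin> Fr \<and> s \<le> card (P (hook (rt v))) \<and> {rt v, hook (rt v)} \<in> E"
    "v \<notin> Fr \<Longrightarrow> card (P v) < s \<Longrightarrow> {x, y} \<in> E \<Longrightarrow> x \<in> P v \<Longrightarrow> y \<notin> P v \<Longrightarrow>
      w {rt v, hook (rt v)} \<le> w {x, y}"
    "v \<notin> Fr \<Longrightarrow> card (P v) < s \<Longrightarrow> x \<in> P (hook (rt v)) \<Longrightarrow> x \<noteq> rt (hook (rt v)) \<Longrightarrow>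
      w {x, par x} \<le> w {rt v, hook (rt v)}" using d4 by blast+
qed

lemma part_disjoint:
  assumes pc: "partial_clustering s n w E P Fr rt par dep D hook" "v < n" "u < n" "x \<in> P v"
      "x \<in> P u"
  shows "P v = P u"
  using part_eq[OF pc(1,2,4)] part_eq[OF pc(1,3,5)] by simp

lemma part_unfree:
  assumes pc: "partial_clustering s n w E P Fr rt par dep D hook" "v < n" "v \<notin> Fr" "x \<in> P v"
  shows "x \<notin> Fr"
proof
  assume "x \<in> Fr"
  moreover have "x < n" using part_sub[OF pc(1,2)] pc(4) by auto
  ultimately have "P x \<subseteq> Fr" using part_free(1)[OF pc(1)] by blast
  then show False using part_eq[OF pc(1,2,4)] part_self[OF pc(1,2)] pc(3) by auto
qed

abbreviation (input) clusterable :: "nat \<Rightarrow> nat \<Rightarrow> (nat set \<Rightarrow> real) \<Rightarrow> nat set set \<Rightarrow> bool" where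
  "clusterable s n w E \<equiv> \<exists>P Fr rt par dep D hook. partial_clustering s n w E P Fr rt par dep D hook"

section \<open>Partial clusterings along Kruskal's order\<close>

lemma partial_clustering_initial:
  assumes "1 \<le> s"
  shows "clusterable s n w {}"
proof -
  have T: "rooted_tree {} w {r} r id (\<lambda>_. 0) (\<lambda>x. {x})" for r
    by (auto simp: rooted_tree_def)
  \<comment> \<open>For \<open>s = 1\<close> a singleton already counts as big, so no part may be
    free.\<close>
  have "s = 1 \<or> 1 < s" using assms by auto
  then have "partial_clustering s n w {} (\<lambda>v. {v}) (if s = 1 then {} else {..<n}) id id (\<lambda>_. 0) (\<lambda>x.
      {x}) id"
  proof
    assume "1 < s"
    then show ?thesis unfolding partial_clustering_def using T by (intro conjI allI impI) auto
  qed (auto simp: partial_clustering_def T)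
  then show ?thesis by blast
qed

text \<open>The new edge stays inside one part or joins two frozen vertices, so free components
  remain closed. It is at least as heavy as all tree edges and hooks and thus respects every cut
  condition.\<close>

lemma partial_clustering_keep:
  assumes pc: "partial_clustering s n w E P Fr rt par dep D hook"
    and heavy: "\<And>f. f \<in> E \<Longrightarrow> w f \<le> w {a, b}"
    and ab: "a < n" "b < n" "P a = P b \<or> a \<notin> Fr \<and> b \<notin> Fr"
  shows "partial_clustering s n w (insert {a, b} E) P Fr rt par dep D hook"
  unfolding partial_clustering_def
proof (intro conjI allI impI)
  note grow = rooted_tree_insert_edge[where E = E and w = w and e = "{a, b}", OF _ heavy]
  fix v assume v: "v < n"
  show "v \<in> P v" "P v \<subseteq> {..<n}" "\<forall>u\<in>P v. P u = P v" "card (P v) < 2 * s"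
    using part_self[OF pc v] part_sub[OF pc v] part_eq[OF pc v] part_card[OF pc v] by blast+
  {
    assume fr: "v \<in> Fr"
    show "P v \<subseteq> Fr" "card (P v) < s" using part_free[OF pc v fr] by blast+
    show "y \<in> P v" if "{x, y} \<in> insert {a, b} E" "x \<in> P v" for x y
    proof (cases "{x, y} = {a, b}")
      case True
      have "x \<in> Fr" using part_free(1)[OF pc v fr] that by auto
      then have "P x = P y" using True ab(3) by (metis doubleton_eq_iff)
      moreover have "y < n" using True ab by (metis doubleton_eq_iff)
      ultimately show ?thesis using part_self[OF pc \<open>y < n\<close>] part_eq[OF pc v that(2)] by simp
    next
      case False
      then show ?thesis using part_free(3)[OF pc v fr] that by auto
    qed
    show "\<forall>r\<in>P v. \<exists>par dep D. rooted_tree (insert {a, b} E) w (P v) r par dep D"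
      using part_free(4)[OF pc v fr] grow by blast
  }
  show "\<forall>u\<in>P v. rt u = rt v" using part_root[OF pc v] by blast
  show "rooted_tree (insert {a, b} E) w (P v) (rt v) par dep D"
    using part_tree[OF pc v] grow by blast
  {
    assume fr: "v \<notin> Fr"
    assume small: "card (P v) < s"
    note hk = part_hook[OF pc v fr small]
    show "hook (rt v) < n" "hook (rt v) \<notin> Fr" "s \<le> card (P (hook (rt v)))"
      "{rt v, hook (rt v)} \<in> insert {a, b} E" using hk(1) by auto
    show "w {rt v, hook (rt v)} \<le> w {x, y}" if "{x, y} \<in> insert {a, b} E" "x \<in> P v" "y \<notin> P v"
        for x y
      using that hk(1) hk(2)[of x y] heavy by auto
    show "\<forall>x\<in>P (hook (rt v)). x \<noteq> rt (hook (rt v)) \<longrightarrow> w {x, par x} \<le> w {rt v, hook (rt v)}"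
      using hk(3) by blast
  }
qed

text \<open>The common core of all changes of a free part: \<open>U\<close> becomes a single part
  with root \<open>r\<close> and is either frozen or still a small free component. Conditions on the
  hook \<open>h\<close> are only imposed if \<open>U\<close> ends up small and frozen.\<close>

lemma partial_clustering_update:
  assumes pc: "partial_clustering s n w E P Fr rt par dep D hook"
    and heavy: "\<And>f. f \<in> E \<Longrightarrow> w f \<le> w {a, b}"
    and U: "U \<subseteq> {..<n}" "\<And>u. u \<in> U \<Longrightarrow> P u \<subseteq> U" "\<And>u. u \<in> U \<Longrightarrow> card (P u) < s"
    and ab: "a \<in> U" "b \<in> U \<or> b \<notin> Fr"
    and tree: "rooted_tree (insert {a, b} E) w U r par' dep' D'" and card: "card U < 2 * s"
    and F: "F = Fr - U \<or> F = Fr \<and> U \<subseteq> Fr \<and> card U < s \<and>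
      (\<forall>x y. {x, y} \<in> insert {a, b} E \<longrightarrow> x \<in> U \<longrightarrow> y \<in> U) \<and>
      (\<forall>r\<in>U. \<exists>par dep D. rooted_tree (insert {a, b} E) w U r par dep D)"
    and hook: "r \<notin> F \<Longrightarrow> card U < s \<Longrightarrow> h < n \<and> h \<notin> Fr \<and> h \<notin> U \<and> s \<le> card (P h) \<and>
        {r, h} \<in> insert {a, b} E"
      "\<And>x y. r \<notin> F \<Longrightarrow> card U < s \<Longrightarrow> {x, y} \<in> insert {a, b} E \<Longrightarrow> x \<in> U \<Longrightarrow> y \<notin> U \<Longrightarrow> w {r, h} \<le> w {x, y}"
      "\<And>x. r \<notin> F \<Longrightarrow> card U < s \<Longrightarrow> x \<in> P h \<Longrightarrow> x \<noteq> rt h \<Longrightarrow> w {x, par x} \<le> w {r, h}"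
  shows "clusterable s n w (insert {a, b} E)"
proof -
  note grow = rooted_tree_insert_edge[where E = E and w = w and e = "{a, b}", OF _ heavy]
  define P' where "P' v = (if v \<in> U then U else P v)" for v
  define rt' where "rt' v = (if v \<in> U then r else rt v)" for v
  define par'' where "par'' v = (if v \<in> U then par' v else par v)" for v
  define dep'' where "dep'' v = (if v \<in> U then dep' v else dep v)" for v
  define D'' where "D'' v = (if v \<in> U then D' v else D v)" for v
  have rU: "r \<in> U" using tree by (simp add: rooted_tree_def)
  have FF: "F \<subseteq> Fr" "v \<in> F \<longleftrightarrow> v \<in> Fr" if "v \<notin> U" for v using F that by auto
  have out: "x \<notin> U" if "v < n" "v \<notin> U" "x \<in> P v" for v x
  proof
    assume "x \<in> U"
    then have "P x \<subseteq> U" by (rule U(2))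
    then show False using part_eq[OF pc that(1,3)] part_self[OF pc that(1)] that(2) by auto
  qed
  have "partial_clustering s n w (insert {a, b} E) P' F rt' par'' dep'' D'' (hook(r := h))"
    unfolding partial_clustering_def
  proof (intro conjI allI impI)
    fix v assume v: "v < n"
    show "v \<in> P' v" using part_self[OF pc v] by (simp add: P'_def)
    show "P' v \<subseteq> {..<n}" using part_sub[OF pc v] U(1) by (simp add: P'_def)
    show "\<forall>u\<in>P' v. P' u = P' v" using part_eq[OF pc v] out[OF v] by (auto simp: P'_def)
    show "card (P' v) < 2 * s" using part_card[OF pc v] card by (simp add: P'_def)
    {
      assume vF: "v \<in> F"
      have "P' v \<subseteq> F \<and> card (P' v) < s \<and> (\<forall>x y. {x, y} \<in> insert {a, b} E \<longrightarrow> x \<in> P' v \<longrightarrow> y \<in> P' v) \<and>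
        (\<forall>r\<in>P' v. \<exists>par dep D. rooted_tree (insert {a, b} E) w (P' v) r par dep D)"
      proof (cases "v \<in> U")
        case True
        then show ?thesis using F vF by (auto simp: P'_def)
      next
        case False
        then have fr: "v \<in> Fr" and P'v: "P' v = P v" using FF vF by (auto simp: P'_def)
        note f = part_free[OF pc v fr]
        have "y \<in> P v" if "{x, y} \<in> insert {a, b} E" "x \<in> P v" for x y
        proof -
          have "x \<in> Fr" "x \<notin> U" using that(2) out[OF v False] f(1) by auto
          then have "x \<noteq> a" "x \<noteq> b" using ab by auto
          then have "{x, y} \<in> E" using that(1) by (auto simp: doubleton_eq_iff)
          then show ?thesis using f(3) that(2) by simp
        qed
        moreover have "P v \<subseteq> F" using f(1) out[OF v False] FF(2) by blast
        moreover have "\<exists>par dep D. rooted_tree (insert {a, b} E) w (P v) r par dep D" if "r \<in> P v"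
            for r
          using f(4)[OF that] grow by blast
        ultimately show ?thesis unfolding P'v using f(2) by blast
      qed
      then show "P' v \<subseteq> F" "card (P' v) < s"
        "\<forall>r\<in>P' v. \<exists>par dep D. rooted_tree (insert {a, b} E) w (P' v) r par dep D"
        "\<And>x y. {x, y} \<in> insert {a, b} E \<Longrightarrow> x \<in> P' v \<Longrightarrow> y \<in> P' v"
        by blast+
    }
    show "\<forall>u\<in>P' v. rt' u = rt' v"
      using part_root[OF pc v] out[OF v] by (auto simp: P'_def rt'_def)
    show "rooted_tree (insert {a, b} E) w (P' v) (rt' v) par'' dep'' D''"
    proof (cases "v \<in> U")
      case True
      then show ?thesis using tree
        by (simp add: P'_def rt'_def)
          (rule rooted_tree_cong, auto simp: par''_def dep''_def D''_def)
    next
      case False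
      have "rooted_tree (insert {a, b} E) w (P v) (rt v) par dep D"
        using part_tree[OF pc v] grow by blast
      then have "rooted_tree (insert {a, b} E) w (P v) (rt v) par'' dep'' D''"
        by (rule rooted_tree_cong) (use out[OF v False] in \<open>auto simp: par''_def dep''_def D''_def\<close>)
      then show ?thesis using False by (simp add: P'_def rt'_def)
    qed
    {
      assume vF: "v \<notin> F"
      assume small: "card (P' v) < s"
      let ?h = "(hook(r := h)) (rt' v)"
      have main: "?h < n \<and> ?h \<notin> F \<and> s \<le> card (P' ?h) \<and> {rt' v, ?h} \<in> insert {a, b} E \<and>
        (\<forall>x y. {x, y} \<in> insert {a, b} E \<longrightarrow> x \<in> P' v \<longrightarrow> y \<notin> P' v \<longrightarrow> w {rt' v, ?h} \<le> w {x, y}) \<and>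
        (\<forall>x\<in>P' ?h. x \<noteq> rt' ?h \<longrightarrow> w {x, par'' x} \<le> w {rt' v, ?h})"
      proof (cases "v \<in> U")
        case True
        then have v': "P' v = U" "rt' v = r" "?h = h" and s: "card U < s"
          using small by (auto simp: P'_def rt'_def)
        have rF: "r \<notin> F" using F vF True rU by blast
        have h: "h < n" "h \<notin> U" "h \<notin> F" using hook(1)[OF rF s] FF(1) by auto
        have "P' h = P h" "rt' h = rt h" using h by (auto simp: P'_def rt'_def)
        moreover have "par'' x = par x" if "x \<in> P h" for x
          using out[OF h(1,2) that] by (simp add: par''_def)
        ultimately show ?thesis using hook(1)[OF rF s] hook(2,3)[OF rF s] v' h by auto
      next
        case False
        then have vFr: "v \<notin> Fr" using FF(2) vF by blast
        have s: "card (P v) < s" and P'v: "P' v = P v" "rt' v = rt v"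
          using small False by (auto simp: P'_def rt'_def)
        note hk = part_hook[OF pc v vFr s]
        have "rt v \<in> P v" using part_tree[OF pc v] by (simp add: rooted_tree_def)
        then have "rt v \<noteq> r" using out[OF v False] rU by blast
        then have h: "?h = hook (rt v)" using P'v by simp
        \<comment> \<open>\<open>U\<close> is assembled from small parts, whereas hooks point into
          parts with at least \<open>s\<close> vertices; so no existing hook loses its
          target.\<close>
        have hU: "hook (rt v) \<notin> U" using hk(1) U(3) by (meson leD)
        have "P' (hook (rt v)) = P (hook (rt v))" "rt' (hook (rt v)) = rt (hook (rt v))"
          using hU by (auto simp: P'_def rt'_def)
        moreover have "par'' x = par x" if "x \<in> P (hook (rt v))" for x
          using out[OF _ hU that] hk(1) by (simp add: par''_def)
        moreover have "w {rt v, hook (rt v)} \<le> w {x, y}"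
          if "{x, y} \<in> insert {a, b} E" "x \<in> P v" "y \<notin> P v" for x y
          using that hk(1) hk(2)[of x y] heavy by auto
        moreover have "w {x, par x} \<le> w {rt v, hook (rt v)}"
          if "x \<in> P (hook (rt v))" "x \<noteq> rt (hook (rt v))" for x using hk(3) that .
        ultimately show ?thesis unfolding h unfolding P'v using hk(1) FF(2)[OF hU] by simp
      qed
      then show "?h < n" "?h \<notin> F" "s \<le> card (P' ?h)" "{rt' v, ?h} \<in> insert {a, b} E"
        "\<forall>x\<in>P' ?h. x \<noteq> rt' ?h \<longrightarrow> w {x, par'' x} \<le> w {rt' v, ?h}"
        by blast+
      show "w {rt' v, ?h} \<le> w {x, y}"
        if "{x, y} \<in> insert {a, b} E" "x \<in> P' v" "y \<notin> P' v" for x y using main that by blast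
    }
  qed
  then show ?thesis by blast
qed

text \<open>If the part of \<open>b\<close> is small, the two parts are merged and have fewer than
  \<open>2 * s\<close> vertices together. If it is big, the part of \<open>a\<close> is re-rooted at
  \<open>a\<close> and frozen with the new edge as its hook: this is the first edge to leave the
  component and at least as heavy as everything in the big tree.\<close>

lemma partial_clustering_free:
  assumes pc: "partial_clustering s n w E P Fr rt par dep D hook"
    and heavy: "\<And>f. f \<in> E \<Longrightarrow> w f \<le> w {a, b}"
    and ab: "a < n" "b < n" "a \<in> Fr" "P a \<noteq> P b"
  shows "clusterable s n w (insert {a, b} E)"
proof -
  note fa = part_free[OF pc ab(1,3)]
  have disj: "P a \<inter> P b = {}" using part_disjoint[OF pc ab(1,2)] ab(4) by blast
  have self: "a \<in> P a" "b \<in> P b" using part_self[OF pc] ab by auto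
  obtain pA dA DA where A: "rooted_tree E w (P a) a pA dA DA" using fa(4)[OF self(1)] by blast
  have eqa: "P u = P a" if "u \<in> P a" for u using part_eq[OF pc ab(1) that] .
  have eqb: "P u = P b" if "u \<in> P b" for u using part_eq[OF pc ab(2) that] .
  show ?thesis
  proof (cases "card (P b) < s")
    case small: True
    \<comment> \<open>A frozen part must keep its root, since its hook starts there; a free part may
      be rooted at \<open>b\<close>.\<close>
    define r where "r = (if b \<in> Fr then b else rt b)"
    obtain pB dB DB where B: "rooted_tree E w (P b) r pB dB DB"
      using part_free(4)[OF pc ab(2) _ self(2)] part_tree[OF pc ab(2)] unfolding r_def
      by (metis (full_types))
    have J: "rooted_tree (insert {a, b} E) w (P a \<union> P b) r
          (\<lambda>x. if x = a then b else if x \<in> P a then pA x else pB x)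
          (\<lambda>x. if x \<in> P a then Suc (dB b + dA x) else dB x)
          (\<lambda>x. if x \<in> P a then DA x else if b \<in> DB x then DB x \<union> P a else DB x)"
      by (rule rooted_tree_join[OF B A disj self(2)]) (use fa(3) heavy in blast)+
    define F where "F = (if b \<in> Fr \<and> card (P a \<union> P b) < s then Fr else Fr - (P a \<union> P b))"
    have trees: "\<exists>par dep D. rooted_tree (insert {a, b} E) w (P a \<union> P b) r par dep D"
      if bF: "b \<in> Fr" and rU: "r \<in> P a \<union> P b" for r
    proof (cases "r \<in> P b")
      case True
      obtain pB dB DB where "rooted_tree E w (P b) r pB dB DB"
        using part_free(4)[OF pc ab(2) bF True] by blast
      from rooted_tree_join[OF this A disj self(2)] show ?thesis using fa(3) heavy by blast
    next
      \<comment> \<open>For a root inside \<open>P a\<close> the roles are exchanged: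
        \<open>P b\<close> is re-rooted at \<open>b\<close> and hung below \<open>a\<close>.\<close>
      case False
      then have "r \<in> P a" using rU by blast
      then obtain pB dB DB pA dA DA
        where *: "rooted_tree E w (P a) r pA dA DA" "rooted_tree E w (P b) b pB dB DB"
        using fa(4)[of r] part_free(4)[OF pc ab(2) bF self(2)] by blast
      have "P b \<inter> P a = {}" using disj by blast
      from rooted_tree_join[OF * this self(1)]
      have "\<exists>par dep D. rooted_tree (insert {b, a} E) w (P b \<union> P a) r par dep D"
        using part_free(3)[OF pc ab(2) bF] heavy by (simp add: insert_commute) blast
      then show ?thesis by (simp add: Un_commute insert_commute)
    qed
    have closed: "y \<in> P a \<union> P b" if "b \<in> Fr" "{x, y} \<in> insert {a, b} E" "x \<in> P a \<union> P b" for x y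
      using that fa(3) part_free(3)[OF pc ab(2) that(1)] self by (auto simp: doubleton_eq_iff)
    show ?thesis
    proof (rule partial_clustering_update[OF pc heavy, where U = "P a \<union> P b" and h = "hook (rt b)"
          and F = F])
      show "P a \<union> P b \<subseteq> {..<n}" using part_sub[OF pc] ab by auto
      show "P u \<subseteq> P a \<union> P b" "card (P u) < s" if "u \<in> P a \<union> P b" for u
        using that eqa[of u] eqb[of u] fa(2) small by (metis Un_iff Un_upper1 Un_upper2)+
      show "a \<in> P a \<union> P b" "b \<in> P a \<union> P b \<or> b \<notin> Fr" using self by auto
      show "card (P a \<union> P b) < 2 * s" using card_Un_le[of "P a" "P b"] fa(2) small by linarith
      show "rooted_tree (insert {a, b} E) w (P a \<union> P b) r
        (\<lambda>x. if x = a then b else if x \<in> P a then pA x else pB x)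
        (\<lambda>x. if x \<in> P a then Suc (dB b + dA x) else dB x)
        (\<lambda>x. if x \<in> P a then DA x else if b \<in> DB x then DB x \<union> P a else DB x)"
        by (fact J)
      show "F = Fr - (P a \<union> P b) \<or> F = Fr \<and> P a \<union> P b \<subseteq> Fr \<and> card (P a \<union> P b) < s \<and>
        (\<forall>x y. {x, y} \<in> insert {a, b} E \<longrightarrow> x \<in> P a \<union> P b \<longrightarrow> y \<in> P a \<union> P b) \<and>
        (\<forall>r\<in>P a \<union> P b. \<exists>par dep D. rooted_tree (insert {a, b} E) w (P a \<union> P b) r par dep D)"
        using trees closed fa(1) part_free(1)[OF pc ab(2)] unfolding F_def by auto
      assume rF: "r \<notin> F" and cU: "card (P a \<union> P b) < s"
      have b: "b \<notin> Fr" and r: "r = rt b"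
        using rF cU self(2) by (auto simp: F_def r_def split: if_splits)
      note hk = part_hook[OF pc ab(2) b small]
      have hU: "hook (rt b) \<notin> P a \<union> P b"
        using hk(1) eqa eqb fa(2) small by (metis Un_iff leD)
      show "hook (rt b) < n \<and> hook (rt b) \<notin> Fr \<and> hook (rt b) \<notin> P a \<union> P b \<and>
        s \<le> card (P (hook (rt b))) \<and> {r, hook (rt b)} \<in> insert {a, b} E"
        using hk(1) hU r by auto
      show "w {r, hook (rt b)} \<le> w {x, y}"
        if "{x, y} \<in> insert {a, b} E" "x \<in> P a \<union> P b" "y \<notin> P a \<union> P b" for x y
      proof -
        \<comment> \<open>An edge that leaves the union is old and starts in \<open>P b\<close>,
          because \<open>P a\<close> was a whole component; so the old comparison with the hook
          applies.\<close>
        have xy: "{x, y} \<in> E" using that self by (auto simp: doubleton_eq_iff)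
        then have "x \<in> P b" using fa(3) that by blast
        then show ?thesis using hk(2)[OF xy] that r by auto
      qed
      show "w {x, par x} \<le> w {r, hook (rt b)}" if "x \<in> P (hook (rt b))" "x \<noteq> rt (hook (rt b))"
          for x
        using hk(3) that r by simp
    qed
  next
    case big: False
    then have b: "b \<notin> Fr" using part_free(2)[OF pc ab(2)] by blast
    show ?thesis
    proof (rule partial_clustering_update[OF pc heavy, where U = "P a" and h = b and r = a
          and F = "Fr - P a"])
      show "P a \<subseteq> {..<n}" using part_sub[OF pc ab(1)] .
      show "P u \<subseteq> P a" "card (P u) < s" if "u \<in> P a" for u using eqa[OF that] fa(2) by simp_all
      show "a \<in> P a" "b \<in> P a \<or> b \<notin> Fr" using self b by auto
      show "card (P a) < 2 * s" using fa(2) by simp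
      show "rooted_tree (insert {a, b} E) w (P a) a pA dA DA"
        using rooted_tree_insert_edge[OF A, of "{a, b}"] heavy by blast
      show "Fr - P a = Fr - P a \<or> Fr - P a = Fr \<and> P a \<subseteq> Fr \<and> card (P a) < s \<and>
        (\<forall>x y. {x, y} \<in> insert {a, b} E \<longrightarrow> x \<in> P a \<longrightarrow> y \<in> P a) \<and>
        (\<forall>r\<in>P a. \<exists>par dep D. rooted_tree (insert {a, b} E) w (P a) r par dep D)" by simp
      show "b < n \<and> b \<notin> Fr \<and> b \<notin> P a \<and> s \<le> card (P b) \<and> {a, b} \<in> insert {a, b} E"
        using ab b big self disj by auto
      show "w {a, b} \<le> w {x, y}" if "{x, y} \<in> insert {a, b} E" "x \<in> P a" "y \<notin> P a" for x y
        using that fa(3) by (metis insertE order_refl)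
      show "w {x, par x} \<le> w {a, b}" if "x \<in> P b" "x \<noteq> rt b" for x
        using part_tree[OF pc ab(2)] that heavy unfolding rooted_tree_def by blast
    qed
  qed
qed

text \<open>The ranking induction inserts the edges by increasing weight; this supplies the
  assumption that no earlier edge is heavier than the new one.\<close>

lemma partial_clustering_exists:
  assumes "finite E" "\<forall>e\<in>E. \<exists>u v. u < n \<and> v < n \<and> e = {u, v}" "1 \<le> s"
  shows "clusterable s n w E"
  using assms(1,2)
proof (induction E rule: finite_ranking_induct[where f = w])
  case empty
  then show ?case using partial_clustering_initial[OF assms(3)] by blast
next
  case (insert e E)
  obtain a b where e: "e = {a, b}" and ab: "a < n" "b < n" using insert.prems by blast
  obtain P Fr rt par dep D hook where pc: "partial_clustering s n w E P Fr rt par dep D hook"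
    using insert by blast
  have heavy: "w f \<le> w {a, b}" "w f \<le> w {b, a}" if "f \<in> E" for f
    using insert.hyps(2) that e by (auto simp: insert_commute)
  consider "P a = P b \<or> a \<notin> Fr \<and> b \<notin> Fr" | "P a \<noteq> P b" "a \<in> Fr" | "P a \<noteq> P b" "b \<in> Fr" by blast
  then show ?case
  proof cases
    case 1
    then show ?thesis using partial_clustering_keep[OF pc heavy(1) ab] e by blast
  next
    case 2
    then show ?thesis using partial_clustering_free[OF pc heavy(1) ab] e by blast
  next
    case 3
    then show ?thesis using partial_clustering_free[OF pc heavy(2) ab(2,1)] e
      by (metis insert_commute)
  qed
qed

text \<open>
  \<open>D x\<close> is the set of descendants of \<open>x\<close> in the forest with the parents \<open>par\<close> and the depths
  \<open>dep\<close>, \<open>rt v\<close> is the root of the tree of \<open>v\<close>, and \<open>R\<close> contains the root of every cluster that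
  is not a whole component.
\<close>

definition clustering ::
  "nat \<Rightarrow> nat \<Rightarrow> nat set set \<Rightarrow> (nat set \<Rightarrow> real) \<Rightarrow> (nat \<Rightarrow> nat) \<Rightarrow> (nat \<Rightarrow> nat) \<Rightarrow> (nat \<Rightarrow> nat set) \<Rightarrow>
   (nat \<Rightarrow> nat) \<Rightarrow> nat set \<Rightarrow> bool" where
  "clustering s n E w par dep D rt R \<longleftrightarrow>
     (\<forall>v<n. par v < n \<and> rt v < n \<and> dep v < 3 * s \<and> dep v \<le> 2 * n \<and> rt (par v) = rt v) \<and>
     (\<forall>v<n. if v = rt v then par v = v \<and> dep v = 0 else {v, par v} \<in> E \<and>
         dep v = Suc (dep (par v))) \<and>
     (\<forall>x<n. \<forall>u<n. u \<in> D x \<longleftrightarrow> u = x \<or> u \<noteq> rt u \<and> par u \<in> D x) \<and>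
     (\<forall>x<n. \<forall>u\<in>D x. u < n \<and> rt u = rt x) \<and>
     (\<forall>x<n. x \<noteq> rt x \<longrightarrow> (\<forall>u v. {u, v} \<in> E \<longrightarrow> u \<in> D x \<longrightarrow> v \<notin> D x \<longrightarrow> w {x, par x} \<le> w {u, v})) \<and>
     R \<subseteq> {..<n} \<and> s * card R \<le> n \<and>
     (\<forall>u v. {u, v} \<in> E \<longrightarrow> rt u \<noteq> rt v \<longrightarrow> rt u \<in> R)"

section \<open>Clusters: big parts together with the small parts hooked onto them\<close>

lemma weighted_graph_edge:
  assumes "weighted_graph n E w" "{u, v} \<in> E"
  shows "u < n" "v < n"
proof -
  obtain x y where "x < n" "y < n" "{u, v} = {x, y}"
    using assms unfolding weighted_graph_def by blast
  then show "u < n" "v < n" by (auto simp: doubleton_eq_iff)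
qed

lemma weighted_graph_finite:
  assumes "weighted_graph n E w"
  shows "finite E"
proof (rule finite_subset)
  show "E \<subseteq> Pow {..<n}" using assms unfolding weighted_graph_def by fastforce
qed simp

text \<open>Every hooked part is hung onto the big part that its hook points to. Targets are never
  hooked themselves, so there is one level of hanging only. A part that is still free in the end is
  a whole component and has no root in \<open>R\<close>.\<close>

lemma clustering_exists:
  assumes G: "weighted_graph n E w" and s: "1 \<le> s"
  shows "\<exists>par dep D rt R. clustering s n E w par dep D rt R"
proof -
  have "\<forall>e\<in>E. \<exists>u v. u < n \<and> v < n \<and> e = {u, v}" using G[unfolded weighted_graph_def, THEN conjunct1]
      by metis
  from partial_clustering_exists[OF weighted_graph_finite[OF G] this s]
  obtain P Fr rt par dep D hook where pc: "partial_clustering s n w E P Fr rt par dep D hook"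
      by blast
  have edge: "u < n" "v < n" if "{u, v} \<in> E" for u v using weighted_graph_edge[OF G that] by auto
  have Pfin: "finite (P v)" if "v < n" for v using part_sub[OF pc that] finite_subset by blast
  have frP: "u \<in> Fr \<longleftrightarrow> v \<in> Fr" if "v < n" "u \<in> P v" for u v
    using part_free(1)[OF pc that(1)] part_unfree[OF pc that(1) _ that(2)] that(2) by blast
  have ltP: "u < n" if "v < n" "u \<in> P v" for u v using part_sub[OF pc that(1)] that(2) by auto
  have eqP: "P u = P v" if "v < n" "u \<in> P v" for u v using part_eq[OF pc that] .
  have rtP: "rt u = rt v" if "v < n" "u \<in> P v" for u v using part_root[OF pc that] .
  have tree: "rooted_tree E w (P v) (rt v) par dep D" if "v < n" for v using part_tree[OF pc that] .
  have self: "v \<in> P v" if "v < n" for v using part_self[OF pc that] .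
  have t_root: "rt v \<in> P v" "par (rt v) = rt v" "dep (rt v) = 0" if "v < n" for v
    using tree[OF that] unfolding rooted_tree_def by auto
  have t_par: "par v \<in> P v" "{v, par v} \<in> E" "dep v = Suc (dep (par v))"
    if "v < n" "v \<noteq> rt v" for v
    using tree[OF that(1)] that self[OF that(1)] unfolding rooted_tree_def by auto
  have t_dep: "dep v < card (P v)" "D v \<subseteq> P v" if "v < n" for v
    using tree[OF that(1)] self[OF that(1)] unfolding rooted_tree_def by auto
  have t_D: "u \<in> D x \<longleftrightarrow> u = x \<or> u \<noteq> rt x \<and> par u \<in> D x" if "x < n" "u \<in> P x" for u x
    using tree[OF that(1)] self[OF that(1)] that(2) unfolding rooted_tree_def by blast
  have t_cut: "w {x, par x} \<le> w {u, v}"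
    if "x < n" "x \<noteq> rt x" "{u, v} \<in> E" "u \<in> D x" "v \<notin> D x" for x u v
    using tree[OF that(1)] self[OF that(1)] that unfolding rooted_tree_def by blast
  define hooked where "hooked v \<longleftrightarrow> v \<notin> Fr \<and> card (P v) < s" for v
  have hookedP: "hooked u \<longleftrightarrow> hooked v" if "v < n" "u \<in> P v" for u v
    using frP[OF that] eqP[OF that] by (simp add: hooked_def)
  define hk where "hk v = hook (rt v)" for v
  have hkP: "hk u = hk v" if "v < n" "u \<in> P v" for u v using rtP[OF that] by (simp add: hk_def)
  have hk: "hk v < n" "hk v \<notin> Fr" "s \<le> card (P (hk v))" "{rt v, hk v} \<in> E" "\<not> hooked (hk v)"
    "hk v \<notin> P v"
    if "v < n" "hooked v" for v
  proof -
    have "hk v < n \<and> hk v \<notin> Fr \<and> s \<le> card (P (hk v)) \<and> {rt v, hk v} \<in> E"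
      using part_hook(1)[OF pc that(1)] that(2) unfolding hooked_def hk_def by auto
    then show "hk v < n" "hk v \<notin> Fr" "s \<le> card (P (hk v))" "{rt v, hk v} \<in> E"
        and nh: "\<not> hooked (hk v)"
      by (auto simp: hooked_def)
    show "hk v \<notin> P v" using nh that hookedP by blast
  qed
  have hk_cut: "w {rt v, hk v} \<le> w {x, y}"
    if "v < n" "hooked v" "{x, y} \<in> E" "x \<in> P v" "y \<notin> P v" for v x y
    using part_hook(2)[OF pc that(1) _ _ that(3-5)] that(2) unfolding hooked_def hk_def
        by auto
  have hk_heavy: "w {x, par x} \<le> w {rt v, hk v}"
    if "v < n" "hooked v" "x \<in> P (hk v)" "x \<noteq> rt x" for v x
  proof -
    have h: "hk v < n" "hk v \<notin> Fr" using hk[OF that(1,2)] by auto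
    have "x \<notin> Fr" using frP[OF h(1) that(3)] h(2) by simp
    moreover have "rt x = rt (hk v)" using rtP[OF h(1) that(3)] .
    ultimately show ?thesis using part_hook(3)[OF pc that(1), of x] that
      unfolding hooked_def hk_def by simp
  qed
  define par1 where "par1 v = (if hooked v \<and> v = rt v then hk v else par v)" for v
  define rt1 where "rt1 v = (if hooked v then rt (hk v) else rt v)" for v
  define dep1 where "dep1 v = (if hooked v then Suc (dep (hk v) + dep v) else dep v)" for v
  \<comment> \<open>Hanging a part below \<open>hk u\<close> puts it as a whole into the subtrees of
    all \<open>x\<close> with \<open>hk u \<in> D x\<close>; nothing is ever hung below a hooked
    part.\<close>
  define D1 where "D1 x = (if hooked x then D x else D x \<union> {u. u < n \<and> hooked u \<and> hk u \<in> D x})"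
      for x
  define R where "R = rt ` {v. v < n \<and> v \<notin> Fr \<and> s \<le> card (P v)}"
  have par_P: "par v \<in> P v" if "v < n" for v
    using t_par(1)[OF that] t_root[OF that] by metis
  have hooked_rt1: "v \<noteq> rt1 v" if "v < n" "hooked v" for v
  proof
    assume "v = rt1 v"
    then have "v \<in> P (hk v)" using t_root(1)[OF hk(1)[OF that]] that by (simp add: rt1_def)
    then have "hooked v \<longleftrightarrow> hooked (hk v)" by (rule hookedP[OF hk(1)[OF that]])
    then show False using hk(5)[OF that] that by simp
  qed
  have rt1P: "rt1 u = rt1 v" if "v < n" "u \<in> P v" for u v
    using rtP[OF that] hkP[OF that] hookedP[OF that] by (simp add: rt1_def)
  have rt1_hk: "rt1 (hk v) = rt1 v" if "v < n" "hooked v" for v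
    using hk(5)[OF that] that by (simp add: rt1_def)
  have "clustering s n E w par1 dep1 D1 rt1 R"
    unfolding clustering_def
  proof (intro conjI allI impI ballI)
    fix v assume v: "v < n"
    show "par1 v < n" using par_P[OF v] ltP[OF v] hk(1)[OF v] by (simp add: par1_def)
    show "rt1 v < n" using t_root(1) hk(1)[OF v] ltP v unfolding rt1_def by (metis)
    show "dep1 v < 3 * s"
    proof (cases "hooked v")
      case True
      \<comment> \<open>At most \<open>2 * s - 1\<close> in the big part, one for the hook, and at
        most \<open>s - 1\<close> in the hooked part stay below \<open>3 * s\<close>.\<close>
      have "dep (hk v) < 2 * s" using t_dep(1)[OF hk(1)[OF v True]] part_card[OF pc hk(1)[OF v
          True]] by simp
      then show ?thesis using True t_dep(1)[OF v] by (simp add: dep1_def hooked_def)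
    next
      case False
      then show ?thesis using t_dep(1)[OF v] part_card[OF pc v] by (simp add: dep1_def)
    qed
    have d: "dep u < n" if "u < n" for u
      using t_dep(1)[OF that] card_mono[OF _ part_sub[OF pc that]] by simp
    show "dep1 v \<le> 2 * n" using d[OF v] d[OF hk(1)[OF v]] by (auto simp: dep1_def)
    show "rt1 (par1 v) = rt1 v"
      using rt1P[OF v par_P[OF v]] rt1_hk[OF v] by (simp add: par1_def)
    show "if v = rt1 v then par1 v = v \<and> dep1 v = 0 else {v, par1 v} \<in> E \<and>
        dep1 v = Suc (dep1 (par1 v))"
    proof (cases "hooked v")
      case h: True
      note hv = hk[OF v h]
      show ?thesis
      proof (cases "v = rt v")
        case True
        then have "par1 v = hk v" "{v, hk v} \<in> E" "dep1 v = Suc (dep (hk v))"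
          using h hv(4) t_root(3)[OF v] by (auto simp: par1_def dep1_def)
        then show ?thesis using hooked_rt1[OF v h] hv(5) by (simp add: dep1_def)
      next
        case False
        note p = t_par[OF v False]
        have "hooked (par v)" "hk (par v) = hk v" using hookedP[OF v p(1)] hkP[OF v p(1)] h
            by auto
        then show ?thesis using p h False hooked_rt1[OF v h] by (simp add: par1_def dep1_def)
      qed
    next
      case h: False
      show ?thesis
      proof (cases "v = rt v")
        case True
        then show ?thesis using h t_root[OF v] by (simp add: par1_def dep1_def rt1_def)
      next
        case False
        note p = t_par[OF v False]
        then show ?thesis using p h False hookedP[OF v p(1)]
            by (simp add: par1_def dep1_def rt1_def)
      qed
    qed
  next
    fix x u assume x: "x < n" and u: "u < n"
    show "u \<in> D1 x \<longleftrightarrow> u = x \<or> u \<noteq> rt1 u \<and> par1 u \<in> D1 x"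
    proof (cases "hooked x")
      case hx: True
      then have D1: "D1 x = D x" by (simp add: D1_def)
      have sub: "D x \<subseteq> P x" using t_dep(2)[OF x] .
      show ?thesis
      proof (cases "u \<in> P x")
        case True
        have hu: "hooked u" using hookedP[OF x True] hx by simp
        have r: "rt u = rt x" using rtP[OF x True] .
        have "hk u \<notin> P x" using hk(6)[OF u hu] eqP[OF x True] by simp
        then have "hk u \<notin> D x" using sub by blast
        then show ?thesis using t_D[OF x True] hooked_rt1[OF u hu] D1 r hu by (auto simp: par1_def)
      next
        case False
        have "par1 u \<notin> D x"
        proof
          assume "par1 u \<in> D x"
          then have p: "par1 u \<in> P x" using sub by blast
          show False
          proof (cases "hooked u \<and> u = rt u")
            case True
            then show False using p hk(5)[OF u] hookedP[OF x p] hx by (simp add: par1_def)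
          next
            case nh: False
            then have "par1 u = par u" unfolding par1_def by (rule if_not_P)
            then have "par1 u \<in> P u" using par_P[OF u] by simp
            then have "P u = P x" using eqP[OF x p] eqP[OF u] by simp
            then show False using False self[OF u] by simp
          qed
        qed
        moreover have "u \<noteq> x" "u \<notin> D x" using False self[OF x] sub by auto
        ultimately show ?thesis using D1 by simp
      qed
    next
      case hx: False
      have D1: "D1 x = D x \<union> {u. u < n \<and> hooked u \<and> hk u \<in> D x}" using hx by (simp add: D1_def)
      have sub: "D x \<subseteq> P x" using t_dep(2)[OF x] .
      have nh: "\<not> hooked y" if "y \<in> P x" for y using hookedP[OF x that] hx by simp
      show ?thesis
      proof (cases "u \<in> P x")
        case True
        have "par1 u = par u" "rt1 u = rt x" "\<not> hooked (par u)"
          using nh[OF True] rtP[OF x True] par_P[OF u] eqP[OF x True] nh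
              by (auto simp: par1_def rt1_def)
        then show ?thesis using t_D[OF x True] nh[OF True] D1 by auto
      next
        case uP: False
        then have ux: "u \<noteq> x" "u \<notin> D x" using self[OF x] sub by auto
        show ?thesis
        proof (cases "hooked u")
          case hu: True
          have "par1 u \<in> D1 x \<longleftrightarrow> hk u \<in> D x"
          proof (cases "u = rt u")
            case True
            then show ?thesis using hu hk(5)[OF u hu] D1 by (simp add: par1_def)
          next
            case False
            note p = t_par(1)[OF u False]
            have "hooked (par u)" "hk (par u) = hk u" "par u < n"
              using hookedP[OF u p] hkP[OF u p] ltP[OF u p] hu by auto
            moreover from this have "par u \<notin> D x" using nh sub by blast
            ultimately show ?thesis using False D1 by (simp add: par1_def)
          qed
          then show ?thesis using ux D1 u hu hooked_rt1[OF u hu] by simp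
        next
          case hu: False
          have p: "par1 u = par u" "par u \<in> P u" using hu par_P[OF u] by (auto simp: par1_def)
          have "\<not> hooked (par u)" using hookedP[OF u p(2)] hu by simp
          moreover have "par u \<notin> D x"
          proof
            assume "par u \<in> D x"
            then have "P (par u) = P x" using sub eqP[OF x] by blast
            then show False using eqP[OF u p(2)] uP self[OF u] by simp
          qed
          ultimately show ?thesis using ux D1 hu p by simp
        qed
      qed
    qed
  next
    fix x u assume x: "x < n" and u: "u \<in> D1 x"
    consider "u \<in> D x" | "u < n" "hooked u" "hk u \<in> D x" "\<not> hooked x"
      using u by (auto simp: D1_def split: if_splits)
    then have "u < n \<and> rt1 u = rt1 x"
    proof cases
      case 1
      then have "u \<in> P x" using t_dep(2)[OF x] by blast
      then show ?thesis using ltP[OF x] rt1P[OF x] by blast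
    next
      case 2
      then have "hk u \<in> P x" using t_dep(2)[OF x] by blast
      then have "rt1 (hk u) = rt1 x" by (rule rt1P[OF x])
      then show ?thesis using rt1_hk[OF 2(1,2)] 2(1) by simp
    qed
    then show "u < n" "rt1 u = rt1 x" by auto
  next
    fix x u v assume x: "x < n" "x \<noteq> rt1 x" and uv: "{u, v} \<in> E" "u \<in> D1 x" "v \<notin> D1 x"
    have un: "u < n" "v < n" using edge[OF uv(1)] .
    show "w {x, par1 x} \<le> w {u, v}"
    proof (cases "hooked x")
      case hx: True
      then have D: "u \<in> D x" "v \<notin> D x" using uv by (auto simp: D1_def)
      show ?thesis
      proof (cases "x = rt x")
        case True
        \<comment> \<open>The subtree of the root is the whole hooked part, and its hook is no
          heavier than any edge leaving that part.\<close>
        then have "D x = P x" using rooted_tree_root_desc[OF tree[OF x(1)]] by simp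
        then have "w {rt x, hk x} \<le> w {u, v}" using hk_cut[OF x(1) hx uv(1)] D by simp
        then show ?thesis using True hx by (simp add: par1_def)
      next
        case False
        then show ?thesis using t_cut[OF x(1) False uv(1) D] by (simp add: par1_def)
      qed
    next
      case hx: False
      then have xr: "x \<noteq> rt x" "par1 x = par x" using x by (auto simp: rt1_def par1_def)
      show ?thesis
      proof (cases "u \<in> D x")
        case True
        moreover have "v \<notin> D x" using uv(3) hx by (simp add: D1_def)
        ultimately show ?thesis using t_cut[OF x(1) xr(1) uv(1)] xr by simp
      next
        case False
        \<comment> \<open>Here the edge leaves the subtree through a part hung below it. It is at
          least as heavy as the hook of that part, and the hook is at least as heavy as every tree
          edge of the big part.\<close>
        then have hu: "hooked u" "hk u \<in> D x" using uv(2) hx by (auto simp: D1_def)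
        have "v \<notin> P u"
        proof
          assume "v \<in> P u"
          then have "hooked v" "hk v = hk u" using hookedP[OF un(1)] hkP[OF un(1)] hu by auto
          then show False using uv(3) hx hu un by (simp add: D1_def)
        qed
        then have 1: "w {rt u, hk u} \<le> w {u, v}"
          using hk_cut[OF un(1) hu(1) uv(1) self[OF un(1)]] by simp
        have hx': "hk u \<in> P x" using hu(2) t_dep(2)[OF x(1)] by blast
        have "x \<in> P (hk u)" using eqP[OF x(1) hx'] self[OF x(1)] by simp
        from hk_heavy[OF un(1) hu(1) this xr(1)] 1 show ?thesis using xr by simp
      qed
    qed
  next
    show "R \<subseteq> {..<n}" using t_root(1) ltP unfolding R_def by blast
    have Rr: "r < n \<and> rt r = r \<and> r \<notin> Fr \<and> s \<le> card (P r)" if rR: "r \<in> R" for r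
    proof -
      obtain v where v: "v < n" "v \<notin> Fr" "s \<le> card (P v)" "r = rt v" using rR unfolding R_def
          by blast
      have "r \<in> P v" using t_root(1)[OF v(1)] v by simp
      then show ?thesis using ltP[OF v(1)] rtP[OF v(1)] frP[OF v(1)] eqP[OF v(1)] v by metis
    qed
    have finR: "finite R" unfolding R_def by simp
    have "s * card R = (\<Sum>r\<in>R. s)" by simp
    also have "\<dots> \<le> (\<Sum>r\<in>R. card (P r))" using Rr by (intro sum_mono) auto
    also have "\<dots> = card (\<Union>r\<in>R. P r)"
    proof (intro card_UN_disjoint[symmetric] ballI impI)
      show "finite R" by (rule finR)
      show "finite (P r)" if "r \<in> R" for r using Pfin Rr[OF that] by blast
      show "P r \<inter> P r' = {}" if "r \<in> R" "r' \<in> R" "r \<noteq> r'" for r r'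
      proof (rule ccontr)
        assume "P r \<inter> P r' \<noteq> {}"
        then obtain y where "y \<in> P r" "y \<in> P r'" by blast
        then have "rt r = rt r'" using rtP Rr[OF that(1)] Rr[OF that(2)] by metis
        then show False using Rr[OF that(1)] Rr[OF that(2)] that(3) by simp
      qed
    qed
    also have "\<dots> \<le> card {..<n}" using Rr part_sub[OF pc] by (intro card_mono) auto
    finally show "s * card R \<le> n" by simp
    show "rt1 u \<in> R" if "{u, v} \<in> E" "rt1 u \<noteq> rt1 v" for u v
    proof -
      have n: "u < n" "v < n" using edge[OF that(1)] .
      \<comment> \<open>Free parts are closed under edges, so an edge between clusters starts in a
        big part or in one hooked onto a big part; in both cases the root of the cluster belongs to
        \<open>R\<close>.\<close>
      have "u \<notin> Fr"
      proof
        assume "u \<in> Fr"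
        then have "v \<in> P u" using part_free(3)[OF pc n(1) _ that(1) self[OF n(1)]] by blast
        then show False using rt1P[OF n(1)] that(2) by metis
      qed
      then show ?thesis using n hk[OF n(1)] unfolding rt1_def R_def
        by (cases "hooked u") (auto simp: hooked_def)
    qed
  qed
  then show ?thesis by blast
qed

subsection \<open>Running programs\<close>

primrec block :: "prog list \<Rightarrow> prog" where
  "block [] = Skip"
| "block (p # ps) = Seq p (block ps)"

text \<open>Total correctness with a time bound: the exact step count of \<open>exec\<close> is
  relaxed to an upper bound so that the bounds of program pieces can be added.\<close>

definition runs :: "nat \<Rightarrow> nat list \<Rightarrow> prog \<Rightarrow> state \<Rightarrow> nat \<Rightarrow> (state \<Rightarrow> bool) \<Rightarrow> bool" where
  "runs B D p s t \<Phi> \<longleftrightarrow> (\<exists>k s'. exec B D p s k s' \<and> k \<le> t \<and> \<Phi> s')"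

lemma runs_weaken:
  assumes "runs B D p s t \<Phi>" "t \<le> t'" "\<And>s'. \<Phi> s' \<Longrightarrow> \<Psi> s'"
  shows "runs B D p s t' \<Psi>"
  using assms unfolding runs_def by (meson le_trans)

lemma runs_Seq:
  assumes "runs B D p s t \<Phi>" "\<And>s'. \<Phi> s' \<Longrightarrow> runs B D p' s' t' \<Psi>"
  shows "runs B D (Seq p p') s (t + t') \<Psi>"
  using assms unfolding runs_def by (meson add_mono exec.Seq)

lemma runs_Skip: "\<Phi> s \<Longrightarrow> runs B D Skip s 1 \<Phi>"
  unfolding runs_def by (meson exec.Skip order_refl)

lemma runs_Cond:
  assumes "regs s i \<noteq> 0 \<Longrightarrow> runs B D p s t \<Phi>" "regs s i = 0 \<Longrightarrow> runs B D p' s t \<Phi>"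
  shows "runs B D (Cond i p p') s (Suc t) \<Phi>"
  using assms unfolding runs_def by (meson Suc_le_mono exec.CondTrue exec.CondFalse)

lemma runs_While_False:
  assumes "regs s i = 0" "\<Phi> s"
  shows "runs B D (While i p) s 1 \<Phi>"
  using assms unfolding runs_def by (meson exec.WhileFalse order_refl)

lemma runs_While_True:
  assumes "regs s i \<noteq> 0" "runs B D p s t \<Phi>" "\<And>s'. \<Phi> s' \<Longrightarrow> runs B D (While i p) s' t' \<Psi>"
  shows "runs B D (While i p) s (Suc (t + t')) \<Psi>"
  using assms unfolding runs_def by (meson add_mono Suc_le_mono exec.WhileTrue)

text \<open>A sufficient precondition for branch-free code that the simplifier unfolds completely;
  its side conditions are those that keep the machine from getting stuck.\<close>

fun straight :: "nat \<Rightarrow> nat list \<Rightarrow> prog list \<Rightarrow> state \<Rightarrow> (state \<Rightarrow> bool) \<Rightarrow> bool" where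
  "straight B D [] s \<Phi> = \<Phi> s"
| "straight B D (Const r a # ps) s \<Phi> =
     (a < B \<and> straight B D ps (s\<lparr>regs := (regs s)(r := a)\<rparr>) \<Phi>)"
| "straight B D (Bin f r i j # ps) s \<Phi> =
     (binop_sem f (regs s i) (regs s j) < B \<and>
      straight B D ps (s\<lparr>regs := (regs s)(r := binop_sem f (regs s i) (regs s j))\<rparr>) \<Phi>)"
| "straight B D (Load r i # ps) s \<Phi> =
     straight B D ps (s\<lparr>regs := (regs s)(r := mem s (regs s i))\<rparr>) \<Phi>"
| "straight B D (Store i j # ps) s \<Phi> =
     straight B D ps (s\<lparr>mem := (mem s)(regs s i := regs s j)\<rparr>) \<Phi>"
| "straight B D (Probe r i # ps) s \<Phi> =
     (regs s i < length D \<and> straight B D ps (s\<lparr>regs := (regs s)(r := D ! regs s i)\<rparr>) \<Phi>)"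
| "straight B D (Emit i # ps) s \<Phi> = straight B D ps (s\<lparr>out := out s @ [regs s i]\<rparr>) \<Phi>"
| "straight B D (_ # ps) s \<Phi> = False"

lemma runs_block_Cons:
  assumes "exec B D p s 1 s1" "runs B D (block ps) s1 t \<Phi>"
  shows "runs B D (block (p # ps)) s (Suc t) \<Phi>"
  using runs_Seq[of B D p s 1 "\<lambda>s'. s' = s1" "block ps" t \<Phi>] assms by (auto simp: runs_def)

text \<open>The extra step is spent by the \<open>Skip\<close> that ends every
  \<open>block\<close>.\<close>

lemma runs_block: "straight B D ps s \<Phi> \<Longrightarrow> runs B D (block ps) s (Suc (length ps)) \<Phi>"
  by (induction B D ps s \<Phi> rule: straight.induct)
     (auto simp del: block.simps(2) intro!: runs_Skip[unfolded One_nat_def] runs_block_Cons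
         exec.Const
       exec.Bin exec.Load exec.Store exec.Probe exec.Emit)

text \<open>
  The query program keeps the registers below 26 for itself. Register \<open>r\<close> of the simulated program
  is register \<open>r + 26\<close>, its memory occupies the even addresses, and its output is collected at the
  odd addresses.
\<close>

abbreviation (input) "rU \<equiv> 0::nat"
abbreviation (input) "rV \<equiv> 1::nat"
abbreviation (input) "rOne \<equiv> 2::nat"
abbreviation (input) "rTwo \<equiv> 3::nat"
abbreviation (input) "rZero \<equiv> 4::nat"
abbreviation (input) "rPar \<equiv> 5::nat"
abbreviation (input) "rDep \<equiv> 6::nat"
abbreviation (input) "rCid \<equiv> 7::nat"
abbreviation (input) "rRow \<equiv> 8::nat"
abbreviation (input) "rDis \<equiv> 9::nat"
abbreviation (input) "rX \<equiv> 10::nat"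
abbreviation (input) "rY \<equiv> 11::nat"
abbreviation (input) "rOff \<equiv> 12::nat"
abbreviation (input) "rN \<equiv> 13::nat"
abbreviation (input) "rM \<equiv> 14::nat"
abbreviation (input) "rT \<equiv> 15::nat"
abbreviation (input) "rCnt \<equiv> 16::nat"
abbreviation (input) "rCur \<equiv> 17::nat"
abbreviation (input) "rPtr \<equiv> 18::nat"
abbreviation (input) "rI \<equiv> 19::nat"
abbreviation (input) "rJ \<equiv> 20::nat"
abbreviation (input) "rSP \<equiv> 21::nat"
abbreviation (input) "rC \<equiv> 22::nat"
abbreviation (input) "rA \<equiv> 23::nat"
abbreviation (input) "rG \<equiv> 24::nat"
abbreviation (input) "rE \<equiv> 25::nat"

text \<open>Interleaving even and odd addresses lets simulated memory and collected output grow side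
  by side, with no bound on either known to the program. Probes are shifted by \<open>rOff\<close>
  because the given data are stored behind the directory.\<close>

primrec simulate :: "prog \<Rightarrow> prog" where
  "simulate Skip = Skip"
| "simulate (Const r a) = Const (r + 26) a"
| "simulate (Bin f r i j) = Bin f (r + 26) (i + 26) (j + 26)"
| "simulate (Load r i) = block [Bin Plus rT (i + 26) (i + 26), Load (r + 26) rT]"
| "simulate (Store i j) = block [Bin Plus rT (i + 26) (i + 26), Store rT (j + 26)]"
| "simulate (Probe r i) = block [Bin Plus rT (i + 26) rOff, Probe (r + 26) rT]"
| "simulate (Emit i) =
     block [Bin Plus rT rCnt rCnt, Bin Plus rT rT rOne, Store rT (i + 26), Bin Plus rCnt rCnt rOne]"
| "simulate (Seq p p') = Seq (simulate p) (simulate p')"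
| "simulate (Cond i p p') = Cond (i + 26) (simulate p) (simulate p')"
| "simulate (While i p) = While (i + 26) (simulate p)"

text \<open>\<open>\<rho>\<close> freezes the registers that the surrounding program keeps; of its
  own registers, only \<open>rT\<close> and \<open>rCnt\<close> may change during the
  simulation.\<close>

definition simulates :: "(nat \<Rightarrow> nat) \<Rightarrow> nat list \<Rightarrow> state \<Rightarrow> state \<Rightarrow> bool" where
  "simulates \<rho> os s \<sigma> \<longleftrightarrow>
     (\<forall>r. regs \<sigma> (r + 26) = regs s r) \<and> (\<forall>a. mem \<sigma> (2 * a) = mem s a) \<and>
     (\<forall>i<length (out s). mem \<sigma> (Suc (2 * i)) = out s ! i) \<and> regs \<sigma> rCnt = length (out s) \<and>
     (\<forall>r<26. r \<noteq> rT \<longrightarrow> r \<noteq> rCnt \<longrightarrow> regs \<sigma> r = \<rho> r) \<and> out \<sigma> = os"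

definition bounded_state :: "nat \<Rightarrow> state \<Rightarrow> bool" where
  "bounded_state X s \<longleftrightarrow> (\<forall>r. regs s r < X) \<and> (\<forall>a. mem s a < X)"

lemma exec_out_mono: "exec B D p s k s' \<Longrightarrow> length (out s) \<le> length (out s')"
  by (induction rule: exec.induct) auto

text \<open>Translated addresses exceed the original ones, so all values are kept below
  \<open>X\<close>: \<open>2 * X\<close> covers doubled memory addresses,
  \<open>X + length D0\<close> shifted probes and \<open>2 * L + 2\<close> the output cells.
  Bounding the final output by \<open>L\<close> suffices because outputs never shrink. The factor 5
  comes from \<open>Emit\<close>: four instructions and the closing \<open>Skip\<close>.\<close>

lemma exec_simulate:
  assumes "exec B D p s k s'" "simulates \<rho> os s \<sigma>" "bounded_state X s" "length (out s') \<le> L"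
    and X: "B \<le> X" "\<forall>d\<in>set D. d < X" "2 * X \<le> B'" "X + length D0 \<le> B'" "2 * L + 2 \<le> B'"
    and \<rho>: "\<rho> rOne = 1" "\<rho> rOff = length D0"
  shows "bounded_state X s' \<and> runs B' (D0 @ D) (simulate p) \<sigma> (5 * k) (simulates \<rho> os s')"
  using assms(1-4)
proof (induction arbitrary: \<sigma> rule: exec.induct)
  case (Skip s)
  have "runs B' (D0 @ D) Skip \<sigma> 1 (simulates \<rho> os s)" by (rule runs_Skip) (rule Skip)
  then have "runs B' (D0 @ D) Skip \<sigma> 5 (simulates \<rho> os s)" by (rule runs_weaken) auto
  then show ?case using Skip by simp
next
  case (Const a r s)
  have "exec B' (D0 @ D) (simulate (Const r a)) \<sigma> 1 (\<sigma>\<lparr>regs := (regs \<sigma>)(r + 26 := a)\<rparr>)"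
    unfolding simulate.simps by (rule exec.Const) (use Const X in simp)
  moreover have "simulates \<rho> os (s\<lparr>regs := (regs s)(r := a)\<rparr>) (\<sigma>\<lparr>regs := (regs \<sigma>)(r + 26 := a)\<rparr>)"
    using Const by (auto simp: simulates_def)
  moreover have "bounded_state X (s\<lparr>regs := (regs s)(r := a)\<rparr>)"
    using Const X by (auto simp: bounded_state_def)
  ultimately show ?case unfolding runs_def by fastforce
next
  case (Bin a f s i j r)
  have ij: "regs \<sigma> (i + 26) = regs s i" "regs \<sigma> (j + 26) = regs s j"
    using Bin by (auto simp: simulates_def)
  have "exec B' (D0 @ D) (simulate (Bin f r i j)) \<sigma> 1 (\<sigma>\<lparr>regs := (regs \<sigma>)(r + 26 := a)\<rparr>)"
    unfolding simulate.simps by (rule exec.Bin) (use Bin X ij in simp_all)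
  moreover have "simulates \<rho> os (s\<lparr>regs := (regs s)(r := a)\<rparr>) (\<sigma>\<lparr>regs := (regs \<sigma>)(r + 26 := a)\<rparr>)"
    using Bin by (auto simp: simulates_def)
  moreover have "bounded_state X (s\<lparr>regs := (regs s)(r := a)\<rparr>)"
    using Bin X by (auto simp: bounded_state_def)
  ultimately show ?case unfolding runs_def by fastforce
next
  case (Load r i s)
  have i: "regs s i < X" and bs: "bounded_state X (s\<lparr>regs := (regs s)(r := mem s (regs s i))\<rparr>)"
    using Load by (auto simp: bounded_state_def)
  have "regs s i + regs s i < B'" using i X by simp
  then have "straight B' (D0 @ D) [Bin Plus rT (i + 26) (i + 26), Load (r + 26) rT] \<sigma>
      (simulates \<rho> os (s\<lparr>regs := (regs s)(r := mem s (regs s i))\<rparr>))"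
    using Load(1) by (simp add: simulates_def mult_2[symmetric])
  from runs_block[OF this] bs show ?case by (auto intro: runs_weaken)
next
  case (Store i j s)
  have i: "regs s i < X" and bs: "bounded_state X (s\<lparr>mem := (mem s)(regs s i := regs s j)\<rparr>)"
    using Store by (auto simp: bounded_state_def)
  have "regs s i + regs s i < B'" using i X by simp
  moreover have "Suc (2 * x) \<noteq> 2 * y" for x y :: nat by presburger
  ultimately have "straight B' (D0 @ D) [Bin Plus rT (i + 26) (i + 26), Store rT (j + 26)] \<sigma>
      (simulates \<rho> os (s\<lparr>mem := (mem s)(regs s i := regs s j)\<rparr>))"
    using Store(1) by (simp add: simulates_def mult_2[symmetric])
  from runs_block[OF this] bs show ?case by (auto intro: runs_weaken)
next
  case (Probe s i r)
  have i: "regs s i < X" and bs: "bounded_state X (s\<lparr>regs := (regs s)(r := D ! regs s i)\<rparr>)"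
    using Probe X by (auto simp: bounded_state_def)
  have "regs s i + length D0 < B'" using i X by simp
  then have "straight B' (D0 @ D) [Bin Plus rT (i + 26) rOff, Probe (r + 26) rT] \<sigma>
      (simulates \<rho> os (s\<lparr>regs := (regs s)(r := D ! regs s i)\<rparr>))"
    using Probe(1,2) \<rho> by (simp add: simulates_def nth_append)
  from runs_block[OF this] bs show ?case by (auto intro: runs_weaken)
next
  case (Emit i s)
  have bs: "bounded_state X (s\<lparr>out := out s @ [regs s i]\<rparr>)"
    using Emit by (auto simp: bounded_state_def)
  have "Suc (2 * length (out s)) < B'" "Suc (length (out s)) < B'" "2 * length (out s) < B'"
      using Emit X by auto
  moreover have "Suc (2 * x) \<noteq> 2 * y" "2 * y \<noteq> Suc (2 * x)" for x y :: nat by presburger+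
  ultimately have "straight B' (D0 @ D) [Bin Plus rT rCnt rCnt, Bin Plus rT rT rOne, Store rT (i +
      26),
      Bin Plus rCnt rCnt rOne] \<sigma> (simulates \<rho> os (s\<lparr>out := out s @ [regs s i]\<rparr>))"
    using Emit(1) \<rho> by (simp add: simulates_def mult_2[symmetric] nth_append)
  from runs_block[OF this] bs show ?case by (auto intro: runs_weaken)
next
  case (Seq p s k s' p' k' s'')
  have "length (out s') \<le> L" using exec_out_mono[OF Seq.hyps(2)] Seq.prems by simp
  with Seq.IH(1) Seq.prems have 1: "bounded_state X s'"
    "runs B' (D0 @ D) (simulate p) \<sigma> (5 * k) (simulates \<rho> os s')" by auto
  have 2: "bounded_state X s'' \<and> runs B' (D0 @ D) (simulate p') \<tau> (5 * k') (simulates \<rho> os s'')"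
    if "simulates \<rho> os s' \<tau>" for \<tau> using Seq.IH(2)[OF that 1(1)] Seq.prems by simp
  have "bounded_state X s''" using 1(2) 2 unfolding runs_def by blast
  moreover have "runs B' (D0 @ D) (simulate (Seq p p')) \<sigma> (5 * k + 5 * k') (simulates \<rho> os s'')"
    unfolding simulate.simps by (rule runs_Seq[OF 1(2)]) (use 2 in blast)
  ultimately show ?case by (simp add: algebra_simps)
next
  case (CondTrue s i p k s' p')
  have *: "bounded_state X s'" "runs B' (D0 @ D) (simulate p) \<sigma> (5 * k) (simulates \<rho> os s')"
    using CondTrue by auto
  have "regs \<sigma> (i + 26) \<noteq> 0" using CondTrue by (simp add: simulates_def)
  then have "runs B' (D0 @ D) (simulate (Cond i p p')) \<sigma> (Suc (5 * k)) (simulates \<rho> os s')"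
    unfolding simulate.simps by (intro runs_Cond * ) simp
  then show ?case using *(1) by (auto intro: runs_weaken)
next
  case (CondFalse s i p' k s' p)
  have *: "bounded_state X s'" "runs B' (D0 @ D) (simulate p') \<sigma> (5 * k) (simulates \<rho> os s')"
    using CondFalse by auto
  have "regs \<sigma> (i + 26) = 0" using CondFalse by (simp add: simulates_def)
  then have "runs B' (D0 @ D) (simulate (Cond i p p')) \<sigma> (Suc (5 * k)) (simulates \<rho> os s')"
    unfolding simulate.simps by (intro runs_Cond * ) simp
  then show ?case using *(1) by (auto intro: runs_weaken)
next
  case (WhileFalse s i p)
  have "regs \<sigma> (i + 26) = 0" using WhileFalse by (simp add: simulates_def)
  then have "runs B' (D0 @ D) (simulate (While i p)) \<sigma> 1 (simulates \<rho> os s)"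
    unfolding simulate.simps using WhileFalse by (intro runs_While_False) auto
  then show ?case using WhileFalse by (auto intro: runs_weaken)
next
  case (WhileTrue s i p k s' k' s'')
  have "length (out s') \<le> L" using exec_out_mono[OF WhileTrue.hyps(3)] WhileTrue.prems by simp
  with WhileTrue.IH(1) WhileTrue.prems have 1: "bounded_state X s'"
    "runs B' (D0 @ D) (simulate p) \<sigma> (5 * k) (simulates \<rho> os s')" by auto
  have 2: "bounded_state X s'' \<and> runs B' (D0 @ D) (simulate (While i p)) \<tau> (5 * k') (simulates \<rho> os
      s'')"
    if "simulates \<rho> os s' \<tau>" for \<tau> using WhileTrue.IH(2)[OF that 1(1)] WhileTrue.prems by simp
  have "bounded_state X s''" using 1(2) 2 unfolding runs_def by blast
  moreover have "regs \<sigma> (i + 26) \<noteq> 0" using WhileTrue by (simp add: simulates_def)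
  then have "runs B' (D0 @ D) (simulate (While i p)) \<sigma> (Suc (5 * k + 5 * k')) (simulates \<rho> os s'')"
    unfolding simulate.simps by (rule runs_While_True[OF _ 1(2)]) (use 2 in auto)
  ultimately show ?case by (auto intro: runs_weaken)
qed

subsection \<open>The query program\<close>

text \<open>
  Climbing always from the deeper of the two ends takes time proportional to the length of the tree
  path, whatever the depths are. The second half of the path is found in reverse order and hence
  goes through a stack, which overwrites the even addresses.
\<close>

definition push_step :: prog where
  "push_step = block [Store rSP rJ, Bin Plus rSP rSP rTwo, Bin Plus rT rPar rJ, Probe rJ rT]"

definition emit_step :: prog where
  "emit_step = block [Emit rI, Bin Plus rT rPar rI, Probe rI rT]"

text \<open>\<open>rC\<close> serves as the flag of the branch and afterwards, recomputed by two
  \<open>Eq\<close> as the negation of equality of the two ends, as the guard of the loop.\<close>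

definition climb_step :: prog where
  "climb_step = Seq
     (block [Bin Plus rT rDep rI, Probe rA rT, Bin Plus rT rDep rJ, Probe rG rT, Bin Less rC rA rG])
     (Seq (Cond rC push_step emit_step) (block [Bin Eq rC rI rJ, Bin Eq rC rC rZero]))"

definition climb_loop :: prog where
  "climb_loop = While rC climb_step"

definition pop_loop :: prog where
  "pop_loop = While rSP (block [Bin Minus rSP rSP rTwo, Load rT rSP, Emit rT])"

definition emit_tree_path :: prog where
  "emit_tree_path = Seq (block [Const rSP 0, Bin Eq rC rI rJ, Bin Eq rC rC rZero])
     (Seq climb_loop (Seq (block [Emit rI]) pop_loop))"

text \<open>Evaluates \<open>slot\<close> for the current and the next cluster and fetches both ends
  of the edge that stands for the pair. Keys are neither stored nor compared, since answers of the
  given oracle only use edges of its spanner. \<open>rPtr\<close> advances by one entry, so the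
  second cluster is read again as the first one of the next round.\<close>

definition lookup :: "prog list" where
  "lookup = [Load rA rPtr, Bin Plus rPtr rPtr rTwo, Load rJ rPtr,
        Bin Plus rT rRow rA, Probe rG rT, Bin Plus rG rG rJ, Bin Modulo rG rG rM,
        Bin Plus rT rDis rG, Probe rG rT, Bin Plus rG rA rG, Bin Modulo rG rG rM,
        Bin Plus rT rX rG, Probe rJ rT, Bin Plus rT rY rG, Probe rE rT,
        Bin Plus rI rCur rZero, Bin Minus rCnt rCnt rOne]"

definition route_step :: prog where
  "route_step = Seq (block lookup)
     (Seq emit_tree_path (block [Bin Plus rCur rE rZero, Bin Less rC rOne rCnt]))"

definition route_loop :: prog where
  "route_loop = While rC route_step"

definition prologue :: "prog list" where
  "prologue = [Const rT 0, Probe rPar rT, Const rT 1, Probe rDep rT, Const rT 2, Probe rCid rT,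
     Const rT 3, Probe rRow rT, Const rT 4, Probe rDis rT, Const rT 5, Probe rX rT,
     Const rT 6, Probe rY rT, Const rT 7, Probe rOff rT, Const rT 8, Probe rN rT,
     Const rT 9, Probe rM rT, Const rOne 1, Const rTwo 2, Const rZero 0, Const rPtr 1,
     Bin Plus rT rCid rU, Probe rA rT, Bin Plus rT rCid rV, Probe rG rT,
     Bin Plus rCur rU rZero, Bin Eq rC rA rG]"

definition load_ends :: "prog list" where
  "load_ends = [Bin Plus rI rCur rZero, Bin Plus rJ rV rZero]"

text \<open>The loop treats all clusters but the last, whose path to \<open>rV\<close> is printed
  separately. A count of 0 stands for the empty answer of a disconnected pair.\<close>

definition finish :: prog where
  "finish = Seq (block [Bin Less rC rOne rCnt]) (Seq (Cond rC route_loop Skip)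
     (Cond rCnt (Seq (block load_ends) emit_tree_path) Skip))"

definition test_big :: "prog list" where
  "test_big = [Bin Less rC rA rN, Bin Less rT rG rN, Bin Times rC rC rT]"

definition load_query :: "prog list" where
  "load_query = [Bin Plus 26 rA rZero, Bin Plus 27 rG rZero]"

text \<open>Two vertices of one cluster are treated as an answer of length 1. Clusters numbered from
  \<open>N\<close> on are meant to be whole components: for them the count stays 0 and the answer is
  empty.\<close>

definition dispatch :: "prog \<Rightarrow> prog" where
  "dispatch Q = Cond rC (block [Const rCnt 1])
     (Seq (block test_big) (Cond rC (Seq (block load_query) (simulate Q)) Skip))"

definition query :: "prog \<Rightarrow> prog" where
  "query Q = Seq (block prologue)
     (Seq (dispatch Q)
     finish)"

text \<open>The functional counterpart of the climbing loop. Each round lifts one end by one level,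
  so the sum of the depths is enough fuel; at fuel 0 both ends are roots and, within one tree,
  equal.\<close>

fun tree_path_fuel :: "(nat \<Rightarrow> nat) \<Rightarrow> (nat \<Rightarrow> nat) \<Rightarrow> nat \<Rightarrow> nat \<Rightarrow> nat \<Rightarrow> nat list" where
  "tree_path_fuel par dep 0 i j = [i]"
| "tree_path_fuel par dep (Suc k) i j =
     (if i = j then [i]
      else if dep i < dep j then tree_path_fuel par dep k i (par j) @ [j]
      else i # tree_path_fuel par dep k (par i) j)"

definition tree_path :: "(nat \<Rightarrow> nat) \<Rightarrow> (nat \<Rightarrow> nat) \<Rightarrow> nat \<Rightarrow> nat \<Rightarrow> nat list" where
  "tree_path par dep i j = tree_path_fuel par dep (dep i + dep j) i j"

lemma tree_path_not_Nil [simp]: "tree_path par dep i j \<noteq> []"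
proof -
  have "tree_path_fuel par dep k i j \<noteq> []" for k
    by (cases k) auto
  then show ?thesis by (simp add: tree_path_def)
qed

text \<open>
  The edge of the quotient graph from \<open>a\<close> to \<open>b\<close> stands for the edge of the graph from
  \<open>ex a b\<close> to \<open>ey a b\<close>.
\<close>

fun route :: "(nat \<Rightarrow> nat \<Rightarrow> nat list) \<Rightarrow> (nat \<Rightarrow> nat \<Rightarrow> nat) \<Rightarrow> (nat \<Rightarrow> nat \<Rightarrow> nat) \<Rightarrow> nat \<Rightarrow> nat \<Rightarrow>
  nat list \<Rightarrow> nat list" where
  "route p ex ey cur v [] = []"
| "route p ex ey cur v [a] = p cur v"
| "route p ex ey cur v (a # b # xs) = p cur (ex a b) @ route p ex ey (ey a b) v (b # xs)"

section \<open>Climbing in a rooted forest\<close>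

locale rooted_forest =
  fixes n :: nat and par dep rt :: "nat \<Rightarrow> nat"
  assumes par_less: "v < n \<Longrightarrow> par v < n"
    and rt_par: "v < n \<Longrightarrow> rt (par v) = rt v"
    and rt_less: "v < n \<Longrightarrow> rt v < n"
    and dep_root: "v < n \<Longrightarrow> v = rt v \<Longrightarrow> dep v = 0"
    and dep_par: "v < n \<Longrightarrow> v \<noteq> rt v \<Longrightarrow> dep v = Suc (dep (par v))"
begin

abbreviation "tpath \<equiv> tree_path par dep"

lemma tpath_same [simp]: "tpath i i = [i]"
  by (cases "dep i + dep i") (simp_all add: tree_path_def)

lemma not_root_down:
  assumes "j < n" "dep i < dep j"
  shows "j \<noteq> rt j"
  using dep_root[OF assms(1)] assms(2) by auto

text \<open>If an end that is at least as deep as the other one were a root, both would have depth 0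
  and be the same root. So the climb never stalls.\<close>

lemma not_root_up:
  assumes "i < n" "j < n" "rt i = rt j" "i \<noteq> j" "\<not> dep i < dep j"
  shows "i \<noteq> rt i"
proof
  assume "i = rt i"
  then have "dep j = 0" using dep_root[OF assms(1)] assms(5) by simp
  then have "j = rt j" using dep_par[OF assms(2)] by (metis nat.distinct(1))
  then show False using \<open>i = rt i\<close> assms by simp
qed

lemma tpath_down:
  assumes "i < n" "j < n" "rt i = rt j" "i \<noteq> j" "dep i < dep j"
  shows "tpath i j = tpath i (par j) @ [j]"
  using dep_par[OF assms(2) not_root_down[OF assms(2,5)]] assms by (simp add: tree_path_def)

lemma tpath_up:
  assumes "i < n" "j < n" "rt i = rt j" "i \<noteq> j" "\<not> dep i < dep j"
  shows "tpath i j = i # tpath (par i) j"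
  using dep_par[OF assms(1) not_root_up[OF assms]] assms by (simp add: tree_path_def)

lemma tpath_induct [consumes 3, case_names same down up]:
  assumes "i < n" "j < n" "rt i = rt j"
    and "\<And>i. i < n \<Longrightarrow> P i i"
    and "\<And>i j. i < n \<Longrightarrow> j < n \<Longrightarrow> rt i = rt j \<Longrightarrow> i \<noteq> j \<Longrightarrow> dep i < dep j \<Longrightarrow> j \<noteq> rt j \<Longrightarrow>
        dep j = Suc (dep (par j)) \<Longrightarrow> P i (par j) \<Longrightarrow> P i j"
    and "\<And>i j. i < n \<Longrightarrow> j < n \<Longrightarrow> rt i = rt j \<Longrightarrow> i \<noteq> j \<Longrightarrow> \<not> dep i < dep j \<Longrightarrow> i \<noteq> rt i \<Longrightarrow>
        dep i = Suc (dep (par i)) \<Longrightarrow> P (par i) j \<Longrightarrow> P i j"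
  shows "P i j"
  using assms(1-3)
proof (induction "dep i + dep j" arbitrary: i j rule: less_induct)
  case less
  note p = less.prems
  consider "i = j" | "i \<noteq> j" "dep i < dep j" | "i \<noteq> j" "\<not> dep i < dep j" by blast
  then show ?case
  proof cases
    case 1
    then show ?thesis using assms(4) p by simp
  next
    case 2
    have r: "j \<noteq> rt j" using not_root_down[OF p(2) 2(2)] .
    have d: "dep j = Suc (dep (par j))" using dep_par[OF p(2) r] .
    have "P i (par j)" using less.hyps[of i "par j"] d par_less[OF p(2)] rt_par[OF p(2)] p by simp
    then show ?thesis using assms(5)[OF p 2 r d] by blast
  next
    case 3
    have r: "i \<noteq> rt i" using not_root_up[OF p 3] .
    have d: "dep i = Suc (dep (par i))" using dep_par[OF p(1) r] .
    have "P (par i) j" using less.hyps[of "par i" j] d par_less[OF p(1)] rt_par[OF p(1)] p by simp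
    then show ?thesis using assms(6)[OF p 3 r d] by blast
  qed
qed

end

text \<open>What the program relies on, independent of the concrete layout. \<open>D0\<close> is
  stored in front of the given data \<open>Dq\<close>, so its addresses do not move. The bounds in
  \<open>words\<close> make base addresses, stack pointers (up to twice a depth) and answer
  addresses fit into a word.\<close>

locale stored_oracle = rooted_forest +
  fixes B :: nat and D0 Dq :: "nat list" and N M :: nat and cid T d X Y :: "nat \<Rightarrow> nat"
    and bPar bDep bCid bT bd bX bY :: nat
    and K :: "(nat \<times> nat) set" and ex ey :: "nat \<Rightarrow> nat \<Rightarrow> nat"
  assumes header: "D0 ! 0 = bPar" "D0 ! 1 = bDep" "D0 ! 2 = bCid" "D0 ! 3 = bT" "D0 ! 4 = bd"
      "D0 ! 5 = bX" "D0 ! 6 = bY" "D0 ! 7 = length D0" "D0 ! 8 = N" "D0 ! 9 = M" "10 \<le> length D0"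
    and stored_vertex: "v < n \<Longrightarrow> bPar + v < length D0 \<and> D0 ! (bPar + v) = par v"
      "v < n \<Longrightarrow> bDep + v < length D0 \<and> D0 ! (bDep + v) = dep v"
      "v < n \<Longrightarrow> bCid + v < length D0 \<and> D0 ! (bCid + v) = cid v"
    and stored_row: "a < N \<Longrightarrow> bT + a < length D0 \<and> D0 ! (bT + a) = T a"
    and stored_slot: "x < M \<Longrightarrow> bd + x < length D0 \<and> D0 ! (bd + x) = d x"
      "x < M \<Longrightarrow> bX + x < length D0 \<and> D0 ! (bX + x) = X x"
      "x < M \<Longrightarrow> bY + x < length D0 \<and> D0 ! (bY + x) = Y x"
    and M_pos: "0 < M" and T_less: "T a < M" and d_less: "d x < M"
    and key: "(a, b) \<in> K \<Longrightarrow> a < N \<and> b < N \<and> X (slot M T d (a, b)) = ex a b \<and>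
        Y (slot M T d (a, b)) = ey a b \<and> ex a b < n \<and> ey a b < n"
    and words: "length D0 + n + N + M \<le> B" "4 * n + 4 \<le> B" "2 * N + 4 \<le> B"
    and dep_le: "v < n \<Longrightarrow> dep v \<le> 2 * n"
begin

section \<open>Correctness of the query program\<close>

abbreviation "run \<equiv> runs B (D0 @ Dq)"

abbreviation "routed \<equiv> route tpath ex ey"

text \<open>The constants and base addresses that printing and routing read. None of these registers
  lies in \<open>path_temps\<close>, so the condition survives the printing of a tree path.\<close>

definition ready :: "state \<Rightarrow> bool" where
  "ready \<sigma> \<longleftrightarrow> regs \<sigma> rOne = 1 \<and> regs \<sigma> rTwo = 2 \<and> regs \<sigma> rZero = 0 \<and> regs \<sigma> rPar = bPar \<and>
     regs \<sigma> rDep = bDep \<and> regs \<sigma> rRow = bT \<and> regs \<sigma> rDis = bd \<and> regs \<sigma> rX = bX \<and>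
     regs \<sigma> rY = bY \<and> regs \<sigma> rM = M"

lemma climb_step_compare:
  assumes "i < n" "j < n" "ready \<sigma>" "regs \<sigma> rI = i" "regs \<sigma> rJ = j"
  shows "run
    (block [Bin Plus rT rDep rI, Probe rA rT, Bin Plus rT rDep rJ, Probe rG rT, Bin Less rC rA rG])
        \<sigma> 6
    (\<lambda>\<sigma>'. \<sigma>' = \<sigma>\<lparr>regs := (regs \<sigma>)(rA := dep i, rT := bDep + j, rG := dep j, rC := of_bool (dep i <
        dep j))\<rparr>)"
  by (rule runs_weaken[OF runs_block])
    (use assms(3)[unfolded ready_def] stored_vertex(2)[OF assms(1)] stored_vertex(2)[OF assms(2)]
        words assms(4,5)
      in \<open>auto simp: nth_append fun_upd_twist\<close>)

lemma climb_step_push: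
  assumes "i < n" "j < n" "ready \<sigma>" "regs \<sigma> rI = i" "regs \<sigma> rJ = j" "dep i < dep j"
    and "regs \<sigma> rSP = 2 * p" "2 * p + 4 \<le> B"
  shows "run climb_step \<sigma> 15 (\<lambda>\<sigma>'. \<sigma>' = \<sigma>\<lparr>regs := (regs \<sigma>)(rT := bPar + j, rA := dep i,
    rG := dep j, rSP := 2 * Suc p, rJ := par j, rC := of_bool (i \<noteq> par j)), mem := (mem \<sigma>)(2 * p :=
        j)\<rparr>)"
    (is "runs _ _ _ _ _ (\<lambda>\<sigma>'. \<sigma>' = ?\<tau>)")
proof -
  note rd = assms(3)[unfolded ready_def] and vj = stored_vertex(1)[OF assms(2)]
  let ?\<tau>1 = "?\<tau>\<lparr>regs := (regs ?\<tau>)(rC := 1)\<rparr>"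
  have "run climb_step \<sigma> (6 + (Suc 5 + 3)) (\<lambda>\<sigma>'. \<sigma>' = ?\<tau>)"
    unfolding climb_step_def
  proof (rule runs_Seq[OF climb_step_compare[OF assms(1-5)]])
    fix \<sigma>' assume \<sigma>': "\<sigma>' = \<sigma>\<lparr>regs := (regs \<sigma>)(rA := dep i, rT := bDep + j, rG := dep j,
      rC := of_bool (dep i < dep j))\<rparr>"
    show "run (Seq (Cond rC push_step emit_step) (block [Bin Eq rC rI rJ, Bin Eq rC rC rZero]))
        \<sigma>' (Suc 5 + 3) (\<lambda>\<sigma>'. \<sigma>' = ?\<tau>)"
    proof (rule runs_Seq)
      have "run push_step \<sigma>' 5 (\<lambda>\<sigma>''. \<sigma>'' = ?\<tau>1)"
        unfolding push_step_def
        by (rule runs_weaken[OF runs_block])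
          (use rd vj words assms in \<open>auto simp: \<sigma>' nth_append fun_upd_twist fun_eq_iff\<close>)
      then show "run (Cond rC push_step emit_step) \<sigma>' (Suc 5) (\<lambda>\<sigma>''. \<sigma>'' = ?\<tau>1)"
        by (rule runs_Cond) (use assms in \<open>simp_all add: \<sigma>'\<close>)
      show "run (block [Bin Eq rC rI rJ, Bin Eq rC rC rZero]) \<sigma>'' 3 (\<lambda>\<sigma>'. \<sigma>' = ?\<tau>)"
        if "\<sigma>'' = ?\<tau>1" for \<sigma>''
        by (rule runs_weaken[OF runs_block]) (use rd words assms in \<open>auto simp: that fun_eq_iff\<close>)
    qed
  qed
  then show ?thesis by simp
qed

lemma climb_step_emit:
  assumes "i < n" "j < n" "ready \<sigma>" "regs \<sigma> rI = i" "regs \<sigma> rJ = j" "\<not> dep i < dep j"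
  shows "run climb_step \<sigma> 15 (\<lambda>\<sigma>'. \<sigma>' = \<sigma>\<lparr>regs := (regs \<sigma>)(rT := bPar + i, rA := dep i,
    rG := dep j, rI := par i, rC := of_bool (par i \<noteq> j)), out := out \<sigma> @ [i]\<rparr>)"
    (is "runs _ _ _ _ _ (\<lambda>\<sigma>'. \<sigma>' = ?\<tau>)")
proof -
  note rd = assms(3)[unfolded ready_def] and vi = stored_vertex(1)[OF assms(1)]
  let ?\<tau>1 = "?\<tau>\<lparr>regs := (regs ?\<tau>)(rC := 0)\<rparr>"
  have "run climb_step \<sigma> (6 + (Suc 4 + 3)) (\<lambda>\<sigma>'. \<sigma>' = ?\<tau>)"
    unfolding climb_step_def
  proof (rule runs_Seq[OF climb_step_compare[OF assms(1-5)]])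
    fix \<sigma>' assume \<sigma>': "\<sigma>' = \<sigma>\<lparr>regs := (regs \<sigma>)(rA := dep i, rT := bDep + j, rG := dep j,
      rC := of_bool (dep i < dep j))\<rparr>"
    show "run (Seq (Cond rC push_step emit_step) (block [Bin Eq rC rI rJ, Bin Eq rC rC rZero]))
        \<sigma>' (Suc 4 + 3) (\<lambda>\<sigma>'. \<sigma>' = ?\<tau>)"
    proof (rule runs_Seq)
      have "run emit_step \<sigma>' 4 (\<lambda>\<sigma>''. \<sigma>'' = ?\<tau>1)"
        unfolding emit_step_def
        by (rule runs_weaken[OF runs_block])
          (use rd vi words assms in \<open>auto simp: \<sigma>' nth_append fun_upd_twist fun_eq_iff\<close>)
      then show "run (Cond rC push_step emit_step) \<sigma>' (Suc 4) (\<lambda>\<sigma>''. \<sigma>'' = ?\<tau>1)"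
        by (rule runs_Cond[rotated]) (use assms in \<open>simp_all add: \<sigma>'\<close>)
      show "run (block [Bin Eq rC rI rJ, Bin Eq rC rC rZero]) \<sigma>'' 3 (\<lambda>\<sigma>'. \<sigma>' = ?\<tau>)"
        if "\<sigma>'' = ?\<tau>1" for \<sigma>''
        by (rule runs_weaken[OF runs_block]) (use rd words assms in \<open>auto simp: that fun_eq_iff\<close>)
    qed
  qed
  then show ?thesis by (rule runs_weaken) auto
qed

definition path_temps :: "nat set" where
  "path_temps = {rI, rJ, rT, rA, rG, rC, rSP}"

text \<open>\<open>l\<close> is the vertex where the two ends meet, \<open>ups\<close> is already
  printed, and \<open>downs\<close> lists the stack in the order of pushing, above an older stack of
  height \<open>p\<close>. Odd addresses are preserved because they hold the clusters still to be
  visited.\<close>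

definition climbed :: "state \<Rightarrow> nat \<Rightarrow> nat list \<Rightarrow> nat \<Rightarrow> nat list \<Rightarrow> state \<Rightarrow> bool" where
  "climbed \<sigma> p ups l downs \<sigma>' \<longleftrightarrow>
     regs \<sigma>' rI = l \<and> regs \<sigma>' rSP = 2 * (p + length downs) \<and> out \<sigma>' = out \<sigma> @ ups \<and>
     (\<forall>x<length downs. mem \<sigma>' (2 * (p + x)) = downs ! x) \<and>
     (\<forall>a. odd a \<or> a < 2 * p \<longrightarrow> mem \<sigma>' a = mem \<sigma> a) \<and>
     (\<forall>r. r \<notin> path_temps \<longrightarrow> regs \<sigma>' r = regs \<sigma> r)"

text \<open>A round takes 15 steps and the loop test one more, whichever end is lifted; each round
  accounts for one vertex of the path.\<close>

lemma climb_loop_correct: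
  assumes "i < n" "j < n" "rt i = rt j" "ready \<sigma>" "regs \<sigma> rI = i" "regs \<sigma> rJ = j"
    "regs \<sigma> rC = of_bool (i \<noteq> j)" "regs \<sigma> rSP = 2 * p" "2 * (p + dep j) + 2 \<le> B"
  shows "\<exists>ups l downs. tpath i j = ups @ [l] @ rev downs \<and> length downs \<le> dep j \<and>
    run climb_loop \<sigma> (16 * (length ups + length downs) + 1) (climbed \<sigma> p ups l downs)"
  using assms
proof (induction arbitrary: \<sigma> p rule: tpath_induct)
  case (same i)
  have "run climb_loop \<sigma> 1 (climbed \<sigma> p [] i [])"
    unfolding climb_loop_def using same by (intro runs_While_False) (auto simp: climbed_def)
  then show ?case by (intro exI[of _ "[]"] exI[of _ i] exI[of _ "[]"]) simp
next
  case (down i j)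
  note rd = down.prems(1)[unfolded ready_def]
  define \<tau> where "\<tau> = \<sigma>\<lparr>regs := (regs \<sigma>)(rT := bPar + j, rA := dep i, rG := dep j, rSP := 2 * Suc p,
    rJ := par j, rC := of_bool (i \<noteq> par j)), mem := (mem \<sigma>)(2 * p := j)\<rparr>"
  have "ready \<tau>" "regs \<tau> rI = i" "regs \<tau> rJ = par j" "regs \<tau> rC = of_bool (i \<noteq> par j)"
    "regs \<tau> rSP = 2 * Suc p" "2 * (Suc p + dep (par j)) + 2 \<le> B"
    using down rd by (auto simp: \<tau>_def ready_def)
  from down.IH[OF this] obtain ups l downs where t: "tpath i (par j) = ups @ [l] @ rev downs" and
    len: "length downs \<le> dep (par j)" and
    r: "run climb_loop \<tau> (16 * (length ups + length downs) + 1) (climbed \<tau> (Suc p) ups l downs)"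
    by blast
  have step: "run climb_step \<sigma> 15 (\<lambda>\<sigma>'. \<sigma>' = \<tau>)"
    unfolding \<tau>_def by (rule climb_step_push) (use down in auto)
  have post: "climbed \<sigma> p ups l (j # downs) \<sigma>'" if c: "climbed \<tau> (Suc p) ups l downs \<sigma>'" for \<sigma>'
  proof -
    have m: "mem \<sigma>' a = mem \<tau> a" if "odd a \<or> a < 2 * Suc p" for a
      using c that unfolding climbed_def by blast
    have "mem \<sigma>' (2 * (p + x)) = (j # downs) ! x" if "x < length (j # downs)" for x
    proof (cases x)
      case 0
      then show ?thesis using m[of "2 * p"] by (simp add: \<tau>_def)
    next
      case (Suc y)
      then have "mem \<sigma>' (2 * (Suc p + y)) = downs ! y" using that c unfolding climbed_def by auto
      then show ?thesis using Suc by simp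
    qed
    moreover have "mem \<sigma>' a = mem \<sigma> a" if "odd a \<or> a < 2 * p" for a
    proof -
      have "a \<noteq> 2 * p" "odd a \<or> a < 2 * Suc p" using that by auto
      then show ?thesis using m[of a] by (simp add: \<tau>_def)
    qed
    ultimately show ?thesis using c unfolding climbed_def by (auto simp: \<tau>_def path_temps_def)
  qed
  have "run climb_loop \<sigma> (Suc (15 + (16 * (length ups + length downs) + 1)))
      (climbed \<sigma> p ups l (j # downs))"
    unfolding climb_loop_def
  proof (rule runs_While_True[OF _ step])
    fix \<sigma>' assume "\<sigma>' = \<tau>"
    then show "run (While rC climb_step) \<sigma>' (16 * (length ups + length downs) + 1)
        (climbed \<sigma> p ups l (j # downs))"
      using runs_weaken[OF r order_refl post] unfolding climb_loop_def by simp
  qed (use down in simp)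
  then have "run climb_loop \<sigma> (16 * (length ups + length (j # downs)) + 1)
      (climbed \<sigma> p ups l (j # downs))" by simp
  moreover have "tpath i j = ups @ [l] @ rev (j # downs)"
    using tpath_down[OF down.hyps(1-5)] t by simp
  moreover have "length (j # downs) \<le> dep j" using len down.hyps(7) by simp
  ultimately show ?case by blast
next
  case (up i j)
  note rd = up.prems(1)[unfolded ready_def]
  define \<tau> where "\<tau> = \<sigma>\<lparr>regs := (regs \<sigma>)(rT := bPar + i, rA := dep i, rG := dep j,
    rI := par i, rC := of_bool (par i \<noteq> j)), out := out \<sigma> @ [i]\<rparr>"
  have "ready \<tau>" "regs \<tau> rI = par i" "regs \<tau> rJ = j" "regs \<tau> rC = of_bool (par i \<noteq> j)"
    "regs \<tau> rSP = 2 * p" "2 * (p + dep j) + 2 \<le> B"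
    using up rd by (auto simp: \<tau>_def ready_def)
  from up.IH[OF this] obtain ups l downs where t: "tpath (par i) j = ups @ [l] @ rev downs" and
    len: "length downs \<le> dep j" and
    r: "run climb_loop \<tau> (16 * (length ups + length downs) + 1) (climbed \<tau> p ups l downs)"
    by blast
  have step: "run climb_step \<sigma> 15 (\<lambda>\<sigma>'. \<sigma>' = \<tau>)"
    unfolding \<tau>_def by (rule climb_step_emit) (use up in auto)
  have post: "climbed \<sigma> p (i # ups) l downs \<sigma>'" if "climbed \<tau> p ups l downs \<sigma>'" for \<sigma>'
    using that unfolding climbed_def by (auto simp: \<tau>_def path_temps_def)
  have "run climb_loop \<sigma> (Suc (15 + (16 * (length ups + length downs) + 1)))
      (climbed \<sigma> p (i # ups) l downs)"
    unfolding climb_loop_def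
  proof (rule runs_While_True[OF _ step])
    fix \<sigma>' assume "\<sigma>' = \<tau>"
    then show "run (While rC climb_step) \<sigma>' (16 * (length ups + length downs) + 1)
        (climbed \<sigma> p (i # ups) l downs)"
      using runs_weaken[OF r order_refl post] unfolding climb_loop_def by simp
  qed (use up in simp)
  then have "run climb_loop \<sigma> (16 * (length (i # ups) + length downs) + 1)
      (climbed \<sigma> p (i # ups) l downs)" by simp
  moreover have "tpath i j = (i # ups) @ [l] @ rev downs"
    using tpath_up[OF up.hyps(1-5)] t by simp
  ultimately show ?case using len by blast
qed

lemma pop_loop_correct:
  assumes "ready \<sigma>" "regs \<sigma> rSP = 2 * length xs" "\<forall>x<length xs. mem \<sigma> (2 * x) = xs ! x"
    "2 * length xs \<le> B"
  shows "run pop_loop \<sigma> (5 * length xs + 1) (\<lambda>\<sigma>'. out \<sigma>' = out \<sigma> @ rev xs \<and>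
    mem \<sigma>' = mem \<sigma> \<and> (\<forall>r. r \<notin> path_temps \<longrightarrow> regs \<sigma>' r = regs \<sigma> r))"
  using assms
proof (induction xs arbitrary: \<sigma> rule: rev_induct)
  case Nil
  then show ?case unfolding pop_loop_def by (auto intro!: runs_While_False[unfolded One_nat_def])
next
  case (snoc a xs)
  note rd = snoc.prems(1)[unfolded ready_def]
  define \<tau> where "\<tau> = \<sigma>\<lparr>regs := (regs \<sigma>)(rSP := 2 * length xs, rT := a), out := out \<sigma> @ [a]\<rparr>"
  have "mem \<sigma> (2 * length xs) = a" using snoc.prems(3) by auto
  then have step: "run (block [Bin Minus rSP rSP rTwo, Load rT rSP, Emit rT]) \<sigma> 4 (\<lambda>\<sigma>'. \<sigma>' = \<tau>)"
    by (intro runs_weaken[OF runs_block]) (use rd snoc in \<open>auto simp: \<tau>_def\<close>)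
  have "\<forall>x<length xs. mem \<tau> (2 * x) = xs ! x"
  proof (intro allI impI)
    fix x assume "x < length xs"
    then have "mem \<sigma> (2 * x) = (xs @ [a]) ! x" using snoc.prems(3) by auto
    then show "mem \<tau> (2 * x) = xs ! x" using \<open>x < length xs\<close> by (simp add: \<tau>_def nth_append)
  qed
  with snoc have IH: "run pop_loop \<tau> (5 * length xs + 1) (\<lambda>\<sigma>'. out \<sigma>' = out \<tau> @ rev xs \<and>
    mem \<sigma>' = mem \<tau> \<and> (\<forall>r. r \<notin> path_temps \<longrightarrow> regs \<sigma>' r = regs \<tau> r))"
    by (intro snoc.IH) (auto simp: \<tau>_def ready_def)
  have "run pop_loop \<sigma> (Suc (4 + (5 * length xs + 1))) (\<lambda>\<sigma>'. out \<sigma>' = out \<sigma> @ rev (xs @ [a]) \<and>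
    mem \<sigma>' = mem \<sigma> \<and> (\<forall>r. r \<notin> path_temps \<longrightarrow> regs \<sigma>' r = regs \<sigma> r))"
    unfolding pop_loop_def
  proof (rule runs_While_True[OF _ step])
    fix \<sigma>' assume "\<sigma>' = \<tau>"
    then show "run (While rSP (block [Bin Minus rSP rSP rTwo, Load rT rSP, Emit rT])) \<sigma>'
        (5 * length xs + 1) (\<lambda>\<sigma>'. out \<sigma>' = out \<sigma> @ rev (xs @ [a]) \<and>
        mem \<sigma>' = mem \<sigma> \<and> (\<forall>r. r \<notin> path_temps \<longrightarrow> regs \<sigma>' r = regs \<sigma> r))"
      using IH unfolding pop_loop_def by (auto elim!: runs_weaken simp: \<tau>_def path_temps_def)
  qed (use snoc in simp)
  then show ?case by (rule runs_weaken) auto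
qed

text \<open>A vertex on the stack costs 16 steps for climbing and 5 for popping; the overhead of 8
  is absorbed by the vertex where the ends meet.\<close>

lemma emit_tree_path_correct:
  assumes "i < n" "j < n" "rt i = rt j" "ready \<sigma>" "regs \<sigma> rI = i" "regs \<sigma> rJ = j"
  shows "run emit_tree_path \<sigma> (21 * length (tpath i j)) (\<lambda>\<sigma>'.
    out \<sigma>' = out \<sigma> @ tpath i j \<and> (\<forall>a. odd a \<longrightarrow> mem \<sigma>' a = mem \<sigma> a) \<and>
    (\<forall>r. r \<notin> path_temps \<longrightarrow> regs \<sigma>' r = regs \<sigma> r))" (is "runs _ _ _ _ _ ?post")
proof -
  note rd = assms(4)[unfolded ready_def]
  define \<tau> where "\<tau> = \<sigma>\<lparr>regs := (regs \<sigma>)(rSP := 0, rC := of_bool (i \<noteq> j))\<rparr>"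
  have init: "run (block [Const rSP 0, Bin Eq rC rI rJ, Bin Eq rC rC rZero]) \<sigma> 4 (\<lambda>\<sigma>'. \<sigma>' = \<tau>)"
    by (intro runs_weaken[OF runs_block]) (use rd words assms in \<open>auto simp: \<tau>_def fun_eq_iff\<close>)
  have dj: "dep j \<le> 2 * n" using dep_le[OF assms(2)] .
  have "ready \<tau>" "regs \<tau> rI = i" "regs \<tau> rJ = j" "regs \<tau> rC = of_bool (i \<noteq> j)" "regs \<tau> rSP = 2 * 0"
    "2 * (0 + dep j) + 2 \<le> B"
    using assms rd words dj by (auto simp: \<tau>_def ready_def)
  from climb_loop_correct[OF assms(1-3) this] obtain ups l downs where
    t: "tpath i j = ups @ [l] @ rev downs" and len: "length downs \<le> dep j" and
    climb: "run climb_loop \<tau> (16 * (length ups + length downs) + 1) (climbed \<tau> 0 ups l downs)"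
    by blast
  have downs: "2 * length downs \<le> B" using len dj words by simp
  have "run emit_tree_path \<sigma>
      (4 + (16 * (length ups + length downs) + 1 + (2 + (5 * length downs + 1)))) ?post"
    unfolding emit_tree_path_def
  proof (rule runs_Seq[OF init])
    fix \<sigma>1 assume 1: "\<sigma>1 = \<tau>"
    show "run (Seq climb_loop (Seq (block [Emit rI]) pop_loop)) \<sigma>1
      (16 * (length ups + length downs) + 1 + (2 + (5 * length downs + 1))) ?post"
      unfolding 1
    proof (rule runs_Seq[OF climb])
      fix \<sigma>2 assume 2: "climbed \<tau> 0 ups l downs \<sigma>2"
      show "run (Seq (block [Emit rI]) pop_loop) \<sigma>2 (2 + (5 * length downs + 1)) ?post"
      proof (rule runs_Seq)
        show "run (block [Emit rI]) \<sigma>2 2 (\<lambda>\<sigma>'. \<sigma>' = \<sigma>2\<lparr>out := out \<sigma>2 @ [l]\<rparr>)"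
          by (intro runs_weaken[OF runs_block]) (use 2 in \<open>auto simp: climbed_def\<close>)
        fix \<sigma>3 assume 3: "\<sigma>3 = \<sigma>2\<lparr>out := out \<sigma>2 @ [l]\<rparr>"
        have "ready \<sigma>3" using assms(4) 2 by (auto simp: 3 climbed_def ready_def path_temps_def
            \<tau>_def)
        then have "run pop_loop \<sigma>3 (5 * length downs + 1) (\<lambda>\<sigma>'. out \<sigma>' = out \<sigma>3 @ rev downs \<and>
            mem \<sigma>' = mem \<sigma>3 \<and> (\<forall>r. r \<notin> path_temps \<longrightarrow> regs \<sigma>' r = regs \<sigma>3 r))"
          by (rule pop_loop_correct) (use 2 downs in \<open>auto simp: 3 climbed_def\<close>)
        then show "run pop_loop \<sigma>3 (5 * length downs + 1) ?post"
          by (rule runs_weaken) (use 2 t in \<open>auto simp: 3 climbed_def \<tau>_def path_temps_def\<close>)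
      qed
    qed
  qed
  then show ?thesis by (rule runs_weaken) (use t in auto)
qed

fun routable :: "nat \<Rightarrow> nat \<Rightarrow> nat list \<Rightarrow> bool" where
  "routable cur v [] \<longleftrightarrow> False"
| "routable cur v [a] \<longleftrightarrow> cur < n \<and> v < n \<and> rt cur = rt v"
| "routable cur v (a # b # xs) \<longleftrightarrow>
     cur < n \<and> (a, b) \<in> K \<and> rt cur = rt (ex a b) \<and> routable (ey a b) v (b # xs)"

text \<open>The loop stops in front of the last leg, whence the split of the route. A leg with
  \<open>L\<close> vertices costs \<open>18 + 21 * L + 3\<close> steps and one for the test; since
  \<open>L \<ge> 1\<close>, this is at most \<open>43 * L\<close>.\<close>

lemma route_loop_correct:
  assumes "routable cur v xs" "ready \<sigma>" "regs \<sigma> rCur = cur" "regs \<sigma> rCnt = length xs"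
    "regs \<sigma> rPtr = Suc (2 * p)" "\<forall>x<length xs. mem \<sigma> (Suc (2 * (p + x))) = xs ! x"
    "regs \<sigma> rC = of_bool (1 < length xs)" "p + length xs \<le> N + 1"
  shows "\<exists>pre cur'. routed cur v xs = pre @ tpath cur' v \<and> cur' < n \<and> v < n \<and> rt cur' = rt v \<and>
    run route_loop \<sigma> (43 * length pre + 1) (\<lambda>\<sigma>'. out \<sigma>' = out \<sigma> @ pre \<and>
      regs \<sigma>' rCur = cur' \<and> regs \<sigma>' rCnt = 1 \<and> ready \<sigma>' \<and> regs \<sigma>' rV = regs \<sigma> rV)"
  using assms
proof (induction cur v xs arbitrary: \<sigma> p rule: routable.induct)
  case (1 cur v)
  then show ?case by simp
next
  case (2 cur v a)
  have "run route_loop \<sigma> 1 (\<lambda>\<sigma>'. out \<sigma>' = out \<sigma> @ [] \<and>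
      regs \<sigma>' rCur = cur \<and> regs \<sigma>' rCnt = 1 \<and> ready \<sigma>' \<and> regs \<sigma>' rV = regs \<sigma> rV)"
    unfolding route_loop_def using 2 by (intro runs_While_False) auto
  then show ?case using 2 by (intro exI[of _ "[]"] exI[of _ cur]) auto
next
  case (3 cur v a b xs)
  note rd = 3(3)[unfolded ready_def]
  have ok: "cur < n" "(a, b) \<in> K" "rt cur = rt (ex a b)" "routable (ey a b) v (b # xs)" using 3(2)
      by auto
  note k = key[OF ok(2)]
  have ab: "mem \<sigma> (Suc (2 * p)) = a" "mem \<sigma> (Suc (Suc (Suc (2 * p)))) = b"
    using 3(7)[rule_format, of 0] 3(7)[rule_format, of 1] by auto
  define g where "g = bucket M T (a, b)"
  define h where "h = slot M T d (a, b)"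
  have gh: "g = (T a + b) mod M" "h = (a + d g) mod M" "g < M" "h < M"
    using M_pos by (auto simp: g_def h_def bucket_def slot_def)
  define \<tau> where "\<tau> = \<sigma>\<lparr>regs := (regs \<sigma>)(rA := a, rPtr := Suc (2 * Suc p), rJ := ex a b, rG := h,
    rT := bY + h, rE := ey a b, rI := cur, rCnt := Suc (length xs))\<rparr>"
  have row: "bT + a < length D0" "(D0 @ Dq) ! (bT + a) = T a"
    using stored_row[of a] k by (auto simp: nth_append)
  have dis: "bd + g < length D0" "(D0 @ Dq) ! (bd + g) = d g"
    using stored_slot(1)[OF gh(3)] by (auto simp: nth_append)
  have ends: "bX + h < length D0" "(D0 @ Dq) ! (bX + h) = ex a b"
      "bY + h < length D0" "(D0 @ Dq) ! (bY + h) = ey a b"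
    using stored_slot(2,3)[OF gh(4)] k by (auto simp: h_def nth_append)
  have lB: "length D0 \<le> B" "n \<le> B" "M \<le> B" "N + M \<le> B" using words by auto
  have s1: "bT + a < B" "bd + g < B" "bX + h < B" "bY + h < B" "cur < B" "g < B" "h < B"
    using row dis ends lB ok gh by linarith+
  have s2: "T a + b < B" using T_less[of a] k lB by linarith
  have s3: "a + d g < B" using d_less[of g] k lB by linarith
  have s4: "Suc (Suc (Suc (2 * p))) < B" "Suc (length xs) < B" using words(3) 3(9) by auto
  have mods: "(T a + b) mod M = g" "(a + d g) mod M = h" using gh by auto
  have lk: "straight B (D0 @ Dq) lookup \<sigma> (\<lambda>\<sigma>'. \<sigma>' = \<tau>)"
    unfolding lookup_def
    by (simp add: rd 3(4-6) ab s1 s2 s3 s4 mods row dis ends trans_less_add1 \<tau>_def fun_upd_twist)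
  have first: "run (block lookup) \<sigma> 18 (\<lambda>\<sigma>'. \<sigma>' = \<tau>)"
    by (rule runs_weaken[OF runs_block[OF lk]]) (simp_all add: lookup_def)
  have r\<tau>: "ready \<tau>" "regs \<tau> rI = cur" "regs \<tau> rJ = ex a b" using rd by (auto simp: \<tau>_def ready_def)
  define good where "good \<sigma>' \<longleftrightarrow> ready \<sigma>' \<and> regs \<sigma>' rCur = ey a b \<and> regs \<sigma>' rCnt = length (b # xs) \<and>
    regs \<sigma>' rPtr = Suc (2 * Suc p) \<and> (\<forall>x<length (b # xs). mem \<sigma>' (Suc (2 * (Suc p + x))) = (b # xs)
        ! x) \<and>
    regs \<sigma>' rC = of_bool (1 < length (b # xs)) \<and> out \<sigma>' = out \<sigma> @ tpath cur (ex a b) \<and>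
    regs \<sigma>' rV = regs \<sigma> rV" for \<sigma>'
  have body: "run route_step \<sigma>
     (18 + (21 * length (tpath cur (ex a b)) + 3)) good"
    unfolding route_step_def
  proof (rule runs_Seq[OF first])
    fix \<sigma>1 assume "\<sigma>1 = \<tau>"
    then show "run (Seq emit_tree_path (block [Bin Plus rCur rE rZero, Bin Less rC rOne rCnt])) \<sigma>1
       (21 * length (tpath cur (ex a b)) + 3) good"
    proof (elim ssubst, intro runs_Seq[OF emit_tree_path_correct[OF ok(1) _ ok(3) r\<tau>]])
      show "ex a b < n" using k by simp
      fix \<sigma>2 :: state assume 2: "out \<sigma>2 = out \<tau> @ tpath cur (ex a b) \<and> (\<forall>a. odd a \<longrightarrow>
          mem \<sigma>2 a = mem \<tau> a) \<and>
        (\<forall>r. r \<notin> path_temps \<longrightarrow> regs \<sigma>2 r = regs \<tau> r)"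
      then have reg2: "regs \<sigma>2 r = regs \<tau> r" if "r \<notin> path_temps" for r using that by blast
      have m2: "mem \<sigma>2 (Suc (2 * (Suc p + x))) = (b # xs) ! x" if "x < length (b # xs)" for x
      proof -
        have "mem \<sigma>2 (Suc (2 * (Suc p + x))) = mem \<sigma> (Suc (2 * (p + Suc x)))" using 2
            by (simp add: \<tau>_def)
        then show ?thesis using 3(7)[rule_format, of "Suc x"] that by simp
      qed
      show "run (block [Bin Plus rCur rE rZero, Bin Less rC rOne rCnt]) \<sigma>2 3 good"
        by (rule runs_weaken[OF runs_block[where \<Phi> = good]])
          (use 2 m2 reg2[of rE] reg2[of rZero] reg2[of rOne] reg2[of rCnt] reg2[of rPtr] reg2[of rV]
              reg2[of rTwo]
            reg2[of rPar] reg2[of rDep] reg2[of rRow] reg2[of rDis] reg2[of rX] reg2[of rY] reg2[of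
                rM]
            rd k words in \<open>auto simp: path_temps_def \<tau>_def good_def ready_def\<close>)
    qed
  qed
  have IHp: "\<exists>pre cur'. routed (ey a b) v (b # xs) = pre @ tpath cur' v \<and> cur' < n \<and> v < n \<and>
      rt cur' = rt v \<and>
    run route_loop \<sigma>1 (43 * length pre + 1) (\<lambda>\<sigma>'. out \<sigma>' = out \<sigma>1 @ pre \<and>
      regs \<sigma>' rCur = cur' \<and> regs \<sigma>' rCnt = 1 \<and> ready \<sigma>' \<and> regs \<sigma>' rV = regs \<sigma>1 rV)"
    if "good \<sigma>1" for \<sigma>1
    using 3(1)[OF ok(4), of \<sigma>1 "Suc p"] that 3(9) unfolding good_def by simp
  \<comment> \<open>The split given by the induction hypothesis may depend on the state after the
    first leg, so one run is fixed before \<open>pre\<close> and \<open>cur'\<close> are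
    chosen.\<close>
  obtain k1 \<sigma>1 where \<sigma>1: "exec B (D0 @ Dq) route_step \<sigma> k1 \<sigma>1"
    "k1 \<le> 18 + (21 * length (tpath cur (ex a b)) + 3)" "good \<sigma>1"
    using body unfolding runs_def by blast
  obtain pre cur' where IH: "routed (ey a b) v (b # xs) = pre @ tpath cur' v" "cur' < n" "v < n"
      "rt cur' = rt v"
    "run route_loop \<sigma>1 (43 * length pre + 1) (\<lambda>\<sigma>'. out \<sigma>' = out \<sigma>1 @ pre \<and>
      regs \<sigma>' rCur = cur' \<and> regs \<sigma>' rCnt = 1 \<and> ready \<sigma>' \<and> regs \<sigma>' rV = regs \<sigma>1 rV)"
    using IHp[OF \<sigma>1(3)] by blast
  obtain k2 \<sigma>2 where \<sigma>2: "exec B (D0 @ Dq) route_loop \<sigma>1 k2 \<sigma>2" "k2 \<le> 43 * length pre + 1"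
    "out \<sigma>2 = out \<sigma>1 @ pre" "regs \<sigma>2 rCur = cur'" "regs \<sigma>2 rCnt = 1" "ready \<sigma>2"
        "regs \<sigma>2 rV = regs \<sigma>1 rV"
    using IH(5) unfolding runs_def by blast
  have "exec B (D0 @ Dq) route_loop \<sigma> (Suc (k1 + k2)) \<sigma>2"
    unfolding route_loop_def
    by (rule exec.WhileTrue[OF _ \<sigma>1(1) \<sigma>2(1)[unfolded route_loop_def]]) (use 3 in simp)
  moreover have "1 \<le> length (tpath cur (ex a b))" by (simp add: Suc_le_eq)
  then have "Suc (k1 + k2) \<le> 43 * length (tpath cur (ex a b) @ pre) + 1" using \<sigma>1(2) \<sigma>2(2) by simp
  ultimately have "run route_loop \<sigma> (43 * length (tpath cur (ex a b) @ pre) + 1)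
    (\<lambda>\<sigma>'. out \<sigma>' = out \<sigma> @ tpath cur (ex a b) @ pre \<and>
      regs \<sigma>' rCur = cur' \<and> regs \<sigma>' rCnt = 1 \<and> ready \<sigma>' \<and> regs \<sigma>' rV = regs \<sigma> rV)"
    using \<sigma>2 \<sigma>1(3) unfolding runs_def good_def by auto
  then show ?case using IH
    by (intro exI[of _ "tpath cur (ex a b) @ pre"] exI[of _ cur']) simp
qed

text \<open>The bound \<open>N + 1\<close> also admits the one-entry list for two vertices of the
  same cluster when \<open>N = 0\<close>.\<close>

lemma finish_correct:
  assumes "routable cur v xs" "ready \<sigma>" "regs \<sigma> rCur = cur" "regs \<sigma> rV = v"
      "regs \<sigma> rCnt = length xs"
    "regs \<sigma> rPtr = 1" "\<forall>x<length xs. mem \<sigma> (Suc (2 * x)) = xs ! x" "length xs \<le> N + 1" "out \<sigma> = []"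
  shows "run finish \<sigma> (43 * length (routed cur v xs) + 9) (\<lambda>\<sigma>'. out \<sigma>' = routed cur v xs)"
proof -
  note rd = assms(2)[unfolded ready_def]
  define \<tau> where "\<tau> = \<sigma>\<lparr>regs := (regs \<sigma>)(rC := of_bool (1 < length xs))\<rparr>"
  have first: "run (block [Bin Less rC rOne rCnt]) \<sigma> 2 (\<lambda>\<sigma>'. \<sigma>' = \<tau>)"
    by (rule runs_weaken[OF runs_block]) (use rd words assms in \<open>auto simp: \<tau>_def\<close>)
  have "ready \<tau>" "regs \<tau> rCur = cur" "regs \<tau> rCnt = length xs" "regs \<tau> rPtr = Suc (2 * 0)"
    "\<forall>x<length xs. mem \<tau> (Suc (2 * (0 + x))) = xs ! x" "regs \<tau> rC = of_bool (1 < length xs)"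
    "0 + length xs \<le> N + 1"
    using assms rd by (auto simp: \<tau>_def ready_def)
  from route_loop_correct[OF assms(1) this] obtain pre cur' where
    r: "routed cur v xs = pre @ tpath cur' v" "cur' < n" "v < n" "rt cur' = rt v" and
    loop: "run route_loop \<tau> (43 * length pre + 1) (\<lambda>\<sigma>'. out \<sigma>' = out \<tau> @ pre \<and>
      regs \<sigma>' rCur = cur' \<and> regs \<sigma>' rCnt = 1 \<and> ready \<sigma>' \<and>
          regs \<sigma>' rV = regs \<tau> rV)" (is "runs _ _ _ _ _ ?mid")
    by blast
  have "run finish \<sigma> (2 + (Suc (43 * length pre + 1) + Suc (3 + 21 * length (tpath cur' v))))
      (\<lambda>\<sigma>'. out \<sigma>' = routed cur v xs)"
    unfolding finish_def
  proof (rule runs_Seq[OF first], elim ssubst, rule runs_Seq)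
    show "run (Cond rC route_loop Skip) \<tau> (Suc (43 * length pre + 1)) ?mid"
    proof (rule runs_Cond)
      show "run route_loop \<tau> (43 * length pre + 1) ?mid" by (rule loop)
      assume 0: "regs \<tau> rC = 0"
      \<comment> \<open>With the flag 0 the loop can only exit at once in its initial state, so its
        postcondition already holds there.\<close>
      from loop have mid: "?mid \<tau>"
        unfolding runs_def route_loop_def using 0
        by (auto elim: exec.cases)
      show "run Skip \<tau> (43 * length pre + 1) ?mid"
        by (rule runs_weaken[OF runs_Skip[where \<Phi> = ?mid, OF mid]]) auto
    qed
    fix \<sigma>1 assume 1: "?mid \<sigma>1"
    show "run (Cond rCnt (Seq (block load_ends) emit_tree_path) Skip)
      \<sigma>1 (Suc (3 + 21 * length (tpath cur' v))) (\<lambda>\<sigma>'. out \<sigma>' = routed cur v xs)"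
    proof (rule runs_Cond)
      define \<tau>2 where "\<tau>2 = \<sigma>1\<lparr>regs := (regs \<sigma>1)(rI := cur', rJ := v)\<rparr>"
      have rd1: "ready \<sigma>1" using 1 by blast
      have "ready \<tau>2" "regs \<tau>2 rI = cur'" "regs \<tau>2 rJ = v" using rd1
          by (auto simp: \<tau>2_def ready_def)
      note e = emit_tree_path_correct[OF r(2,3,4) this]
      have b: "run (block load_ends) \<sigma>1 3 (\<lambda>\<sigma>'. \<sigma>' = \<tau>2)"
        by (rule runs_weaken[OF runs_block])
          (use 1 rd1[unfolded ready_def] words assms r in \<open>auto simp: \<tau>2_def \<tau>_def load_ends_def\<close>)
      show "run (Seq (block load_ends) emit_tree_path)
          \<sigma>1 (3 + 21 * length (tpath cur' v)) (\<lambda>\<sigma>'. out \<sigma>' = routed cur v xs)"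
        by (rule runs_Seq[OF b], elim ssubst, rule runs_weaken[OF e])
          (use 1 r assms in \<open>auto simp: \<tau>2_def \<tau>_def\<close>)
    qed (use 1 in simp)
  qed
  then show ?thesis by (rule runs_weaken) (use r in auto)
qed

lemma finish_empty:
  assumes "ready \<sigma>" "regs \<sigma> rCnt = 0" "out \<sigma> = []"
  shows "run finish \<sigma> 9 (\<lambda>\<sigma>'. out \<sigma>' = [])"
proof -
  note rd = assms(1)[unfolded ready_def]
  define \<tau> where "\<tau> = \<sigma>\<lparr>regs := (regs \<sigma>)(rC := 0)\<rparr>"
  have first: "run (block [Bin Less rC rOne rCnt]) \<sigma> 2 (\<lambda>\<sigma>'. \<sigma>' = \<tau>)"
    by (rule runs_weaken[OF runs_block]) (use rd words assms in \<open>auto simp: \<tau>_def\<close>)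
  have "run finish \<sigma> (2 + (Suc 1 + Suc 1)) (\<lambda>\<sigma>'. out \<sigma>' = [])"
    unfolding finish_def
  proof (rule runs_Seq[OF first], elim ssubst, rule runs_Seq[where \<Phi> = "\<lambda>\<sigma>'. \<sigma>' = \<tau>"])
    show "run (Cond rC route_loop Skip) \<tau> (Suc 1) (\<lambda>\<sigma>'. \<sigma>' = \<tau>)"
      by (rule runs_Cond) (auto simp: \<tau>_def intro: runs_Skip[unfolded One_nat_def])
    fix \<sigma>1 assume "\<sigma>1 = \<tau>"
    then show "run (Cond rCnt (Seq (block load_ends) emit_tree_path) Skip)
      \<sigma>1 (Suc 1) (\<lambda>\<sigma>'. out \<sigma>' = [])"
      by (intro runs_Cond) (use assms in \<open>auto simp: \<tau>_def intro: runs_Skip[unfolded One_nat_def]\<close>)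
  qed
  then show ?thesis by (rule runs_weaken) auto
qed

lemma prologue_correct:
  assumes "u < n" "v < n"
  shows "run (block prologue) (query_state u v) 31 (\<lambda>\<sigma>. ready \<sigma> \<and> regs \<sigma> rOff = length D0 \<and>
    regs \<sigma> rN = N \<and> regs \<sigma> rPtr = 1 \<and> regs \<sigma> rA = cid u \<and> regs \<sigma> rG = cid v \<and> regs \<sigma> rCur = u \<and>
    regs \<sigma> rV = v \<and> regs \<sigma> rC = of_bool (cid u = cid v) \<and> mem \<sigma> = (\<lambda>_. 0) \<and> out \<sigma> = [] \<and>
    (\<forall>r. regs \<sigma> (r + 26) = 0) \<and> regs \<sigma> rCnt = 0)"
proof -
  have l: "0 < length D0" "Suc 0 < length D0" "2 < length D0" "3 < length D0" "4 < length D0"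
    "5 < length D0" "6 < length D0" "7 < length D0" "8 < length D0" "9 < length D0"
    using header(11) by linarith+
  have h: "(D0 @ Dq) ! 0 = bPar" "(D0 @ Dq) ! Suc 0 = bDep" "(D0 @ Dq) ! 2 = bCid"
      "(D0 @ Dq) ! 3 = bT"
    "(D0 @ Dq) ! 4 = bd" "(D0 @ Dq) ! 5 = bX" "(D0 @ Dq) ! 6 = bY" "(D0 @ Dq) ! 7 = length D0"
    "(D0 @ Dq) ! 8 = N" "(D0 @ Dq) ! 9 = M"
    using header l by (simp_all add: nth_append del: length_greater_0_conv)
  have lB: "length D0 \<le> B" "n \<le> B" using words by auto
  have c: "(D0 @ Dq) ! (bCid + u) = cid u" "bCid + u < length D0"
    "(D0 @ Dq) ! (bCid + v) = cid v" "bCid + v < length D0"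
    using stored_vertex(3)[OF assms(1)] stored_vertex(3)[OF assms(2)] by (auto simp: nth_append)
  note lt = l[THEN less_le_trans, OF lB(1)]
  have cB: "bCid + u < B" "bCid + v < B" "u < B" using c(2,4) lB assms by linarith+
  have b01: "of_bool x < B" for x using lt(2) by (cases x) auto
  have "straight B (D0 @ Dq) prologue (query_state u v) (\<lambda>\<sigma>. ready \<sigma> \<and> regs \<sigma> rOff = length D0 \<and>
    regs \<sigma> rN = N \<and> regs \<sigma> rPtr = 1 \<and> regs \<sigma> rA = cid u \<and> regs \<sigma> rG = cid v \<and> regs \<sigma> rCur = u \<and>
    regs \<sigma> rV = v \<and> regs \<sigma> rC = of_bool (cid u = cid v) \<and> mem \<sigma> = (\<lambda>_. 0) \<and> out \<sigma> = [] \<and>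
    (\<forall>r. regs \<sigma> (r + 26) = 0) \<and> regs \<sigma> rCnt = 0)"
    unfolding prologue_def query_state_def ready_def
    by (simp add: h l lt c cB b01 trans_less_add1 l(1)[unfolded length_greater_0_conv])
  from runs_block[OF this] show ?thesis by (rule runs_weaken) (simp_all add: prologue_def)
qed

lemma query_correct:
  assumes uv: "u < n" "v < n"
    and mid: "\<And>\<sigma>. ready \<sigma> \<Longrightarrow> regs \<sigma> rOff = length D0 \<Longrightarrow> regs \<sigma> rN = N \<Longrightarrow> regs \<sigma> rPtr = 1 \<Longrightarrow>
      regs \<sigma> rA = cid u \<Longrightarrow> regs \<sigma> rG = cid v \<Longrightarrow> regs \<sigma> rCur = u \<Longrightarrow> regs \<sigma> rV = v \<Longrightarrow>
      regs \<sigma> rC = of_bool (cid u = cid v) \<Longrightarrow> mem \<sigma> = (\<lambda>_. 0) \<Longrightarrow> out \<sigma> = [] \<Longrightarrow>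
      \<forall>r. regs \<sigma> (r + 26) = 0 \<Longrightarrow> regs \<sigma> rCnt = 0 \<Longrightarrow>
      run (dispatch Q) \<sigma> t1 \<Phi>"
    and fin: "\<And>\<sigma>. \<Phi> \<sigma> \<Longrightarrow> run finish \<sigma> t2 (\<lambda>\<sigma>'. out \<sigma>' = R)"
  shows "\<exists>k \<le> 31 + (t1 + t2). answers B (query Q) (D0 @ Dq) u v R k"
proof -
  have "run (query Q) (query_state u v) (31 + (t1 + t2)) (\<lambda>\<sigma>'. out \<sigma>' = R)"
    unfolding query_def
    by (rule runs_Seq[OF prologue_correct[OF uv]], rule runs_Seq[where \<Phi> = \<Phi>])
       (use mid fin in blast)+
  then show ?thesis unfolding runs_def answers_def by blast
qed

lemma query_same:
  assumes uv: "u < n" "v < n" and same: "cid u = cid v" "rt u = rt v"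
  shows "\<exists>k \<le> 50 + 43 * length (tpath u v). answers B (query Q) (D0 @ Dq) u v (tpath u v) k"
proof -
  \<comment> \<open>the list of clusters is read from the memory, which is still zero; a single entry is never
      looked up\<close>
  have "\<exists>k \<le> 31 + (3 + (43 * length (routed u v [0]) + 9)). answers B (query Q) (D0 @ Dq) u v
      (routed u v [0]) k"
  proof (rule query_correct[OF uv])
    fix \<sigma> assume \<sigma>: "ready \<sigma>" "regs \<sigma> rPtr = 1" "regs \<sigma> rCur = u" "regs \<sigma> rV = v"
      "regs \<sigma> rC = of_bool (cid u = cid v)" "mem \<sigma> = (\<lambda>_. 0)" "out \<sigma> = []"
    define \<tau> where "\<tau> = \<sigma>\<lparr>regs := (regs \<sigma>)(rCnt := 1)\<rparr>"
    have "run (block [Const rCnt 1]) \<sigma> 2 (\<lambda>\<sigma>'. \<sigma>' = \<tau>)"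
      by (rule runs_weaken[OF runs_block]) (use words in \<open>auto simp: \<tau>_def\<close>)
    then have "run (dispatch Q) \<sigma> (Suc 2)
        (\<lambda>\<sigma>'. \<sigma>' = \<tau>)"
      unfolding dispatch_def by (rule runs_Cond) (use \<sigma> same in auto)
    then show "run (dispatch Q) \<sigma> 3
        (\<lambda>\<sigma>. ready \<sigma> \<and> regs \<sigma> rPtr = 1 \<and> regs \<sigma> rCur = u \<and> regs \<sigma> rV = v \<and> regs \<sigma> rCnt = 1 \<and>
          mem \<sigma> = (\<lambda>_. 0) \<and> out \<sigma> = [])"
      by (rule runs_weaken) (use \<sigma> in \<open>auto simp: \<tau>_def ready_def\<close>)
  next
    fix \<sigma> assume "ready \<sigma> \<and> regs \<sigma> rPtr = 1 \<and> regs \<sigma> rCur = u \<and> regs \<sigma> rV = v \<and> regs \<sigma> rCnt = 1 \<and>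
          mem \<sigma> = (\<lambda>_. 0) \<and> out \<sigma> = []"
    then show "run finish \<sigma> (43 * length (routed u v [0]) + 9) (\<lambda>\<sigma>'. out \<sigma>' = routed u v [0])"
      by (intro finish_correct) (use uv same in auto)
  qed
  then obtain k where "k \<le> 31 + (3 + (43 * length (routed u v [0]) + 9))"
    "answers B (query Q) (D0 @ Dq) u v (routed u v [0]) k" by blast
  then show ?thesis by (intro exI[of _ k]) simp
qed

lemma query_apart:
  assumes uv: "u < n" "v < n" and apart: "cid u \<noteq> cid v" "\<not> (cid u < N \<and> cid v < N)"
  shows "\<exists>k \<le> 50. answers B (query Q) (D0 @ Dq) u v [] k"
proof -
  have "\<exists>k \<le> 31 + (7 + 9). answers B (query Q) (D0 @ Dq) u v [] k"
  proof (rule query_correct[OF uv])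
    fix \<sigma> assume \<sigma>: "ready \<sigma>" "regs \<sigma> rN = N" "regs \<sigma> rA = cid u" "regs \<sigma> rG = cid v"
      "regs \<sigma> rC = of_bool (cid u = cid v)" "out \<sigma> = []" "regs \<sigma> rCnt = 0"
    have b: "run (block test_big) \<sigma> 4
        (\<lambda>\<sigma>. ready \<sigma> \<and> regs \<sigma> rCnt = 0 \<and> out \<sigma> = [] \<and> regs \<sigma> rC = 0)"
      by (rule runs_weaken[OF runs_block]) (use words \<sigma> apart in \<open>auto simp: ready_def
          test_big_def\<close>)
    have "run (dispatch Q) \<sigma> (Suc (4 + Suc 1))
        (\<lambda>\<sigma>. ready \<sigma> \<and> regs \<sigma> rCnt = 0 \<and> out \<sigma> = [])"
      unfolding dispatch_def
    proof (rule runs_Cond)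
      show "run (Seq (block test_big)
           (Cond rC (Seq (block load_query) (simulate Q)) Skip)) \<sigma> (4 + Suc 1)
           (\<lambda>\<sigma>. ready \<sigma> \<and> regs \<sigma> rCnt = 0 \<and> out \<sigma> = [])"
        by (rule runs_Seq[OF b], rule runs_Cond) (auto intro: runs_Skip[unfolded One_nat_def])
    qed (use \<sigma> apart in auto)
    then show "run (dispatch Q) \<sigma> 7
        (\<lambda>\<sigma>. ready \<sigma> \<and> regs \<sigma> rCnt = 0 \<and> out \<sigma> = [])"
      by (rule runs_weaken) auto
  qed (use finish_empty in auto)
  then obtain k where "k \<le> 31 + (7 + 9)" "answers B (query Q) (D0 @ Dq) u v [] k" by blast
  then show ?thesis by (intro exI[of _ k]) simp
qed

text \<open>\<open>W\<close> bounds every value of the simulation: the words of the given machine,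
  its stored data and the cluster numbers. A simple path of the quotient has at most
  \<open>N\<close> vertices, which limits the output cells.\<close>

lemma query_simulated:
  assumes uv: "u < n" "v < n" and cl: "cid u \<noteq> cid v" "cid u < N" "cid v < N"
    and ans: "answers Bq Q Dq (cid u) (cid v) P k" "length P \<le> N" "P = [] \<or> routable u v P"
    and W: "Bq \<le> W" "\<forall>x\<in>set Dq. x < W" "N \<le> W" "2 * W \<le> B" "W + length D0 \<le> B"
  shows "\<exists>k' \<le> 60 + 5 * k + 43 * length (routed u v P). answers B (query Q) (D0 @ Dq) u v (routed u
      v P) k'"
proof -
  obtain s where s: "exec Bq Dq Q (query_state (cid u) (cid v)) k s" "out s = P"
    using ans(1) unfolding answers_def by blast
  define mid where "mid \<sigma> \<longleftrightarrow> ready \<sigma> \<and> regs \<sigma> rPtr = 1 \<and> regs \<sigma> rCur = u \<and> regs \<sigma> rV = v \<and>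
    regs \<sigma> rCnt = length P \<and> (\<forall>x<length P. mem \<sigma> (Suc (2 * x)) = P ! x) \<and> out \<sigma> = []" for \<sigma>
  have "\<exists>k' \<le> 31 + (Suc (4 + Suc (3 + 5 * k)) + (43 * length (routed u v P) + 9)).
    answers B (query Q) (D0 @ Dq) u v (routed u v P) k'"
  proof (rule query_correct[OF uv])
    fix \<sigma> assume \<sigma>: "ready \<sigma>" "regs \<sigma> rOff = length D0" "regs \<sigma> rN = N" "regs \<sigma> rPtr = 1"
      "regs \<sigma> rA = cid u" "regs \<sigma> rG = cid v" "regs \<sigma> rCur = u" "regs \<sigma> rV = v"
      "regs \<sigma> rC = of_bool (cid u = cid v)" "mem \<sigma> = (\<lambda>_. 0)" "out \<sigma> = []"
      "\<forall>r. regs \<sigma> (r + 26) = 0" "regs \<sigma> rCnt = 0"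
    define \<tau> where "\<tau> = \<sigma>\<lparr>regs := (regs \<sigma>)(rC := 1, rT := 1)\<rparr>"
    define \<tau>' where "\<tau>' = \<tau>\<lparr>regs := (regs \<tau>)(26 := cid u, 27 := cid v)\<rparr>"
    have b: "run (block test_big) \<sigma> 4 (\<lambda>\<sigma>'. \<sigma>' = \<tau>)"
      by (rule runs_weaken[OF runs_block]) (use words \<sigma> cl in \<open>auto simp: \<tau>_def test_big_def
          fun_eq_iff\<close>)
    have b': "run (block load_query) \<tau> 3 (\<lambda>\<sigma>'. \<sigma>' = \<tau>')"
    proof (rule runs_weaken[OF runs_block])
      have "cid u < B" "cid v < B" using cl words by auto
      then show "straight B (D0 @ Dq) load_query \<tau> (\<lambda>\<sigma>'. \<sigma>' = \<tau>')"
        by (simp add: \<tau>_def \<tau>'_def load_query_def \<sigma>(5,6) \<sigma>(1)[unfolded ready_def])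
    qed (simp_all add: load_query_def)
    have r26: "regs \<tau>' (r + 26) = regs (query_state (cid u) (cid v)) r" for r
    proof -
      have "regs \<sigma> (r + 26) = 0" using \<sigma>(12) by blast
      then show ?thesis by (auto simp: \<tau>'_def \<tau>_def query_state_def)
    qed
    have sim: "simulates (regs \<tau>') [] (query_state (cid u) (cid v)) \<tau>'"
      using \<sigma> r26 unfolding simulates_def by (auto simp: \<tau>'_def \<tau>_def query_state_def)
    have bd: "bounded_state W (query_state (cid u) (cid v))"
      using cl W by (auto simp: bounded_state_def query_state_def)
    have \<rho>: "regs \<tau>' rOne = 1" "regs \<tau>' rOff = length D0"
      using \<sigma> by (auto simp: \<tau>'_def \<tau>_def ready_def)
    have sq: "run (simulate Q) \<tau>' (5 * k) (simulates (regs \<tau>') [] s)"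
      using exec_simulate[OF s(1) sim bd _ W(1,2,4) _ _ \<rho>, of N] s(2) ans(2) W(5) words by simp
    have mq: "mid \<sigma>'" if "simulates (regs \<tau>') [] s \<sigma>'" for \<sigma>'
    proof -
      have rr: "regs \<sigma>' r = regs \<tau>' r" if "r < 26" "r \<noteq> rT" "r \<noteq> rCnt" for r
        using \<open>simulates (regs \<tau>') [] s \<sigma>'\<close> that unfolding simulates_def by blast
      have "regs \<sigma>' rCnt = length P" "\<forall>x<length P. mem \<sigma>' (Suc (2 * x)) = P ! x" "out \<sigma>' = []"
        using that s(2) unfolding simulates_def by auto
      then show ?thesis using \<sigma> unfolding mid_def ready_def
        by (simp add: rr) (simp add: \<tau>'_def \<tau>_def)
    qed
    have q: "run (simulate Q) \<tau>' (5 * k) mid" by (rule runs_weaken[OF sq order_refl mq])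
    show "run (dispatch Q) \<sigma>
           (Suc (4 + Suc (3 + 5 * k))) mid"
      unfolding dispatch_def
    proof (rule runs_Cond)
      show "run (Seq (block test_big)
           (Cond rC (Seq (block load_query) (simulate Q)) Skip)) \<sigma>
           (4 + Suc (3 + 5 * k)) mid"
      proof (rule runs_Seq[OF b], elim ssubst, rule runs_Cond)
        show "run (Seq (block load_query) (simulate Q)) \<tau>
            (3 + 5 * k) mid"
          by (rule runs_Seq[OF b'], elim ssubst, rule q)
      qed (simp add: \<tau>_def)
    qed (use \<sigma> cl in simp)
  next
    fix \<sigma> assume m: "mid \<sigma>"
    show "run finish \<sigma> (43 * length (routed u v P) + 9) (\<lambda>\<sigma>'. out \<sigma>' = routed u v P)"
    proof (cases "P = []")
      case True
      then show ?thesis using m finish_empty[of \<sigma>] by (simp add: mid_def)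
    next
      case False
      then have r: "routable u v P" using ans(3) by blast
      show ?thesis by (rule finish_correct[OF r]) (use m ans(2) in \<open>simp_all add: mid_def\<close>)
    qed
  qed
  then obtain k' where "k' \<le> 31 + (Suc (4 + Suc (3 + 5 * k)) + (43 * length (routed u v P) + 9))"
    "answers B (query Q) (D0 @ Dq) u v (routed u v P) k'" by blast
  then show ?thesis by (intro exI[of _ k']) simp
qed

end

subsection \<open>Tree paths\<close>

lemma path_edges_append:
  "xs \<noteq> [] \<Longrightarrow> ys \<noteq> [] \<Longrightarrow>
    path_edges (xs @ ys) = path_edges xs @ {last xs, hd ys} # path_edges ys"
proof (induction xs rule: path_edges.induct)
  case ("2_2" x)
  then show ?case by (cases ys) auto
qed auto

lemma length_path_edges: "length (path_edges P) = length P - 1"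
  by (induction P rule: path_edges.induct) auto

lemma path_weight_append:
  "xs \<noteq> [] \<Longrightarrow> ys \<noteq> [] \<Longrightarrow>
    path_weight w (xs @ ys) = path_weight w xs + w {last xs, hd ys} + path_weight w ys"
  by (simp add: path_weight_def path_edges_append)

lemma path_weight_nonneg:
  assumes "\<forall>e\<in>E. 0 \<le> w e" "set (path_edges P) \<subseteq> E"
  shows "0 \<le> path_weight w P"
  unfolding path_weight_def using assms by (intro sum_list_nonneg) auto

text \<open>Some edge of the path leaves \<open>A\<close> and weighs at least
  \<open>\<beta>\<close>; the others are nonnegative.\<close>

lemma path_weight_crossing:
  assumes "\<forall>e\<in>E. 0 \<le> w e" "P \<noteq> []" "set (path_edges P) \<subseteq> E" "hd P \<in> A" "last P \<notin> A"
    and "\<And>u v. {u, v} \<in> E \<Longrightarrow> u \<in> A \<Longrightarrow> v \<notin> A \<Longrightarrow> \<beta> \<le> w {u, v}"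
  shows "\<beta> \<le> path_weight w P"
  using assms(2-5)
proof (induction P rule: path_edges.induct)
  case (1 x y xs)
  have rest: "0 \<le> path_weight w (y # xs)" using 1 by (intro path_weight_nonneg[OF assms(1)]) simp
  have pw: "path_weight w (x # y # xs) = w {x, y} + path_weight w (y # xs)"
    by (simp add: path_weight_def)
  have xy: "{x, y} \<in> E" "0 \<le> w {x, y}" using 1 assms(1) by auto
  show ?case
  proof (cases "y \<in> A")
    case True
    then have "\<beta> \<le> path_weight w (y # xs)" using 1 by simp
    then show ?thesis using pw xy by simp
  next
    case False
    then have "\<beta> \<le> w {x, y}" using assms(6)[OF xy(1)] 1 by simp
    then show ?thesis using pw rest by simp
  qed
qed auto

locale clustered_graph =
  fixes s n :: nat and E :: "nat set set" and w :: "nat set \<Rightarrow> real" and par dep :: "nat \<Rightarrow> nat"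
    and D :: "nat \<Rightarrow> nat set" and rt :: "nat \<Rightarrow> nat" and R :: "nat set"
  assumes graph: "weighted_graph n E w" and clustering: "clustering s n E w par dep D rt R"

sublocale clustered_graph \<subseteq> rooted_forest n par dep rt
proof -
  note c1 = clustering[unfolded clustering_def, THEN conjunct1]
    and c2 = clustering[unfolded clustering_def, THEN conjunct2, THEN conjunct1]
  show "rooted_forest n par dep rt"
  proof
    fix v assume v: "v < n"
    show "par v < n" "rt (par v) = rt v" "rt v < n" using c1 v by blast+
    show "v = rt v \<Longrightarrow> dep v = 0" "v \<noteq> rt v \<Longrightarrow> dep v = Suc (dep (par v))"
      using c2[rule_format, OF v] by presburger+
  qed
qed

context clustered_graph
begin

lemma dep_less: "v < n \<Longrightarrow> dep v < 3 * s" and dep_le: "v < n \<Longrightarrow> dep v \<le> 2 * n"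
  and par_edge: "v < n \<Longrightarrow> v \<noteq> rt v \<Longrightarrow> {v, par v} \<in> E"
  and desc: "x < n \<Longrightarrow> u < n \<Longrightarrow> u \<in> D x \<longleftrightarrow> u = x \<or> u \<noteq> rt u \<and> par u \<in> D x"
  and desc_cluster: "x < n \<Longrightarrow> u \<in> D x \<Longrightarrow> u < n" "x < n \<Longrightarrow> u \<in> D x \<Longrightarrow> rt u = rt x"
  and light: "x < n \<Longrightarrow> x \<noteq> rt x \<Longrightarrow> {u, v} \<in> E \<Longrightarrow> u \<in> D x \<Longrightarrow> v \<notin> D x \<Longrightarrow> w {x, par x} \<le> w {u, v}"
  and big: "R \<subseteq> {..<n}" "s * card R \<le> n" "{u, v} \<in> E \<Longrightarrow> rt u \<noteq> rt v \<Longrightarrow> rt u \<in> R"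
proof -
  note c = clustering[unfolded clustering_def]
  note c1 = c[THEN conjunct1] and d = c[THEN conjunct2]
  note c2 = d[THEN conjunct1] and d2 = d[THEN conjunct2]
  note c3 = d2[THEN conjunct1] and d3 = d2[THEN conjunct2]
  note c4 = d3[THEN conjunct1] and d4 = d3[THEN conjunct2]
  note c5 = d4[THEN conjunct1] and d5 = d4[THEN conjunct2]
  show "v < n \<Longrightarrow> dep v < 3 * s" "v < n \<Longrightarrow> dep v \<le> 2 * n" using c1 by blast+
  show "v < n \<Longrightarrow> v \<noteq> rt v \<Longrightarrow> {v, par v} \<in> E" using c2 by meson
  show "x < n \<Longrightarrow> u < n \<Longrightarrow> u \<in> D x \<longleftrightarrow> u = x \<or> u \<noteq> rt u \<and> par u \<in> D x" using c3 by blast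
  show "x < n \<Longrightarrow> u \<in> D x \<Longrightarrow> u < n" "x < n \<Longrightarrow> u \<in> D x \<Longrightarrow> rt u = rt x" using c4 by blast+
  show "x < n \<Longrightarrow> x \<noteq> rt x \<Longrightarrow> {u, v} \<in> E \<Longrightarrow> u \<in> D x \<Longrightarrow> v \<notin> D x \<Longrightarrow> w {x, par x} \<le> w {u, v}"
    using c5 by blast
  show "R \<subseteq> {..<n}" "s * card R \<le> n" "{u, v} \<in> E \<Longrightarrow> rt u \<noteq> rt v \<Longrightarrow> rt u \<in> R" using d5 by blast+
qed

lemma weight_nonneg: "\<forall>e\<in>E. 0 \<le> w e"
  using graph unfolding weighted_graph_def by blast

lemma edge_less: "{u, v} \<in> E \<Longrightarrow> u < n" "{u, v} \<in> E \<Longrightarrow> v < n"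
  using weighted_graph_edge[OF graph] by auto

lemma desc_dep:
  assumes "x < n" "u \<in> D x" "u \<noteq> x"
  shows "dep x < dep u"
  using assms
proof (induction "dep u" arbitrary: u rule: less_induct)
  case less
  have u: "u < n" using desc_cluster(1) less.prems by blast
  then have p: "u \<noteq> rt u" "par u \<in> D x" using desc[OF less.prems(1) u] less.prems by auto
  have d: "dep u = Suc (dep (par u))" using dep_par[OF u p(1)] .
  show ?case
  proof (cases "par u = x")
    case False
    then show ?thesis using less.hyps[of "par u"] p(2) d less.prems by simp
  qed (use d in simp)
qed

lemma desc_self: "x < n \<Longrightarrow> x \<in> D x"
  using desc by blast

lemma tpath_ends:
  assumes "i < n" "j < n" "rt i = rt j"
  shows "hd (tpath i j) = i \<and> last (tpath i j) = j"
  using assms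
proof (induction rule: tpath_induct)
  case (down i j)
  then show ?case using tpath_down[OF down.hyps(1-5)] down.IH by simp
next
  case (up i j)
  then show ?case using tpath_up[OF up.hyps(1-5)] up.IH by simp
qed simp

text \<open>The end that is lifted first is at least as deep as the other one, and all remaining
  vertices except possibly that other end are less deep; this yields distinctness. Each edge leads
  from some \<open>x\<close> to its parent with exactly one of the two ends below \<open>x\<close>,
  which is the form the cut property needs.\<close>

lemma tpath_props:
  assumes "i < n" "j < n" "rt i = rt j"
  shows "distinct (tpath i j) \<and> (\<forall>y\<in>set (tpath i j). y < n \<and> rt y = rt i \<and>
      (y = i \<or> y = j \<or> dep y < max (dep i) (dep j))) \<and>
    length (tpath i j) \<le> Suc (dep i + dep j) \<and>
    (\<forall>e\<in>set (path_edges (tpath i j)). \<exists>x\<in>set (tpath i j). x \<noteq> rt x \<and> e = {x, par x} \<and> (i \<in> D x \<or>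
        j \<in> D x) \<and>
      \<not> (i \<in> D x \<and> j \<in> D x))"
  using assms
proof (induction rule: tpath_induct)
  case (down i j)
  note ih = down.IH and h = down.hyps
  have pj: "par j < n" "rt i = rt (par j)" using par_less rt_par h by auto
  have t: "tpath i j = tpath i (par j) @ [j]" using tpath_down[OF h(1-5)] .
  have ends: "last (tpath i (par j)) = par j" "tpath i (par j) \<noteq> []"
    using tpath_ends[OF h(1) pj] by auto
  note dist = ih[THEN conjunct1] and len = ih[THEN conjunct2, THEN conjunct2, THEN conjunct1]
  have old: "y < n \<and> rt y = rt i \<and> (y = i \<or> dep y < dep j)" "y \<noteq> j" if "y \<in> set (tpath i (par j))"
      for y
  proof -
    have "y < n \<and> rt y = rt i \<and> (y = i \<or> y = par j \<or> dep y < max (dep i) (dep (par j)))"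
        using ih that by blast
    then show "y < n \<and> rt y = rt i \<and> (y = i \<or> dep y < dep j)" using h(5,7) by auto
    then show "y \<noteq> j" using h(4) by auto
  qed
  have Dj: "j \<in> D x \<longleftrightarrow> j = x \<or> par j \<in> D x" if "x < n" for x using desc[OF that h(2)] h(6) by blast
  show ?case unfolding t
  proof (intro conjI ballI)
    show "distinct (tpath i (par j) @ [j])" using dist old(2) by auto
    show "length (tpath i (par j) @ [j]) \<le> Suc (dep i + dep j)" using len h(7) by simp
    fix y assume "y \<in> set (tpath i (par j) @ [j])"
    then show "y < n" "rt y = rt i" "y = i \<or> y = j \<or> dep y < max (dep i) (dep j)"
      using old[of y] h(2,3) by auto
  next
    fix e assume "e \<in> set (path_edges (tpath i (par j) @ [j]))"
    then have "e \<in> set (path_edges (tpath i (par j))) \<or> e = {j, par j}"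
      using ends by (auto simp: path_edges_append)
    then show "\<exists>x\<in>set (tpath i (par j) @ [j]). x \<noteq> rt x \<and> e = {x, par x} \<and> (i \<in> D x \<or> j \<in> D x) \<and>
        \<not> (i \<in> D x \<and> j \<in> D x)"
    proof
      assume "e = {j, par j}"
      \<comment> \<open>Proper descendants are strictly deeper, whereas
        \<open>dep i < dep j\<close>.\<close>
      moreover have "i \<notin> D j" using desc_dep[OF h(2), of i] h(4,5) by auto
      ultimately show ?thesis using h(6) desc_self[OF h(2)] by (intro bexI[of _ j]) auto
    next
      assume "e \<in> set (path_edges (tpath i (par j)))"
      then obtain x where x: "x \<in> set (tpath i (par j))" "x \<noteq> rt x" "e = {x, par x}"
        "i \<in> D x \<or> par j \<in> D x" "\<not> (i \<in> D x \<and> par j \<in> D x)" using ih by blast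
      then have "j \<in> D x \<longleftrightarrow> par j \<in> D x" using Dj[of x] old[OF x(1)] by auto
      then show ?thesis using x by (intro bexI[of _ x]) auto
    qed
  qed
next
  case (up i j)
  note ih = up.IH and h = up.hyps
  have pi: "par i < n" "rt (par i) = rt j" "rt (par i) = rt i" using par_less rt_par h by auto
  have t: "tpath i j = i # tpath (par i) j" using tpath_up[OF h(1-5)] .
  have ends: "hd (tpath (par i) j) = par i" "tpath (par i) j \<noteq> []"
    using tpath_ends[OF pi(1) h(2) pi(2)]
    by auto
  note dist = ih[THEN conjunct1] and len = ih[THEN conjunct2, THEN conjunct2, THEN conjunct1]
  have old: "y < n \<and> rt y = rt i \<and> (y = j \<or> dep y < dep i)" "y \<noteq> i" if "y \<in> set (tpath (par i) j)"
      for y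
  proof -
    have "y < n \<and> rt y = rt (par i) \<and> (y = par i \<or> y = j \<or> dep y < max (dep (par i)) (dep j))"
        using ih that by blast
    then show "y < n \<and> rt y = rt i \<and> (y = j \<or> dep y < dep i)" using h(5,7) pi by auto
    then show "y \<noteq> i" using h(4) by auto
  qed
  have Di: "i \<in> D x \<longleftrightarrow> i = x \<or> par i \<in> D x" if "x < n" for x using desc[OF that h(1)] h(6) by blast
  show ?case unfolding t
  proof (intro conjI ballI)
    show "distinct (i # tpath (par i) j)" using dist old(2) by auto
    show "length (i # tpath (par i) j) \<le> Suc (dep i + dep j)" using len h(7) by simp
    fix y assume "y \<in> set (i # tpath (par i) j)"
    then show "y < n" "rt y = rt i" "y = i \<or> y = j \<or> dep y < max (dep i) (dep j)"
      using old[of y] h(1) by auto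
  next
    fix e assume "e \<in> set (path_edges (i # tpath (par i) j))"
    then have "e \<in> set (path_edges (tpath (par i) j)) \<or> e = {i, par i}"
      using ends path_edges_append[of "[i]" "tpath (par i) j"] by auto
    then show "\<exists>x\<in>set (i # tpath (par i) j). x \<noteq> rt x \<and> e = {x, par x} \<and> (i \<in> D x \<or> j \<in> D x) \<and>
        \<not> (i \<in> D x \<and> j \<in> D x)"
    proof
      assume "e = {i, par i}"
      moreover have "j \<notin> D i" using desc_dep[OF h(1), of j] h(4,5) by auto
      ultimately show ?thesis using h(6) desc_self[OF h(1)] by (intro bexI[of _ i]) auto
    next
      assume "e \<in> set (path_edges (tpath (par i) j))"
      then obtain x where x: "x \<in> set (tpath (par i) j)" "x \<noteq> rt x" "e = {x, par x}"
        "par i \<in> D x \<or> j \<in> D x" "\<not> (par i \<in> D x \<and> j \<in> D x)" using ih by blast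
      then have "i \<in> D x \<longleftrightarrow> par i \<in> D x" using Di[of x] old[OF x(1)] by auto
      then show ?thesis using x by (intro bexI[of _ x]) auto
    qed
  qed
qed simp

text \<open>The climbs from \<open>i\<close> and from \<open>j\<close> get separate bounds, because
  in a routed path the two ends of a leg are paid for by different edges. Both depths are below
  \<open>3 * s\<close>, hence at most \<open>6 * s\<close> edges.\<close>

lemma tpath_weight:
  assumes "i < n" "j < n" "rt i = rt j" "0 \<le> \<beta>" "0 \<le> \<gamma>"
    and \<beta>: "\<And>x. x < n \<Longrightarrow> x \<noteq> rt x \<Longrightarrow> i \<in> D x \<Longrightarrow> j \<notin> D x \<Longrightarrow> w {x, par x} \<le> \<beta>"
    and \<gamma>: "\<And>x. x < n \<Longrightarrow> x \<noteq> rt x \<Longrightarrow> j \<in> D x \<Longrightarrow> i \<notin> D x \<Longrightarrow> w {x, par x} \<le> \<gamma>"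
  shows "path_weight w (tpath i j) \<le> 6 * real s * (\<beta> + \<gamma>)"
proof -
  note t = tpath_props[OF assms(1-3)]
  note vertices = t[THEN conjunct2, THEN conjunct1]
      and len = t[THEN conjunct2, THEN conjunct2, THEN conjunct1]
    and edges = t[THEN conjunct2, THEN conjunct2, THEN conjunct2]
  have "w e \<le> \<beta> + \<gamma>" if e: "e \<in> set (path_edges (tpath i j))" for e
  proof -
    obtain x where "x \<in> set (tpath i j)" "x \<noteq> rt x" "e = {x, par x}" "i \<in> D x \<or>
        j \<in> D x" "\<not> (i \<in> D x \<and> j \<in> D x)"
      using bspec[OF edges e] by blast
    moreover from this have "x < n" using vertices by blast
    ultimately have "w e \<le> \<beta> \<or> w e \<le> \<gamma>" using \<beta>[of x] \<gamma>[of x] by blast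
    then show ?thesis using assms(4,5) by linarith
  qed
  then have "path_weight w (tpath i j) \<le> (\<Sum>e\<leftarrow>path_edges (tpath i j). \<beta> + \<gamma>)"
    unfolding path_weight_def by (rule sum_list_mono)
  also have "\<dots> = real (length (path_edges (tpath i j))) * (\<beta> + \<gamma>)" by (rule sum_list_triv)
  also have "\<dots> \<le> 6 * real s * (\<beta> + \<gamma>)"
  proof (rule mult_right_mono)
    have "length (path_edges (tpath i j)) \<le> 6 * s"
      using len dep_less[OF assms(1)] dep_less[OF assms(2)]
      by (simp add: length_path_edges)
    then show "real (length (path_edges (tpath i j))) \<le> 6 * real s" by linarith
  qed (use assms(4,5) in simp)
  finally show ?thesis .
qed

lemma light_path:
  assumes "P \<in> paths n E u v" "x < n" "x \<noteq> rt x" "u \<in> D x" "v \<notin> D x"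
  shows "w {x, par x} \<le> path_weight w P"
  using assms light[OF assms(2,3)] unfolding paths_def
  by (intro path_weight_crossing[OF weight_nonneg, where A = "D x"]) auto

text \<open>The path enters \<open>D x\<close> instead of leaving it, so the crossing argument is
  applied to the complement.\<close>

lemma light_path_end:
  assumes "P \<in> paths n E u v" "x < n" "x \<noteq> rt x" "v \<in> D x" "u \<notin> D x"
  shows "w {x, par x} \<le> path_weight w P"
proof (rule path_weight_crossing[OF weight_nonneg, where A = "- D x"])
  show "w {x, par x} \<le> w {a, b}" if "{a, b} \<in> E" "a \<in> - D x" "b \<notin> - D x" for a b
    using light[OF assms(2,3), of b a] that by (simp add: insert_commute)
qed (use assms in \<open>auto simp: paths_def\<close>)

end

subsection \<open>The quotient graph\<close>

text \<open>Numbers below \<open>N\<close> that belong to no cluster are isolated vertices, so the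
  quotient has exactly \<open>N\<close> vertices however many clusters there are.\<close>

locale quotient_graph = clustered_graph +
  fixes N :: nat and cid :: "nat \<Rightarrow> nat"
  assumes cid_eq: "u < n \<Longrightarrow> v < n \<Longrightarrow> cid u = cid v \<longleftrightarrow> rt u = rt v"
    and cid_less: "u < n \<Longrightarrow> cid u < N \<longleftrightarrow> rt u \<in> R"
begin

definition qE :: "nat set set" where
  "qE = {f. \<exists>u v. {u, v} \<in> E \<and> cid u \<noteq> cid v \<and> f = {cid u, cid v}}"

text \<open>The lightest of the parallel edges between two clusters; the minimum is meaningful for
  \<open>f \<in> qE\<close>, where the set is finite and nonempty.\<close>

definition qw :: "nat set \<Rightarrow> real" where
  "qw f = Min (w ` {e \<in> E. cid ` e = f})"

text \<open>An oriented representative that starts in cluster \<open>a\<close>. The two orientations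
  may pick different edges of equal weight, which is the origin of the factor 2 in the size of the
  lifted spanner.\<close>

definition link :: "nat \<Rightarrow> nat \<Rightarrow> nat \<times> nat" where
  "link a b = (SOME p. {fst p, snd p} \<in> E \<and> cid (fst p) = a \<and> cid (snd p) = b \<and>
     w {fst p, snd p} = qw {a, b})"

definition ex :: "nat \<Rightarrow> nat \<Rightarrow> nat" where "ex a b = fst (link a b)"
definition ey :: "nat \<Rightarrow> nat \<Rightarrow> nat" where "ey a b = snd (link a b)"

lemma finite_E: "finite E"
  using weighted_graph_finite[OF graph] .

lemma qE_edge:
  assumes "{u, v} \<in> E" "cid u \<noteq> cid v"
  shows "{cid u, cid v} \<in> qE" "cid u < N" "cid v < N" "qw {cid u, cid v} \<le> w {u, v}"
proof -
  show "{cid u, cid v} \<in> qE" unfolding qE_def using assms by blast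
  have n: "u < n" "v < n" using edge_less[OF assms(1)] .
  then have "rt u \<noteq> rt v" using cid_eq assms(2) by blast
  then have "rt u \<in> R" "rt v \<in> R" using big(3)[OF assms(1)] big(3)[of v u] assms(1)
    by (auto simp: insert_commute)
  then show "cid u < N" "cid v < N" using cid_less n by auto
  have "w {u, v} \<in> w ` {e \<in> E. cid ` e = {cid u, cid v}}" using assms(1) by (intro imageI) auto
  then show "qw {cid u, cid v} \<le> w {u, v}" unfolding qw_def using finite_E by (intro Min_le) auto
qed

lemma link:
  assumes "{a, b} \<in> qE"
  shows "{ex a b, ey a b} \<in> E" "cid (ex a b) = a" "cid (ey a b) = b"
      "w {ex a b, ey a b} = qw {a, b}"
    and "a \<noteq> b" "a < N" "b < N"
proof -
  obtain u v where uv: "{u, v} \<in> E" "cid u \<noteq> cid v" "{a, b} = {cid u, cid v}"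
    using assms unfolding qE_def by blast
  then have "a = cid u \<and> b = cid v \<or> a = cid v \<and> b = cid u" by (simp add: doubleton_eq_iff)
  then show "a \<noteq> b" "a < N" "b < N" using qE_edge(2,3)[OF uv(1,2)] uv(2) by metis+
  have "cid ` {u, v} = {a, b}" using uv(3) by simp
  then have "w ` {e \<in> E. cid ` e = {a, b}} \<noteq> {}" using uv(1) by blast
  then have "qw {a, b} \<in> w ` {e \<in> E. cid ` e = {a, b}}" unfolding qw_def using finite_E
      by (intro Min_in) auto
  then obtain e where "qw {a, b} = w e" "e \<in> {e \<in> E. cid ` e = {a, b}}" by (rule imageE)
  then have e: "e \<in> E" "cid ` e = {a, b}" "w e = qw {a, b}" by auto
  obtain x y where xy: "e = {x, y}"
    using bspec[OF graph[unfolded weighted_graph_def, THEN conjunct1] e(1)] by blast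
  then have "{cid x, cid y} = {a, b}" using e(2) by simp
  then have "cid x = a \<and> cid y = b \<or> cid x = b \<and> cid y = a" by (simp add: doubleton_eq_iff)
  then have "\<exists>p. {fst p, snd p} \<in> E \<and> cid (fst p) = a \<and> cid (snd p) = b \<and>
      w {fst p, snd p} = qw {a, b}"
  proof
    assume "cid x = a \<and> cid y = b"
    then show ?thesis using e(1,3) xy by (intro exI[of _ "(x, y)"]) simp
  next
    assume "cid x = b \<and> cid y = a"
    moreover have "{y, x} = e" using xy by blast
    ultimately show ?thesis using e(1,3) by (intro exI[of _ "(y, x)"]) simp
  qed
  then have "{fst (link a b), snd (link a b)} \<in> E \<and> cid (fst (link a b)) = a \<and>
      cid (snd (link a b)) = b \<and> w {fst (link a b), snd (link a b)} = qw {a, b}"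
    unfolding link_def by (rule someI_ex)
  then show "{ex a b, ey a b} \<in> E" "cid (ex a b) = a" "cid (ey a b) = b"
      "w {ex a b, ey a b} = qw {a, b}"
    unfolding ex_def ey_def by blast+
qed

lemma quotient_weighted: "weighted_graph N qE qw"
  unfolding weighted_graph_def
proof (intro conjI ballI)
  fix f assume f: "f \<in> qE"
  then obtain u v where uv: "{u, v} \<in> E" "cid u \<noteq> cid v" "f = {cid u, cid v}" unfolding qE_def
      by blast
  then show "\<exists>u v. u < N \<and> v < N \<and> u \<noteq> v \<and> f = {u, v}" using qE_edge[OF uv(1,2)] by blast
  have "{cid u, cid v} \<in> qE" using f uv by simp
  from link(1,4)[OF this] show "0 \<le> qw f" using weight_nonneg uv(3) by metis
qed

lemma qw_nonneg: "\<forall>f\<in>qE. 0 \<le> qw f"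
  using quotient_weighted unfolding weighted_graph_def by blast

text \<open>A path of the graph may return to a cluster it has left, whereas paths of the quotient
  must be simple. Cutting off the detour before \<open>a\<close> removes only nonnegative
  weight.\<close>

lemma paths_suffix:
  assumes "P \<in> paths N qE b c" "a \<in> set P"
  shows "\<exists>P'\<in>paths N qE a c. path_weight qw P' \<le> path_weight qw P"
proof -
  obtain xs ys where P: "P = xs @ a # ys" using assms(2) by (meson split_list)
  show ?thesis
  proof (cases "xs = []")
    case True
    then have "P \<in> paths N qE a c" using assms(1) P by (auto simp: paths_def)
    then show ?thesis by blast
  next
    case False
    have pe: "path_edges P = path_edges xs @ {last xs, a} # path_edges (a # ys)"
      using path_edges_append[OF False, of "a # ys"] P by simp
    have sub: "set (path_edges P) \<subseteq> qE" using assms(1) by (simp add: paths_def)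
    have "a # ys \<in> paths N qE a c" using assms(1) P pe by (auto simp: paths_def)
    moreover have "path_weight qw (a # ys) \<le> path_weight qw P"
    proof -
      have "0 \<le> path_weight qw xs" using sub pe by (intro path_weight_nonneg[OF qw_nonneg]) auto
      moreover have "0 \<le> qw {last xs, a}" using sub pe qw_nonneg by auto
      ultimately show ?thesis using path_weight_append[OF False, of "a # ys" qw] P by simp
    qed
    ultimately show ?thesis by blast
  qed
qed

lemma project_path:
  assumes "P \<noteq> []" "set (path_edges P) \<subseteq> E" "set P \<subseteq> {..<n}" "cid (last P) < N"
  shows "\<exists>P'\<in>paths N qE (cid (hd P)) (cid (last P)). path_weight qw P' \<le> path_weight w P"
  using assms
proof (induction P rule: path_edges.induct)
  case (1 x y xs)
  then obtain P' where P': "P' \<in> paths N qE (cid y) (cid (last (y # xs)))"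
    "path_weight qw P' \<le> path_weight w (y # xs)" by auto
  have pw: "path_weight w (x # y # xs) = w {x, y} + path_weight w (y # xs)"
      by (simp add: path_weight_def)
  have xy: "{x, y} \<in> E" "0 \<le> w {x, y}" using 1 weight_nonneg by auto
  consider "cid x = cid y" | "cid x \<noteq> cid y" "cid x \<in> set P'" | "cid x \<noteq> cid y" "cid x \<notin> set P'"
      by blast
  then show ?case
  proof cases
    case 1
    then show ?thesis using P' pw xy by (intro bexI[of _ P']) auto
  next
    case 2
    obtain P'' where "P'' \<in> paths N qE (cid x) (cid (last (y # xs)))"
        "path_weight qw P'' \<le> path_weight qw P'"
      using paths_suffix[OF P'(1) 2(2)] by blast
    then show ?thesis using P' pw xy by (intro bexI[of _ P'']) auto
  next
    case 3
    note q = qE_edge[OF xy(1) 3(1)]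
    obtain ys where ys: "P' = cid y # ys" using P'(1) by (cases P') (auto simp: paths_def)
    have "cid x # P' \<in> paths N qE (cid x) (cid (last (y # xs)))"
      using P'(1) 3 q ys by (auto simp: paths_def)
    moreover have "path_weight qw (cid x # P') = qw {cid x, cid y} + path_weight qw P'"
      by (simp add: path_weight_def ys)
    ultimately show ?thesis using P'(2) pw q(4) by (intro bexI[of _ "cid x # P'"]) auto
  qed
next
  case ("2_2" x)
  then show ?case by (intro bexI[of _ "[cid x]"]) (auto simp: paths_def path_weight_def)
qed simp

definition lifted_edges :: "nat set set \<Rightarrow> nat set set" where
  "lifted_edges S' = (\<lambda>x. {x, par x}) ` {x. x < n \<and>
      x \<noteq> rt x} \<union> (\<lambda>(a, b). {ex a b, ey a b}) ` {(a, b). {a, b} \<in> S'}"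

lemma tpath_in_lifted:
  assumes "i < n" "j < n" "cid i = cid j"
  shows "set (path_edges (tpath i j)) \<subseteq> lifted_edges S'" "\<forall>y\<in>set (tpath i j). y < n \<and> cid y = cid i"
    "distinct (tpath i j)" "hd (tpath i j) = i" "last (tpath i j) = j"
proof -
  have r: "rt i = rt j" using cid_eq assms by blast
  note t = tpath_props[OF assms(1,2) r]
  have v: "\<forall>y\<in>set (tpath i j). y < n \<and> rt y = rt i" using t by blast
  then show "\<forall>y\<in>set (tpath i j). y < n \<and> cid y = cid i" using cid_eq assms by blast
  show "distinct (tpath i j)" using t by blast
  show "hd (tpath i j) = i" "last (tpath i j) = j" using tpath_ends[OF assms(1,2) r] by auto
  show "set (path_edges (tpath i j)) \<subseteq> lifted_edges S'"
  proof
    fix e assume "e \<in> set (path_edges (tpath i j))"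
    then have "\<exists>x\<in>set (tpath i j). x \<noteq> rt x \<and> e = {x, par x}" using t by blast
    then show "e \<in> lifted_edges S'" using v unfolding lifted_edges_def by blast
  qed
qed

abbreviation "routed \<equiv> route tpath ex ey"

text \<open>Legs stay in pairwise different clusters, so the routed path is simple. Each cluster
  contributes at least one vertex; this comparison of lengths later charges the time of the given
  oracle to the printed path.\<close>

lemma route_props:
  assumes "S' \<subseteq> qE" "P \<noteq> []" "distinct P" "set (path_edges P) \<subseteq> S'"
    "cur < n" "v < n" "cid cur = hd P" "cid v = last P"
  shows "routed cur v P \<noteq> [] \<and> hd (routed cur v P) = cur \<and> last (routed cur v P) = v \<and>
      distinct (routed cur v P) \<and>
    (\<forall>y\<in>set (routed cur v P). y < n \<and> cid y \<in> set P) \<and>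
    set (path_edges (routed cur v P)) \<subseteq> lifted_edges S' \<and> length P \<le> length (routed cur v P)"
  using assms(2-8)
proof (induction tpath ex ey cur v P rule: route.induct)
  case (2 cur v a)
  have c: "cid cur = cid v" using 2 by simp
  note t = tpath_in_lifted[OF 2(4,5) c]
  have "\<forall>y\<in>set (tpath cur v). y < n \<and> cid y \<in> set [a]" using t(2) 2(6) by simp
  moreover have "length [a] \<le> length (tpath cur v)" by (simp add: Suc_le_eq)
  ultimately show ?case using t(1,3-5) by simp
next
  case (3 cur v a b xs)
  have ab: "{a, b} \<in> S'" "{a, b} \<in> qE" using 3(4) assms(1) by auto
  note l = link[OF ab(2)]
  have n: "ex a b < n" "ey a b < n" using edge_less[OF l(1)] .
  have c: "cid cur = cid (ex a b)" using 3(7) l(2) by simp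
  note t = tpath_in_lifted[OF 3(5) n(1) c]
  have ih: "routed (ey a b) v (b # xs) \<noteq> []" "hd (routed (ey a b) v (b # xs)) = ey a b"
    "last (routed (ey a b) v (b # xs)) = v" "distinct (routed (ey a b) v (b # xs))"
    "\<forall>y\<in>set (routed (ey a b) v (b # xs)). y < n \<and> cid y \<in> set (b # xs)"
    "set (path_edges (routed (ey a b) v (b # xs))) \<subseteq> lifted_edges S'"
    "length (b # xs) \<le> length (routed (ey a b) v (b # xs))"
    using 3(1)[OF _ _ _ n(2) 3(6) _ _] 3(2-4,8) l(3) by auto
  have cid_t: "cid y = a" if "y \<in> set (tpath cur (ex a b))" for y
    using t(2)[rule_format, OF that] 3(7) by simp
  have disj: "set (tpath cur (ex a b)) \<inter> set (routed (ey a b) v (b # xs)) = {}"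
  proof -
    have "cid y \<noteq> a" if "y \<in> set (routed (ey a b) v (b # xs))" for y
      using ih(5)[rule_format, OF that] 3(3) by auto
    then show ?thesis using cid_t by blast
  qed
  have pe: "path_edges (routed cur v (a # b # xs)) = path_edges (tpath cur (ex a b)) @
      {ex a b, ey a b} # path_edges (routed (ey a b) v (b # xs))"
    using path_edges_append[OF _ ih(1), of "tpath cur (ex a b)"] t(5) ih(2) by simp
  have "{ex a b, ey a b} \<in> lifted_edges S'" using ab(1) unfolding lifted_edges_def by auto
  then have "set (path_edges (routed cur v (a # b # xs))) \<subseteq> lifted_edges S'"
    unfolding pe using t(1) ih(6) by auto
  moreover have "length (a # b # xs) \<le> length (routed cur v (a # b # xs))"
  proof -
    have "1 \<le> length (tpath cur (ex a b))" by (simp add: Suc_le_eq)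
    then show ?thesis using ih(7) by simp
  qed
  moreover have "\<forall>y\<in>set (routed cur v (a # b # xs)). y < n \<and> cid y \<in> set (a # b # xs)"
  proof
    fix y assume "y \<in> set (routed cur v (a # b # xs))"
    then have "y \<in> set (tpath cur (ex a b)) \<or> y \<in> set (routed (ey a b) v (b # xs))" by simp
    then show "y < n \<and> cid y \<in> set (a # b # xs)"
      using t(2)[rule_format, of y] cid_t[of y] ih(5)[rule_format, of y] by auto
  qed
  moreover have "distinct (routed cur v (a # b # xs))" using t(3) ih(4) disj by simp
  moreover have "hd (routed cur v (a # b # xs)) = cur" "last (routed cur v (a # b # xs)) = v"
    using t(4) ih(1,3) by simp_all
  ultimately show ?case using ih(1) by simp
qed simp

text \<open>A quotient edge of weight \<open>\<omega>\<close> leaves its cluster and thus every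
  subtree that contains its end, so it is at least as heavy as the tree edges climbed from that end.
  It pays \<open>6 * s * \<omega>\<close> for the leg before it, the same for the leg after it, and
  \<open>\<omega>\<close> for itself. The two outermost climbs are paid by \<open>\<beta>\<close>
  and \<open>\<gamma>\<close>; the induction continues with \<open>\<omega>\<close> in place of
  \<open>\<beta>\<close>.\<close>

lemma route_weight:
  assumes "S' \<subseteq> qE" "P \<noteq> []" "set (path_edges P) \<subseteq> S'" "distinct P"
    "cur < n" "v < n" "cid cur = hd P" "cid v = last P" "0 \<le> \<beta>" "0 \<le> \<gamma>"
    and "\<And>x. x < n \<Longrightarrow> x \<noteq> rt x \<Longrightarrow> cur \<in> D x \<Longrightarrow> v \<notin> D x \<Longrightarrow> w {x, par x} \<le> \<beta>"
    and "\<And>x. x < n \<Longrightarrow> x \<noteq> rt x \<Longrightarrow> v \<in> D x \<Longrightarrow> cur \<notin> D x \<Longrightarrow> w {x, par x} \<le> \<gamma>"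
  shows "path_weight w (routed cur v P) \<le> 6 * real s * (\<beta> + \<gamma>) + (1 + 12 * real s) * path_weight qw
      P"
  using assms(2-)
proof (induction tpath ex ey cur v P arbitrary: \<beta> rule: route.induct)
  case (2 cur v a)
  have "rt cur = rt v" using cid_eq[OF 2(4,5)] 2(6,7) by simp
  then have "path_weight w (tpath cur v) \<le> 6 * real s * (\<beta> + \<gamma>)"
    by (rule tpath_weight[OF 2(4,5) _ 2(8,9)]) (use 2(10,11) in blast)+
  then show ?case by (simp add: path_weight_def)
next
  case (3 cur v a b xs)
  have ab: "{a, b} \<in> S'" "{a, b} \<in> qE" using 3(3) assms(1) by auto
  note l = link[OF ab(2)]
  have n: "ex a b < n" "ey a b < n" using edge_less[OF l(1)] .
  define \<omega> where "\<omega> = qw {a, b}"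
  have \<omega>: "0 \<le> \<omega>" "w {ex a b, ey a b} = \<omega>" using qw_nonneg ab(2) l(4) by (auto simp: \<omega>_def)
  have cv: "cid v \<in> set (b # xs)" using 3(8) by auto
  then have cva: "cid v \<noteq> a" using 3(4) by auto
  have rts: "rt cur = rt (ex a b)" "rt cur \<noteq> rt v" "rt (ex a b) \<noteq> rt (ey a b)"
    using cid_eq[OF 3(5) n(1)] cid_eq[OF 3(5,6)] cid_eq[OF n] 3(7) cva l by auto
  \<comment> \<open>Subtrees stay within one cluster, so a vertex of another cluster is always on
    the other side of the cut.\<close>
  have outside: "y \<notin> D x" if "x < n" "z \<in> D x" "rt y \<noteq> rt z" for x y z
    using desc_cluster(2)[OF that(1)] that by metis
  have bx: "w {x, par x} \<le> \<omega>" if "x < n" "x \<noteq> rt x" "ex a b \<in> D x" for x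
    using light[OF that(1,2) l(1) that(3)] outside[OF that(1,3)] rts \<omega> by auto
  have "{ey a b, ex a b} \<in> E" using l(1) by (simp add: insert_commute)
  then have by': "w {x, par x} \<le> \<omega>" if "x < n" "x \<noteq> rt x" "ey a b \<in> D x" for x
    using light[OF that(1,2) _ that(3)] outside[OF that(1,3)] rts \<omega> by (metis insert_commute)
  have "path_weight w (tpath cur (ex a b)) \<le> 6 * real s * (\<beta> + \<omega>)"
  proof (rule tpath_weight[OF 3(5) n(1) rts(1) 3(9) \<omega>(1)])
    show "w {x, par x} \<le> \<beta>" if "x < n" "x \<noteq> rt x" "cur \<in> D x" for x
      using 3(11)[OF that] outside[OF that(1,3)] rts(2) by metis
  qed (rule bx)
  moreover have "path_weight w (routed (ey a b) v (b # xs)) \<le>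
      6 * real s * (\<omega> + \<gamma>) + (1 + 12 * real s) * path_weight qw (b # xs)"
  proof (rule 3(1))
    show "w {x, par x} \<le> \<omega>" if "x < n" "x \<noteq> rt x" "ey a b \<in> D x" for x using by'[OF that] .
    show "w {x, par x} \<le> \<gamma>" if "x < n" "x \<noteq> rt x" "v \<in> D x" for x
      using 3(12)[OF that] outside[OF that(1,3)] rts(2) by metis
  qed (use 3(2-10) l n \<omega> in auto)
  moreover have ne: "routed (ey a b) v (b # xs) \<noteq> []" "hd (routed (ey a b) v (b # xs)) = ey a b"
    using route_props[OF assms(1), of "b # xs" "ey a b" v] 3(3-8) l n by auto
  have "last (tpath cur (ex a b)) = ex a b" using tpath_ends[OF 3(5) n(1) rts(1)] by simp
  then have "path_weight w (routed cur v (a # b # xs)) =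
      path_weight w (tpath cur (ex a b)) + \<omega> + path_weight w (routed (ey a b) v (b # xs))"
    using path_weight_append[OF _ ne(1), of "tpath cur (ex a b)"] ne(2) \<omega>(2) by simp
  moreover have "path_weight qw (a # b # xs) = \<omega> + path_weight qw (b # xs)"
    by (simp add: path_weight_def \<omega>_def)
  ultimately show ?case by (simp add: algebra_simps)
qed simp

end

subsection \<open>The spanner\<close>

lemma exec_steps_pos: "exec B D p s k s' \<Longrightarrow> 1 \<le> k"
  by (induction rule: exec.induct) auto

lemma last_le_line:
  assumes "set (path_edges P) \<subseteq> {{i, Suc i} |i. True}" "P \<noteq> []"
  shows "last P \<le> hd P + length (path_edges P)"
  using assms
proof (induction P rule: path_edges.induct)
  case (1 x y xs)
  then have "y \<le> Suc x" by (auto simp: doubleton_eq_iff)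
  then show ?case using 1 by auto
qed auto

lemma all_graphs_admitD:
  assumes "all_graphs_admit Q \<kappa> c \<alpha> q h" "weighted_graph n E w"
  obtains S D where "interactive_spanner Q \<kappa> c n E w \<alpha> q S D" "real (spanner_size S D) \<le> h n"
  using assms unfolding all_graphs_admit_def by blast

lemma interactive_spanner_query:
  assumes "interactive_spanner Q \<kappa> c n E w \<alpha> q S D" "u < n" "v < n"
  obtains P k where "answers (word_bound \<kappa> n) Q D u v P k"
    "real k \<le> c * (q + real (length (path_edges P)))"
    "paths n E u v = {} \<Longrightarrow> P = []"
    "paths n E u v \<noteq> {} \<Longrightarrow> P \<in> paths n S u v \<and> graph_dist n E w u v \<le> path_weight w P \<and>
       path_weight w P \<le> \<alpha> * graph_dist n E w u v"
proof -
  obtain P k where "answers (word_bound \<kappa> n) Q D u v P k \<and>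
        real k \<le> c * (q + real (length (path_edges P))) \<and>
        (if paths n E u v = {} then P = []
         else P \<in> paths n S u v \<and>
              graph_dist n E w u v \<le> path_weight w P \<and>
              path_weight w P \<le> \<alpha> * graph_dist n E w u v)"
    using assms unfolding interactive_spanner_def by blast
  then show thesis by (intro that[of P k]) (auto split: if_splits)
qed

lemma admits_size_nonneg:
  assumes "all_graphs_admit Q \<kappa> c \<alpha> q h"
  shows "0 \<le> h n"
proof -
  have "weighted_graph n {} (\<lambda>_. 0)" by (simp add: weighted_graph_def)
  from all_graphs_admitD[OF assms this] show ?thesis by (metis of_nat_0_le_iff order_trans)
qed

text \<open>On one vertex the answer has no edge, yet every execution takes a step. This lets
  \<open>c * q\<close> absorb additive constants in later time bounds.\<close>

lemma admits_time:
  assumes "all_graphs_admit Q \<kappa> c \<alpha> q h"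
  shows "1 \<le> c * q"
proof -
  have "weighted_graph 1 {} (\<lambda>_. 0)" by (simp add: weighted_graph_def)
  from all_graphs_admitD[OF assms this] obtain S D where
    "interactive_spanner Q \<kappa> c 1 {} (\<lambda>_. 0) \<alpha> q S D" by blast
  then obtain P k where P: "answers (word_bound \<kappa> 1) Q D 0 0 P k"
    "real k \<le> c * (q + real (length (path_edges P)))"
    "paths 1 {} 0 0 = {} \<Longrightarrow> P = []" "paths 1 {} 0 0 \<noteq> {} \<Longrightarrow> P \<in> paths 1 S 0 0"
    by (rule interactive_spanner_query[of _ _ _ _ _ _ _ _ _ _ 0 0]) auto
  have "length (path_edges P) = 0"
  proof (cases "P = []")
    case False
    then have "P \<in> paths 1 S 0 0" using P by blast
    then have "distinct P" "set P \<subseteq> {0}" by (auto simp: paths_def)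
    then have "length P \<le> 1" using card_mono[of "{0}" "set P"] by (simp add: distinct_card)
    then show ?thesis by (simp add: length_path_edges)
  qed simp
  moreover have "1 \<le> k" using P(1) exec_steps_pos unfolding answers_def by blast
  ultimately show ?thesis using P(2) by simp
qed

lemma line_path:
  assumes "k \<le> n"
  shows "[k..<Suc n] \<in> paths (Suc n) {{i, Suc i} |i. i < n} k n"
  using assms
proof (induction "n - k" arbitrary: k)
  case 0
  then show ?case by (simp add: paths_def)
next
  case (Suc m)
  then have k: "k < n" "Suc k \<le> n" by auto
  then have P: "[Suc k..<Suc n] \<in> paths (Suc n) {{i, Suc i} |i. i < n} (Suc k) n" using Suc by simp
  have e: "[k..<Suc n] = k # [Suc k..<Suc n]" "[Suc k..<Suc n] = Suc k # [Suc (Suc k)..<Suc n]"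
    using k by (auto simp: upt_conv_Cons simp del: upt_Suc)
  have "{k, Suc k} \<in> {{i, Suc i} |i. i < n}" using k by blast
  then show ?case using P k unfolding e(1) by (subst e(2)) (auto simp: paths_def e(2) simp del:
      upt_Suc)
qed

text \<open>\<open>1 \<le> c * q\<close> leaves open that both factors are negative. A path graph
  with more than \<open>- q\<close> edges excludes this: the answer between its ends has at least
  that many edges, which would make the time bound negative.\<close>

lemma admits_constant_pos:
  assumes "all_graphs_admit Q \<kappa> c \<alpha> q h"
  shows "0 < c"
proof (rule ccontr)
  assume "\<not> 0 < c"
  then have c: "c < 0" using admits_time[OF assms]
      by (metis linorder_neqE_linordered_idom mult_zero_left not_one_le_zero)
  obtain m :: nat where m: "- q < real m" using reals_Archimedean2 by blast
  let ?E = "{{i, Suc i} |i. i < m}"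
  have "weighted_graph (Suc m) ?E (\<lambda>_. 0)"
    unfolding weighted_graph_def
  proof (intro conjI ballI)
    fix e assume "e \<in> ?E"
    then obtain i where "i < m" "e = {i, Suc i}" by blast
    then show "\<exists>u v. u < Suc m \<and> v < Suc m \<and> u \<noteq> v \<and> e = {u, v}"
      by (intro exI[of _ i] exI[of _ "Suc i"]) simp
  qed simp
  from all_graphs_admitD[OF assms this] obtain S D where
    sp: "interactive_spanner Q \<kappa> c (Suc m) ?E (\<lambda>_. 0) \<alpha> q S D" by blast
  then have "S \<subseteq> ?E" unfolding interactive_spanner_def by blast
  obtain P k where P: "real k \<le> c * (q + real (length (path_edges P)))"
    "paths (Suc m) ?E 0 m \<noteq> {} \<Longrightarrow> P \<in> paths (Suc m) S 0 m"
    by (rule interactive_spanner_query[OF sp, of 0 m]) auto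
  have "paths (Suc m) ?E 0 m \<noteq> {}" using line_path[of 0 m] by blast
  then have P': "P \<in> paths (Suc m) S 0 m" using P(2) by blast
  then have "last P \<le> hd P + length (path_edges P)"
    using \<open>S \<subseteq> ?E\<close> by (intro last_le_line) (auto simp: paths_def)
  then have "m \<le> length (path_edges P)" using P' by (simp add: paths_def)
  then have "0 < q + real (length (path_edges P))" using m by linarith
  then have "c * (q + real (length (path_edges P))) < 0" using c by (simp add: mult_neg_pos)
  then show False using P(1) by linarith
qed

lemma graph_dist_le:
  assumes "\<forall>e\<in>E. 0 \<le> w e" "P \<in> paths n E u v"
  shows "graph_dist n E w u v \<le> path_weight w P"
  unfolding graph_dist_def
proof (rule cINF_lower[OF _ assms(2)])
  show "bdd_below (path_weight w ` paths n E u v)"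
    by (rule bdd_belowI[of _ 0]) (auto simp: paths_def intro!: path_weight_nonneg[OF assms(1)])
qed

lemma le_graph_dist:
  assumes "paths n E u v \<noteq> {}" "0 < a" "\<And>P. P \<in> paths n E u v \<Longrightarrow> x \<le> a * path_weight w P"
  shows "x \<le> a * graph_dist n E w u v"
proof -
  have "x / a \<le> graph_dist n E w u v"
    unfolding graph_dist_def
  proof (rule cINF_greatest[OF assms(1)])
    fix P assume "P \<in> paths n E u v"
    from assms(3)[OF this] assms(2) show "x / a \<le> path_weight w P" by (simp add: field_simps)
  qed
  then show ?thesis using assms(2) by (simp add: field_simps)
qed

text \<open>The ends of a single edge of weight 1 have positive distance \<open>d\<close>, and
  \<open>d\<close> cancels in \<open>d \<le> \<alpha> * d\<close>.\<close>

lemma admits_stretch: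
  assumes "all_graphs_admit Q \<kappa> c \<alpha> q h"
  shows "1 \<le> \<alpha>"
proof -
  let ?E = "{{0, 1 :: nat}}" and ?w = "\<lambda>_. 1 :: real"
  have "weighted_graph 2 ?E ?w" 
    unfolding weighted_graph_def
  proof (intro conjI ballI)
    fix e assume "e \<in> ?E"
    then show "\<exists>u v. u < 2 \<and> v < 2 \<and> u \<noteq> v \<and> e = {u, v}"
      by (intro exI[of _ 0] exI[of _ 1]) simp
  qed simp
  from all_graphs_admitD[OF assms this] obtain S D where
    sp: "interactive_spanner Q \<kappa> c 2 ?E ?w \<alpha> q S D" by blast
  have ne: "paths 2 ?E 0 1 \<noteq> {}"
  proof -
    have "[0, 1] \<in> paths 2 ?E 0 1" by (auto simp: paths_def)
    then show ?thesis by blast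
  qed
  obtain P where P: "graph_dist 2 ?E ?w 0 1 \<le> path_weight ?w P"
      "path_weight ?w P \<le> \<alpha> * graph_dist 2 ?E ?w 0 1"
    by (rule interactive_spanner_query[OF sp, of 0 1]) (use ne in auto)
  have "1 \<le> 1 * graph_dist 2 ?E ?w 0 1"
  proof (rule le_graph_dist[OF ne])
    fix P assume "P \<in> paths 2 ?E 0 1"
    then have "P \<noteq> []" "hd P = 0" "last P = 1" by (auto simp: paths_def)
    then obtain y ys where "P = 0 # y # ys" by (cases P rule: path_edges.cases) auto
    moreover have "0 \<le> path_weight ?w (y # ys)" by (simp add: path_weight_def sum_list_triv)
    ultimately show "1 \<le> 1 * path_weight ?w P" by (simp add: path_weight_def)
  qed simp
  moreover from this P have "graph_dist 2 ?E ?w 0 1 \<le> \<alpha> * graph_dist 2 ?E ?w 0 1" by linarith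
  ultimately show ?thesis by (simp add: mult_le_cancel_right1)
qed

text \<open>The header holds the base addresses of the seven tables, then the total length,
  \<open>N\<close> and \<open>M\<close>. The total length is also the offset at which the given data
  start.\<close>

definition directory :: "(nat \<Rightarrow> nat) \<Rightarrow> (nat \<Rightarrow> nat) \<Rightarrow> (nat \<Rightarrow> nat) \<Rightarrow> (nat \<Rightarrow> nat) \<Rightarrow> (nat \<Rightarrow> nat) \<Rightarrow>
  (nat \<Rightarrow> nat) \<Rightarrow> (nat \<Rightarrow> nat) \<Rightarrow> nat \<Rightarrow> nat \<Rightarrow> nat \<Rightarrow> nat list" where
  "directory par dep cid T d X Y n N M =
     [10, 10 + n, 10 + 2 * n, 10 + 3 * n, 10 + 3 * n + N, 10 + 3 * n + N + M,
      10 + 3 * n + N + 2 * M, 10 + 3 * n + N + 3 * M, N, M] @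
     map par [0..<n] @ map dep [0..<n] @ map cid [0..<n] @ map T [0..<N] @
     map d [0..<M] @ map X [0..<M] @ map Y [0..<M]"

lemma length_directory: "length (directory par dep cid T d X Y n N M) = 10 + 3 * n + N + 3 * M"
  by (simp add: directory_def)

lemma nth_segment:
  assumes "k = length xs" "v < m"
  shows "k + v < length (xs @ map f [0..<m] @ ys) \<and> (xs @ map f [0..<m] @ ys) ! (k + v) = f v"
  using assms by (simp add: nth_append)

lemma nth_directory:
  fixes par dep cid T d X Y :: "nat \<Rightarrow> nat" and n N M :: nat
  defines "L \<equiv> directory par dep cid T d X Y n N M"
  shows "v < n \<Longrightarrow> 10 + v < length L \<and> L ! (10 + v) = par v"
    and "v < n \<Longrightarrow> 10 + n + v < length L \<and> L ! (10 + n + v) = dep v"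
    and "v < n \<Longrightarrow> 10 + 2 * n + v < length L \<and> L ! (10 + 2 * n + v) = cid v"
    and "a < N \<Longrightarrow> 10 + 3 * n + a < length L \<and> L ! (10 + 3 * n + a) = T a"
    and "x < M \<Longrightarrow> 10 + 3 * n + N + x < length L \<and> L ! (10 + 3 * n + N + x) = d x"
    and "x < M \<Longrightarrow> 10 + 3 * n + N + M + x < length L \<and> L ! (10 + 3 * n + N + M + x) = X x"
    and "x < M \<Longrightarrow> 10 + 3 * n + N + 2 * M + x < length L \<and> L ! (10 + 3 * n + N + 2 * M + x) = Y x"
proof -
  let ?h = "[10, 10 + n, 10 + 2 * n, 10 + 3 * n, 10 + 3 * n + N, 10 + 3 * n + N + M,
      10 + 3 * n + N + 2 * M, 10 + 3 * n + N + 3 * M, N, M]"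
  let ?p = "map par [0..<n]" and ?e = "map dep [0..<n]" and ?c = "map cid [0..<n]"
      and ?t = "map T [0..<N]"
    and ?d = "map d [0..<M]" and ?x = "map X [0..<M]" and ?y = "map Y [0..<M]"
  show "v < n \<Longrightarrow> 10 + v < length L \<and> L ! (10 + v) = par v"
    using nth_segment[of 10 ?h v n par "?e @ ?c @ ?t @ ?d @ ?x @ ?y"] unfolding L_def directory_def
        by simp
  show "v < n \<Longrightarrow> 10 + n + v < length L \<and> L ! (10 + n + v) = dep v"
    using nth_segment[of "10 + n" "?h @ ?p" v n dep "?c @ ?t @ ?d @ ?x @ ?y"]
    unfolding L_def directory_def by simp
  show "v < n \<Longrightarrow> 10 + 2 * n + v < length L \<and> L ! (10 + 2 * n + v) = cid v"
    using nth_segment[of "10 + 2 * n" "?h @ ?p @ ?e" v n cid "?t @ ?d @ ?x @ ?y"]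
    unfolding L_def directory_def by simp
  show "a < N \<Longrightarrow> 10 + 3 * n + a < length L \<and> L ! (10 + 3 * n + a) = T a"
    using nth_segment[of "10 + 3 * n" "?h @ ?p @ ?e @ ?c" a N T "?d @ ?x @ ?y"]
    unfolding L_def directory_def by simp
  show "x < M \<Longrightarrow> 10 + 3 * n + N + x < length L \<and> L ! (10 + 3 * n + N + x) = d x"
    using nth_segment[of "10 + 3 * n + N" "?h @ ?p @ ?e @ ?c @ ?t" x M d "?x @ ?y"]
    unfolding L_def directory_def by simp
  show "x < M \<Longrightarrow> 10 + 3 * n + N + M + x < length L \<and> L ! (10 + 3 * n + N + M + x) = X x"
    using nth_segment[of "10 + 3 * n + N + M" "?h @ ?p @ ?e @ ?c @ ?t @ ?d" x M X "?y"]
    unfolding L_def directory_def by simp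
  show "x < M \<Longrightarrow> 10 + 3 * n + N + 2 * M + x < length L \<and> L ! (10 + 3 * n + N + 2 * M + x) = Y x"
    using nth_segment[of "10 + 3 * n + N + 2 * M" "?h @ ?p @ ?e @ ?c @ ?t @ ?d @ ?x" x M Y "[]"]
    unfolding L_def directory_def by simp
qed

lemma card_ordered_pairs:
  assumes "finite S"
  shows "finite {(a, b). {a, b} \<in> S} \<and> card {(a :: nat, b). {a, b} \<in> S} \<le> 2 * card S"
proof -
  have e: "{(a, b). {a, b} \<in> S} = (\<Union>f\<in>S. {(a, b). {a, b} = f})" by blast
  have one: "finite {(a :: nat, b). {a, b} = f} \<and> card {(a :: nat, b). {a, b} = f} \<le> 2" for f
  proof (cases "\<exists>x y. f = {x, y}")
    case True
    then obtain x y where "f = {x, y}" by blast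
    then have sub: "{(a, b). {a, b} = f} \<subseteq> {(x, y), (y, x)}" by (auto simp: doubleton_eq_iff)
    then have "finite {(a, b). {a, b} = f}" by (rule finite_subset) simp
    moreover have "card {(a, b). {a, b} = f} \<le> card {(x, y), (y, x)}" using sub
        by (intro card_mono) auto
    moreover have "card {(x, y), (y, x)} \<le> 2" using card_insert_le_m1[of 2 "{(y, x)}" "(x, y)"]
        by simp
    ultimately show ?thesis by linarith
  next
    case False
    then have "{(a, b). {a, b} = f} = {}" by auto
    then show ?thesis by simp
  qed
  have "card {(a :: nat, b). {a, b} \<in> S} \<le> (\<Sum>f\<in>S. card {(a :: nat, b). {a, b} = f})"
    unfolding e by (rule card_UN_le[OF assms])
  also have "\<dots> \<le> (\<Sum>f\<in>S. 2)" using one by (intro sum_mono) blast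
  finally have "card {(a :: nat, b). {a, b} \<in> S} \<le> 2 * card S" by simp
  moreover have "finite {(a :: nat, b). {a, b} \<in> S}" unfolding e using assms one by blast
  ultimately show ?thesis by blast
qed

text \<open>\<open>m ^ (\<kappa> + 1)\<close> will bound the values of the simulation and
  \<open>16 * m ^ 2\<close> the directory. Both are at most \<open>m ^ (\<kappa> + 6)\<close>
  because \<open>m \<ge> 2\<close>; the exponent \<open>\<kappa> + 10\<close> leaves room for their
  sum.\<close>

lemma word_bound_arith:
  assumes "N \<le> n" "m = n + 2"
  shows "word_bound \<kappa> N \<le> m ^ (\<kappa> + 1)" "N \<le> m ^ (\<kappa> + 1)"
    "m ^ (\<kappa> + 1) + 16 * m ^ 2 \<le> word_bound (\<kappa> + 10) n" "2 * m ^ (\<kappa> + 1) \<le> word_bound (\<kappa> + 10) n"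
proof -
  have m: "2 \<le> m" "1 \<le> m" using assms by auto
  have "(N + 2) ^ \<kappa> \<le> m ^ \<kappa>" using assms by (intro power_mono) auto
  also have "\<dots> \<le> m ^ (\<kappa> + 1)" using m by (intro power_increasing) auto
  finally show "word_bound \<kappa> N \<le> m ^ (\<kappa> + 1)" by (simp add: word_bound_def)
  have "m ^ 1 \<le> m ^ (\<kappa> + 1)" using m by (intro power_increasing) auto
  then show "N \<le> m ^ (\<kappa> + 1)" using assms by simp
  have "(2 :: nat) ^ 4 * m ^ 2 \<le> m ^ 4 * m ^ 2" using m by (intro mult_right_mono power_mono) auto
  also have "\<dots> = m ^ 6" by (simp flip: power_add)
  also have "\<dots> \<le> m ^ (\<kappa> + 6)" using m by (intro power_increasing) auto
  finally have 1: "16 * m ^ 2 \<le> m ^ (\<kappa> + 6)" by simp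
  have 2: "m ^ (\<kappa> + 1) \<le> m ^ (\<kappa> + 6)" using m by (intro power_increasing) auto
  have "2 * m ^ (\<kappa> + 6) \<le> m * m ^ (\<kappa> + 6)" using m by (intro mult_right_mono) auto
  also have "\<dots> = m ^ (\<kappa> + 7)" by (simp add: algebra_simps flip: power_Suc)
  also have "\<dots> \<le> m ^ (\<kappa> + 10)" using m by (intro power_increasing) auto
  also have "\<dots> = word_bound (\<kappa> + 10) n" by (simp add: word_bound_def assms)
  finally have 3: "2 * m ^ (\<kappa> + 6) \<le> word_bound (\<kappa> + 10) n" .
  show "m ^ (\<kappa> + 1) + 16 * m ^ 2 \<le> word_bound (\<kappa> + 10) n" "2 * m ^ (\<kappa> + 1) \<le> word_bound (\<kappa> + 10) n"
    using 1 2 3 by linarith+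
qed

section \<open>Size, stretch and storage of the lifted spanner\<close>

context quotient_graph
begin

lemma lifted_subset:
  assumes "S' \<subseteq> qE"
  shows "lifted_edges S' \<subseteq> E"
  using par_edge link(1) assms unfolding lifted_edges_def by auto

lemma finite_quotient: "finite qE"
  using weighted_graph_finite[OF quotient_weighted] .

lemma card_lifted:
  assumes "S' \<subseteq> qE"
  shows "card (lifted_edges S') \<le> n + 2 * card S'"
proof -
  have fin: "finite S'" using assms finite_quotient finite_subset by blast
  note c = card_ordered_pairs[OF fin]
  have "card ((\<lambda>x. {x, par x}) ` {x. x < n \<and> x \<noteq> rt x}) \<le> card {x. x < n \<and> x \<noteq> rt x}"
    by (rule card_image_le) simp
  also have "\<dots> \<le> card {..<n}" by (rule card_mono) auto
  finally have 1: "card ((\<lambda>x. {x, par x}) ` {x. x < n \<and> x \<noteq> rt x}) \<le> n" by simp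
  have "card ((\<lambda>(a, b). {ex a b, ey a b}) ` {(a, b). {a, b} \<in> S'}) \<le> card {(a, b). {a, b} \<in> S'}"
    using c by (intro card_image_le) blast
  then show ?thesis unfolding lifted_edges_def
    using 1 c card_Un_le[of "(\<lambda>x. {x, par x}) ` {x. x < n \<and> x \<noteq> rt x}"
      "(\<lambda>(a, b). {ex a b, ey a b}) ` {(a, b). {a, b} \<in> S'}"] by linarith
qed

text \<open>The last change of cluster along a path uses an edge into the cluster of
  \<open>v\<close>, whose number is therefore below \<open>N\<close>. The path can then be
  projected, and the projection starts at the number of \<open>u\<close>.\<close>

lemma apart_paths:
  assumes "u < n" "v < n" "cid u \<noteq> cid v" "paths n E u v \<noteq> {}"
  shows "cid u < N \<and> cid v < N"
proof -
  obtain P where P: "P \<in> paths n E u v" using assms by blast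
  have "cid (hd P) \<noteq> cid (last P) \<Longrightarrow> P \<noteq> [] \<Longrightarrow> set (path_edges P) \<subseteq> E \<Longrightarrow> cid (last P) < N" for P
  proof (induction P rule: path_edges.induct)
    case (1 x y xs)
    show ?case
    proof (cases "cid y = cid (last (y # xs))")
      case True
      then have "cid y < N" using qE_edge(3)[of x y] 1 by auto
      then show ?thesis using True by simp
    qed (use 1 in auto)
  qed auto
  then have v: "cid v < N" using P assms(3) by (auto simp: paths_def)
  then obtain P' where "P' \<in> paths N qE (cid u) (cid v)"
    using project_path[of P] P by (auto simp: paths_def)
  then have "hd P' = cid u" "P' \<noteq> []" "set P' \<subseteq> {..<N}" by (auto simp: paths_def)
  then have "cid u \<in> {..<N}" by (metis hd_in_set subsetD)
  then show ?thesis using v by simp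
qed

text \<open>Each edge of the tree path separates \<open>u\<close> from \<open>v\<close>, so the
  weight of \<open>P\<close> itself serves as both bounds.\<close>

lemma tpath_stretch:
  assumes "u < n" "v < n" "cid u = cid v" "P \<in> paths n E u v"
  shows "path_weight w (tpath u v) \<le> 12 * real s * path_weight w P"
proof -
  have "0 \<le> path_weight w P" using assms(4) by (intro path_weight_nonneg[OF weight_nonneg]) (simp
      add: paths_def)
  moreover have "rt u = rt v" using cid_eq assms by blast
  ultimately have "path_weight w (tpath u v) \<le> 6 * real s * (path_weight w P + path_weight w P)"
    using light_path[OF assms(4)] light_path_end[OF assms(4)] by (intro tpath_weight assms) auto
  then show ?thesis by (simp add: algebra_simps)
qed

text \<open>With \<open>W\<close> for the weight of \<open>P\<close>, the outermost climbs cost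
  \<open>12 * s * W\<close> and the rest \<open>(1 + 12 * s) * \<alpha> * W\<close>; they combine
  because \<open>1 \<le> \<alpha>\<close>.\<close>

lemma route_stretch:
  assumes "u < n" "v < n" "cid v < N" "S' \<subseteq> qE" "P' \<in> paths N S' (cid u) (cid v)"
    "path_weight qw P' \<le> \<alpha> * graph_dist N qE qw (cid u) (cid v)" "1 \<le> \<alpha>" "P \<in> paths n E u v"
  shows "path_weight w (routed u v P') \<le> (1 + 24 * real s) * \<alpha> * path_weight w P"
proof -
  define W where "W = path_weight w P"
  have W: "0 \<le> W" using assms(8) unfolding W_def
    by (intro path_weight_nonneg[OF weight_nonneg]) (simp add: paths_def)
  have "P \<noteq> []" "set (path_edges P) \<subseteq> E" "set P \<subseteq> {..<n}" "hd P = u" "last P = v"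
    using assms(8) by (auto simp: paths_def)
  then obtain P'' where P'': "P'' \<in> paths N qE (cid u) (cid v)" "path_weight qw P'' \<le> W"
    using project_path[of P] assms(3) unfolding W_def by auto
  have 1: "path_weight w (routed u v P') \<le> 6 * real s * (W + W) + (1 + 12 * real s) * path_weight qw
      P'"
  proof (rule route_weight[OF assms(4) _ _ _ assms(1,2) _ _ W W])
    show "w {x, par x} \<le> W" if "x < n" "x \<noteq> rt x" "u \<in> D x" "v \<notin> D x" for x
      using light_path[OF assms(8) that] by (simp add: W_def)
    show "w {x, par x} \<le> W" if "x < n" "x \<noteq> rt x" "v \<in> D x" "u \<notin> D x" for x
      using light_path_end[OF assms(8) that] by (simp add: W_def)
  qed (use assms(5) in \<open>auto simp: paths_def\<close>)
  have 2: "path_weight qw P' \<le> \<alpha> * W"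
  proof -
    have "graph_dist N qE qw (cid u) (cid v) \<le> W" using graph_dist_le[OF qw_nonneg P''(1)] P''(2)
        by simp
    then have "\<alpha> * graph_dist N qE qw (cid u) (cid v) \<le> \<alpha> * W" using assms(7)
        by (intro mult_left_mono) auto
    then show ?thesis using assms(6) by simp
  qed
  have 3: "6 * real s * (W + W) \<le> 12 * real s * (\<alpha> * W)"
  proof -
    have "W \<le> \<alpha> * W" using W assms(7) by (simp add: mult_le_cancel_right1)
    then have "12 * real s * W \<le> 12 * real s * (\<alpha> * W)" by (intro mult_left_mono) auto
    then show ?thesis by simp
  qed
  have "(1 + 12 * real s) * path_weight qw P' \<le> (1 + 12 * real s) * (\<alpha> * W)"
    using 2 by (intro mult_left_mono) auto
  then have "path_weight w (routed u v P') \<le> 12 * real s * (\<alpha> * W) + (1 + 12 * real s) * (\<alpha> * W)"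
    using 1 3 by linarith
  also have "\<dots> = (1 + 24 * real s) * \<alpha> * W" by (simp add: algebra_simps)
  finally show ?thesis by (simp add: W_def)
qed

end

context quotient_graph
begin

text \<open>\<open>M\<close> meets the demands of the hashing: at least \<open>N\<close>, at least
  twice the number of ordered keys (there are at most \<open>2 * card S'\<close>), and positive.
  Addresses are kept polynomial in \<open>n\<close> by \<open>card S' \<le> N * N\<close>.\<close>

lemma stored_oracle_exists:
  assumes "S' \<subseteq> qE" "N \<le> n" "0 < n" "\<And>v. v < n \<Longrightarrow> cid v < N + n"
    and "m = n + 2" "M = N + 4 * card S' + 1" "\<forall>x\<in>set Dq. x < word_bound \<kappa> N"
  shows "\<exists>D0 T d X Y bPar bDep bCid bT bd bX bY.
    stored_oracle n par dep rt (word_bound (\<kappa> + 10) n) D0 N M cid T d X Y bPar bDep bCid bT bd bX bY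
      {(a, b). {a, b} \<in> S'} ex ey \<and>
    length D0 = 10 + 3 * n + N + 3 * M \<and> length D0 \<le> 16 * m ^ 2 \<and>
    (\<forall>x\<in>set (D0 @ Dq). x < word_bound (\<kappa> + 10) n)"
proof -
  define K where "K = {(a, b). {a, b} \<in> S'}"
  define B where "B = word_bound (\<kappa> + 10) n"
  have finS: "finite S'" using assms(1) finite_quotient finite_subset by blast
  have K: "finite K" "card K \<le> 2 * card S'" using card_ordered_pairs[OF finS] unfolding K_def
      by auto
  have linkK: "{a, b} \<in> qE" if "(a, b) \<in> K" for a b using that assms(1) unfolding K_def by blast
  have KN: "K \<subseteq> {..<N} \<times> {..<N}" using link(6,7)[OF linkK] by auto
  have "S' \<subseteq> (\<lambda>(a, b). {a, b}) ` ({..<N} \<times> {..<N})"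
  proof
    fix f assume f: "f \<in> S'"
    then obtain u v where "f = {cid u, cid v}" using assms(1) unfolding qE_def by blast
    moreover from this f have "(cid u, cid v) \<in> K" by (simp add: K_def)
    ultimately show "f \<in> (\<lambda>(a, b). {a, b}) ` ({..<N} \<times> {..<N})" using KN by blast
  qed
  then have "card S' \<le> card ((\<lambda>(a, b). {a, b}) ` ({..<N} \<times> {..<N}))"
      by (rule card_mono[rotated]) simp
  also have "\<dots> \<le> card ({..<N} \<times> {..<N})" by (rule card_image_le) simp
  also have "\<dots> = N * N" by (simp add: card_cartesian_product)
  also have "\<dots> \<le> n * n" using assms(2) by (intro mult_le_mono) auto
  finally have "10 + 4 * n + 2 * N + 4 * M \<le> 10 + 4 * n + 2 * n + 4 * (n + 4 * (n * n) + 1)"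
    using assms(2,6) by simp
  also have "\<dots> \<le> 16 * m ^ 2" using assms(5) by (simp add: power2_eq_square algebra_simps)
  finally have total: "10 + 4 * n + 2 * N + 4 * M \<le> 16 * m ^ 2" .
  have B: "m ^ (\<kappa> + 1) + 16 * m ^ 2 \<le> B" "word_bound \<kappa> N \<le> m ^ (\<kappa> + 1)" "N \<le> m ^ (\<kappa> + 1)"
    using word_bound_arith[OF assms(2,5)] unfolding B_def by auto
  have "1 \<le> m ^ (\<kappa> + 1)" by (rule one_le_power) (use assms(5) in simp)
  then have lB: "10 + 4 * n + 2 * N + 4 * M < B" using B total by linarith
  obtain T d where Td: "\<And>a. T a < M" "\<And>v. d v < M" "inj_on (slot M T d) K"
    using perfect_displacement[OF K(1) KN, of M] K(2) assms(6) by auto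
  define X where "X p = (if p \<in> slot M T d ` K then case_prod ex (inv_into K (slot M T d) p) else
      0)" for p
  define Y where "Y p = (if p \<in> slot M T d ` K then case_prod ey (inv_into K (slot M T d) p) else
      0)" for p
  have XY: "X (slot M T d (a, b)) = ex a b" "Y (slot M T d (a, b)) = ey a b" if "(a, b) \<in> K" for a b
    using that inv_into_f_f[OF Td(3) that] by (auto simp: X_def Y_def)
  have ends: "ex a b < n" "ey a b < n" if "(a, b) \<in> K" for a b
    using edge_less[OF link(1)[OF linkK[OF that]]] by auto
  have XYn: "X p < n" "Y p < n" for p
  proof -
    have "X p < n \<and> Y p < n"
    proof (cases "p \<in> slot M T d ` K")
      case True
      then obtain a b where "(a, b) \<in> K" "p = slot M T d (a, b)" by auto
      then show ?thesis using XY ends by simp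
    qed (use assms(3) in \<open>simp add: X_def Y_def\<close>)
    then show "X p < n" "Y p < n" by auto
  qed
  define D0 where "D0 = directory par dep cid T d X Y n N M"
  have len: "length D0 = 10 + 3 * n + N + 3 * M" by (simp add: D0_def length_directory)
  note nd = nth_directory[where par = par and dep = dep and cid = cid and T = T and d = d and X = X
      and Y = Y
      and n = n and N = N and M = M, folded D0_def]
  have "stored_oracle n par dep rt B D0 N M cid T d X Y 10 (10 + n) (10 + 2 * n) (10 + 3 * n) (10 +
      3 * n + N)
      (10 + 3 * n + N + M) (10 + 3 * n + N + 2 * M) K ex ey"
  proof
    show "D0 ! 0 = 10" "D0 ! 1 = 10 + n" "D0 ! 2 = 10 + 2 * n" "D0 ! 3 = 10 + 3 * n"
        "D0 ! 4 = 10 + 3 * n + N"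
      "D0 ! 5 = 10 + 3 * n + N + M" "D0 ! 6 = 10 + 3 * n + N + 2 * M" "D0 ! 7 = length D0"
          "D0 ! 8 = N" "D0 ! 9 = M"
      by (simp_all only: len) (simp_all add: D0_def directory_def)
    show "10 \<le> length D0" using len by simp
    show "10 + v < length D0 \<and> D0 ! (10 + v) = par v" "10 + n + v < length D0 \<and>
        D0 ! (10 + n + v) = dep v"
      "10 + 2 * n + v < length D0 \<and> D0 ! (10 + 2 * n + v) = cid v" if "v < n" for v
      using that by (rule nd)+
    show "10 + 3 * n + a < length D0 \<and> D0 ! (10 + 3 * n + a) = T a" if "a < N" for a
      using that by (rule nd)
    show "10 + 3 * n + N + x < length D0 \<and> D0 ! (10 + 3 * n + N + x) = d x"
      "10 + 3 * n + N + M + x < length D0 \<and> D0 ! (10 + 3 * n + N + M + x) = X x"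
      "10 + 3 * n + N + 2 * M + x < length D0 \<and> D0 ! (10 + 3 * n + N + 2 * M + x) = Y x" if "x < M"
          for x
      using that by (rule nd)+
    show "0 < M" using assms(6) by simp
    show "T a < M" for a using Td by blast
    show "d x < M" for x using Td by blast
    show "a < N \<and> b < N \<and> X (slot M T d (a, b)) = ex a b \<and> Y (slot M T d (a, b)) = ey a b \<and>
      ex a b < n \<and> ey a b < n" if "(a, b) \<in> K" for a b using that XY ends KN by auto
    show "length D0 + n + N + M \<le> B" "4 * n + 4 \<le> B" "2 * N + 4 \<le> B" using lB len by linarith+
    show "dep v \<le> 2 * n" if "v < n" for v using dep_le[OF that] .
  qed
  moreover have "length D0 \<le> 16 * m ^ 2" using total len by linarith
  moreover have "x < B" if "x \<in> set (D0 @ Dq)" for x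
  proof (cases "x \<in> set Dq")
    case True
    then have "x < word_bound \<kappa> N" using assms(7) by blast
    then show ?thesis using B by linarith
  next
    case False
    have v: "par v < B" "dep v < B" "cid v < B" if "v < n" for v
      using par_less[OF that] dep_le[OF that] assms(4)[OF that] lB by linarith+
    have t: "T a < B" "d a < B" "X a < B" "Y a < B" for a
      using Td(1)[of a] Td(2)[of a] XYn[of a] lB by linarith+
    have h: "10 < B" "10 + n < B" "10 + 2 * n < B" "10 + 3 * n < B" "10 + 3 * n + N < B"
      "10 + 3 * n + N + M < B" "10 + 3 * n + N + 2 * M < B" "10 + 3 * n + N + 3 * M < B" "N < B"
          "M < B"
      using lB by linarith+
    from False have "x \<in> set D0" using that by simp
    then show ?thesis unfolding D0_def directory_def using v t h by auto
  qed
  ultimately show ?thesis using len unfolding B_def K_def by blast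
qed

lemma spanner_exists:
  assumes sp: "interactive_spanner Q \<kappa> c N qE qw \<alpha> q S' Dq"
    and n: "N \<le> n" "0 < n" "\<And>v. v < n \<Longrightarrow> cid v < N + n"
    and pos: "1 \<le> \<alpha>" "0 < c" "1 \<le> c * q" and t: "1 \<le> t" "real s \<le> 2 * t"
  shows "\<exists>D. interactive_spanner (query Q) (\<kappa> + 10) (5 * c + 43) n E w (100 * (\<alpha> * t)) (100 * q)
      (lifted_edges S') D \<and>
    length D \<le> 13 + 3 * n + 4 * N + 12 * card S' + length Dq"
proof -
  define B where "B = word_bound (\<kappa> + 10) n"
  define M where "M = N + 4 * card S' + 1"
  define W where "W = (n + 2) ^ (\<kappa> + 1)"
  have S': "S' \<subseteq> qE" and Dq: "\<forall>x\<in>set Dq. x < word_bound \<kappa> N"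
    using sp unfolding interactive_spanner_def by blast+
  obtain D0 T d X Y bPar bDep bCid bT bd bX bY where
    so: "stored_oracle n par dep rt B D0 N M cid T d X Y bPar bDep bCid bT bd bX bY
      {(a, b). {a, b} \<in> S'} ex ey" and
    len: "length D0 = 10 + 3 * n + N + 3 * M" "length D0 \<le> 16 * (n + 2) ^ 2" and
    words: "\<forall>x\<in>set (D0 @ Dq). x < B"
    using stored_oracle_exists[OF S' n refl M_def Dq] unfolding B_def by blast
  interpret so: stored_oracle n par dep rt B D0 Dq N M cid T d X Y bPar bDep bCid bT bd bX bY
    "{(a, b). {a, b} \<in> S'}" ex ey
    using so .
  have arith: "word_bound \<kappa> N \<le> W" "N \<le> W" "W + 16 * (n + 2) ^ 2 \<le> B" "2 * W \<le> B"
    using word_bound_arith[OF n(1) refl] unfolding W_def B_def by auto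
  have WD: "W + length D0 \<le> B" using arith(3) len(2) by linarith
  have DqW: "\<forall>x\<in>set Dq. x < W" using Dq arith(1) by auto
  have routable: "so.routable cur v P"
    if "P \<noteq> []" "set (path_edges P) \<subseteq> S'" "cur < n" "v < n" "cid cur = hd P" "cid v = last P"
        for cur v P
    using that
  proof (induction cur v P rule: so.routable.induct)
    case (2 cur v a)
    then show ?case using cid_eq[OF 2(3,4)] by simp
  next
    case (3 cur v a b xs)
    have ab: "{a, b} \<in> S'" "{a, b} \<in> qE" using 3(3) S' by auto
    note l = link[OF ab(2)]
    have e: "ex a b < n" "ey a b < n" using edge_less[OF l(1)] .
    have "rt cur = rt (ex a b)" using cid_eq[OF 3(4) e(1)] 3(6) l(2) by simp
    moreover have "so.routable (ey a b) v (b # xs)" by (rule 3(1)) (use 3(2-7) l e in auto)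
    ultimately show ?case using 3(4) ab(1) by simp
  qed simp
  have q: "0 < q" using pos(2,3) by (smt (verit) mult_nonneg_nonpos)
  \<comment> \<open>From \<open>s \<le> 2 * t\<close> and \<open>1 \<le> t\<close>:
    \<open>12 * s \<le> 24 * t\<close> and \<open>1 + 24 * s \<le> 49 * t\<close>.\<close>
  have stretch: "12 * real s \<le> 100 * (\<alpha> * t)" "(1 + 24 * real s) * \<alpha> \<le> 100 * (\<alpha> * t)"
  proof -
    have at: "t \<le> \<alpha> * t" "1 * t \<le> \<alpha> * t" using pos(1) t(1) by auto
    show "12 * real s \<le> 100 * (\<alpha> * t)" using at t by linarith
    have "(1 + 24 * real s) * \<alpha> \<le> (100 * t) * \<alpha>" using t pos(1) by (intro mult_right_mono) linarith+
    then show "(1 + 24 * real s) * \<alpha> \<le> 100 * (\<alpha> * t)" by (simp add: mult_ac)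
  qed
  have at_pos: "0 < 100 * (\<alpha> * t)" using pos(1) t(1) by simp
  \<comment> \<open>The distance is an infimum, so the stretch needs to be checked against each
    single path only; the lower bound holds because lifted edges are edges of the graph.\<close>
  have final: "paths n E u v \<noteq> {} \<and> P \<in> paths n (lifted_edges S') u v \<and>
      graph_dist n E w u v \<le> path_weight w P \<and>
      path_weight w P \<le> 100 * (\<alpha> * t) * graph_dist n E w u v"
    if "P \<in> paths n (lifted_edges S') u v"
      "\<And>P'. P' \<in> paths n E u v \<Longrightarrow> path_weight w P \<le> 100 * (\<alpha> * t) * path_weight w P'" for P u v
  proof -
    have PE: "P \<in> paths n E u v" using that(1) lifted_subset[OF S'] by (auto simp: paths_def)
    then have "paths n E u v \<noteq> {}" by blast
    from this le_graph_dist[OF this at_pos that(2)] graph_dist_le[OF weight_nonneg PE] that(1) show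
        ?thesis
      by blast
  qed
  have weightP: "0 \<le> path_weight w P" if "P \<in> paths n E u v" for P u v
    using that by (intro path_weight_nonneg[OF weight_nonneg]) (simp add: paths_def)
  have query: "\<exists>P k. answers B (query Q) (D0 @ Dq) u v P k \<and>
        real k \<le> (5 * c + 43) * (100 * q + real (length (path_edges P))) \<and>
        (if paths n E u v = {} then P = []
         else P \<in> paths n (lifted_edges S') u v \<and> graph_dist n E w u v \<le> path_weight w P \<and>
              path_weight w P \<le> 100 * (\<alpha> * t) * graph_dist n E w u v)"
    if uv: "u < n" "v < n" for u v
  proof -
    \<comment> \<open>93 is 50 plus 43, as a path has one vertex more than edges;
      \<open>1 \<le> c * q\<close> turns it into a multiple of \<open>c * q\<close>.\<close>
    have time: "93 + 5 * (c * (q + l')) + 43 * l \<le> (5 * c + 43) * (100 * q + l)" if "l' \<le> l" "0 \<le> l"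
        for l l'
    proof -
      have "c * l' \<le> c * l" using that(1) pos(2) by (intro mult_left_mono) auto
      then have "93 + 5 * (c * (q + l')) + 43 * l \<le> 93 * (c * q) + 5 * (c * q) + 5 * (c * l) + 43 *
          l"
        using pos(3) by (simp add: algebra_simps)
      also have "\<dots> \<le> (5 * c + 43) * (100 * q + l)" using pos q that by (simp add: algebra_simps)
      finally show ?thesis .
    qed
    consider "cid u = cid v" | "cid u \<noteq> cid v" "\<not> (cid u < N \<and> cid v < N)"
      | "cid u \<noteq> cid v" "cid u < N" "cid v < N" by blast
    then show ?thesis
    proof cases
      case 1
      have r: "rt u = rt v" using cid_eq[OF uv] 1 by simp
      note tp = tpath_in_lifted[OF uv 1]
      have P: "tpath u v \<in> paths n (lifted_edges S') u v" using tp by (auto simp: paths_def)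
      obtain k where k: "k \<le> 50 + 43 * length (tpath u v)"
          "answers B (query Q) (D0 @ Dq) u v (tpath u v) k"
        using so.query_same[OF uv 1 r] by blast
      have "0 < length (tpath u v)" by simp
      then have "k \<le> 93 + 43 * length (path_edges (tpath u v))" using k(1)
          by (simp add: length_path_edges)
      then have "real k \<le> 93 + 5 * (c * (q + 0)) + 43 * real (length (path_edges (tpath u v)))"
        unfolding add_0_right using pos(3) by linarith
      also have "\<dots> \<le> (5 * c + 43) * (100 * q + real (length (path_edges (tpath u v))))"
          by (rule time) auto
      finally have kb: "real k \<le> (5 * c + 43) * (100 * q + real (length (path_edges (tpath u v))))"
          .
      have "path_weight w (tpath u v) \<le> 100 * (\<alpha> * t) * path_weight w P'" if "P' \<in> paths n E u v"
          for P'
        using tpath_stretch[OF uv 1 that] mult_right_mono[OF stretch(1) weightP[OF that]]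
            by linarith
      from final[OF P this] show ?thesis using k(2) kb
          by (intro exI[of _ "tpath u v"] exI[of _ k]) simp
    next
      case 2
      then have e: "paths n E u v = {}" using apart_paths[OF uv] by blast
      obtain k where k: "k \<le> 50" "answers B (query Q) (D0 @ Dq) u v [] k"
          using so.query_apart[OF uv 2] by blast
      have "real k \<le> 93 + 5 * (c * (q + 0)) + 43 * 0"
        unfolding add_0_right using k(1) pos(3) by linarith
      also have "\<dots> \<le> (5 * c + 43) * (100 * q + 0)" by (rule time) auto
      finally show ?thesis using k(2) e by (intro exI[of _ "[]"] exI[of _ k]) simp
    next
      case 3
      obtain P' k where P': "answers (word_bound \<kappa> N) Q Dq (cid u) (cid v) P' k"
        "real k \<le> c * (q + real (length (path_edges P')))"
        "paths N qE (cid u) (cid v) = {} \<Longrightarrow> P' = []"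
        "paths N qE (cid u) (cid v) \<noteq> {} \<Longrightarrow> P' \<in> paths N S' (cid u) (cid v) \<and>
           graph_dist N qE qw (cid u) (cid v) \<le> path_weight qw P' \<and>
           path_weight qw P' \<le> \<alpha> * graph_dist N qE qw (cid u) (cid v)"
        using interactive_spanner_query[OF sp 3(2,3)] by metis
      show ?thesis
      proof (cases "paths N qE (cid u) (cid v) = {}")
        case True
        then have [simp]: "P' = []" using P'(3) by blast
        have e: "paths n E u v = {}"
        proof (rule ccontr)
          assume "paths n E u v \<noteq> {}"
          then obtain P where "P \<in> paths n E u v" by blast
          then have "paths N qE (cid u) (cid v) \<noteq> {}" using project_path[of P] 3(3)
              by (auto simp: paths_def)
          then show False using True by blast
        qed
        obtain k' where k': "k' \<le> 60 + 5 * k + 43 * length (routed u v P')"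
          "answers B (query Q) (D0 @ Dq) u v (routed u v P') k'"
          using so.query_simulated[OF uv 3 P'(1) _ _ arith(1) DqW arith(2,4) WD] by auto
        have "k' \<le> 60 + 5 * k" "real k \<le> c * q" using k'(1) P'(2) by simp_all
        then have "real k' \<le> 93 + 5 * (c * (q + 0)) + 43 * 0" unfolding add_0_right by linarith
        also have "\<dots> \<le> (5 * c + 43) * (100 * q + 0)" by (rule time) auto
        finally show ?thesis using k'(2) e by (intro exI[of _ "[]"] exI[of _ k']) simp
      next
        case False
        note Q = P'(4)[OF False]
        have p: "P' \<noteq> []" "distinct P'" "set (path_edges P') \<subseteq> S'" "cid u = hd P'" "cid v = last P'"
            "set P' \<subseteq> {..<N}"
          using Q by (auto simp: paths_def)
        have "card (set P') \<le> card {..<N}" using p(6) by (intro card_mono) auto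
        then have lenP: "length P' \<le> N" using p(2) by (simp add: distinct_card)
        obtain k' where k': "k' \<le> 60 + 5 * k + 43 * length (routed u v P')"
          "answers B (query Q) (D0 @ Dq) u v (routed u v P') k'"
          using so.query_simulated[OF uv 3 P'(1) lenP _ arith(1) DqW arith(2,4) WD]
            routable[OF p(1,3) uv p(4,5)] by blast
        note rp = route_props[OF S' p(1-3) uv p(4,5)]
        have R: "routed u v P' \<in> paths n (lifted_edges S') u v" using rp by (auto simp: paths_def)
        have "0 < length (routed u v P')" using rp by simp
        then have "k' \<le> 103 + 5 * k + 43 * length (path_edges (routed u v P'))"
          using k'(1) by (simp add: length_path_edges)
        moreover have "length (path_edges P') \<le> length (path_edges (routed u v P'))"
          using rp by (simp add: length_path_edges diff_le_mono)
        ultimately have l: "real (length (path_edges P')) \<le> real (length (path_edges (routed u v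
            P')))"
          "real k' \<le> 103 + 5 * (c * (q + real (length (path_edges P')))) + 43 * real (length
              (path_edges (routed u v P')))"
          using P'(2) by linarith+
        have kb: "real k' \<le> (5 * c + 43) * (100 * q + real (length (path_edges (routed u v P'))))"
        proof -
          have "c * real (length (path_edges P')) \<le> c * real (length (path_edges (routed u v P')))"
            using l(1) pos(2) by (intro mult_left_mono) auto
          then have "real k' \<le> 103 * (c * q) + 5 * (c * q) + 5 * (c * real (length (path_edges
              (routed u v P')))) +
              43 * real (length (path_edges (routed u v P')))"
            using l(2) pos(3) by (simp add: algebra_simps)
          also have "\<dots> \<le> (5 * c + 43) * (100 * q + real (length (path_edges (routed u v P'))))"
            using pos q by (simp add: algebra_simps)
          finally show ?thesis .
        qed
        have "path_weight w (routed u v P') \<le> 100 * (\<alpha> * t) * path_weight w P"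
            if "P \<in> paths n E u v" for P
          using route_stretch[OF uv 3(3) S' _ _ pos(1) that, of P'] Q
            mult_right_mono[OF stretch(2) weightP[OF that]] by linarith
        from final[OF R this] show ?thesis using k'(2) kb
            by (intro exI[of _ "routed u v P'"] exI[of _ k']) simp
      qed
    qed
  qed
  have "interactive_spanner (query Q) (\<kappa> + 10) (5 * c + 43) n E w (100 * (\<alpha> * t)) (100 * q)
      (lifted_edges S') (D0 @ Dq)"
    unfolding interactive_spanner_def using lifted_subset[OF S'] words query unfolding B_def
        by blast
  moreover have "length (D0 @ Dq) \<le> 13 + 3 * n + 4 * N + 12 * card S' + length Dq"
    using len(1) unfolding M_def by simp
  ultimately show ?thesis by blast
qed

end

text \<open>Rounding \<open>t\<close> up leaves at most \<open>n / s \<le> n / t\<close> roots in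
  \<open>R\<close>; their number is an integer, so they also fit below the rounded-down
  \<open>N\<close>, at which \<open>h\<close> is evaluated.\<close>

lemma spanner_of_cluster_spanner:
  assumes admits: "all_graphs_admit Q \<kappa> c \<alpha> q h" and t: "1 \<le> t" and G: "weighted_graph n E w"
  shows "\<exists>S D. interactive_spanner (query Q) (\<kappa> + 10) (5 * c + 43) n E w (100 * (\<alpha> * t)) (100 * q) S
      D \<and>
    real (spanner_size S D) \<le> 100 * (h (nat \<lfloor>real n / t\<rfloor>) + real n)"
proof (cases "n = 0")
  case True
  have "interactive_spanner (query Q) (\<kappa> + 10) (5 * c + 43) n E w (100 * (\<alpha> * t)) (100 * q) {} []"
    using True by (simp add: interactive_spanner_def)
  moreover have "real (spanner_size {} []) \<le> 100 * (h (nat \<lfloor>real n / t\<rfloor>) + real n)"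
    using admits_size_nonneg[OF admits, of "nat \<lfloor>real n / t\<rfloor>"] by (simp add: spanner_size_def)
  ultimately show ?thesis by blast
next
  case False
  define s where "s = nat \<lceil>t\<rceil>"
  define N where "N = nat \<lfloor>real n / t\<rfloor>"
  have s: "1 \<le> s" "t \<le> real s" "real s \<le> 2 * t" using t unfolding s_def by linarith+
  obtain par dep D rt R where cl: "clustering s n E w par dep D rt R"
      using clustering_exists[OF G s(1)] by blast
  interpret clustered_graph s n E w par dep D rt R using G cl by unfold_locales
  have "real (card R) \<le> real n / t"
  proof -
    have "t * real (card R) \<le> real s * real (card R)" using s(2) by (intro mult_right_mono) auto
    also have "\<dots> \<le> real n" using big(2) by (metis of_nat_le_iff of_nat_mult)
    finally show ?thesis using t by (simp add: field_simps)
  qed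
  then have RN: "card R \<le> N" unfolding N_def by linarith
  have finR: "finite R" using big(1) finite_subset by blast
  obtain f where f: "f ` R \<subseteq> {..<N}" "inj_on f R"
    using card_le_inj[OF finR, of "{..<N}"] RN by auto
  \<comment> \<open>Roots are below \<open>n\<close>, so the shift by \<open>N\<close> keeps the
    remaining clusters apart, outside of the quotient and below \<open>N + n\<close>.\<close>
  define cid where "cid v = (if rt v \<in> R then f (rt v) else N + rt v)" for v
  have fN: "f r < N" if "r \<in> R" for r using f(1) that by auto
  interpret quotient_graph s n E w par dep D rt R N cid
  proof
    fix u v assume "u < n" "v < n"
    show "cid u = cid v \<longleftrightarrow> rt u = rt v"
      using f(2) fN[of "rt u"] fN[of "rt v"] unfolding cid_def by (auto dest: inj_onD)
  next
    fix u assume "u < n"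
    show "cid u < N \<longleftrightarrow> rt u \<in> R" using fN[of "rt u"] unfolding cid_def by auto
  qed
  obtain S' Dq where sp: "interactive_spanner Q \<kappa> c N qE qw \<alpha> q S' Dq"
    "real (spanner_size S' Dq) \<le> h N"
    using all_graphs_admitD[OF admits quotient_weighted] by blast
  have "real n / t \<le> real n" using t by (simp add: divide_le_eq mult_le_cancel_left1)
  then have Nn: "N \<le> n" unfolding N_def by linarith
  have cidn: "cid v < N + n" if "v < n" for v using fN[of "rt v"] rt_less[OF that] unfolding cid_def
      by auto
  obtain D' where D': "interactive_spanner (query Q) (\<kappa> + 10) (5 * c + 43) n E w (100 * (\<alpha> * t))
      (100 * q)
      (lifted_edges S') D'" "length D' \<le> 13 + 3 * n + 4 * N + 12 * card S' + length Dq"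
    using spanner_exists[OF sp(1) Nn _ cidn admits_stretch[OF admits] admits_constant_pos[OF admits]
        admits_time[OF admits] t s(3)] False by blast
  have S': "S' \<subseteq> qE" using sp(1) unfolding interactive_spanner_def by blast
  have "real (card S') \<le> h N" "real (length Dq) \<le> h N" using sp(2) unfolding spanner_size_def
      by auto
  moreover have "real (card (lifted_edges S')) \<le> real n + 2 * real (card S')"
    using card_lifted[OF S'] by linarith
  moreover have "real (length D') \<le> 20 * real n + 12 * real (card S') + real (length Dq)"
    using D'(2) Nn False by linarith
  moreover have "0 \<le> h N" using admits_size_nonneg[OF admits] .
  ultimately have "real (spanner_size (lifted_edges S') D') \<le> 100 * (h N + real n)"
    unfolding spanner_size_def by simp
  then show ?thesis using D'(1) unfolding N_def by blast
qed

text \<open>The order of the quantifiers makes the hidden constants uniform: \<open>Q'\<close> is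
  fixed before \<open>\<alpha>\<close>, \<open>q\<close>, \<open>h\<close> and \<open>t\<close>, so
  \<open>t\<close> influences only the chosen edges and the stored words.\<close>

theorem theorem7:
  "\<exists>C::real. \<forall>(\<kappa>::nat) (c::real). \<exists>(\<kappa>'::nat) (c'::real). \<forall>Q. \<exists>Q'. \<forall>(\<alpha>::real) (q::real) (h::nat \<Rightarrow>
      real).
     all_graphs_admit Q \<kappa> c \<alpha> q h \<longrightarrow>
     (\<forall>t::real. 1 \<le> t \<longrightarrow>
        all_graphs_admit Q' \<kappa>' c' (C * (\<alpha> * t)) (C * q)
          (\<lambda>n. C * (h (nat \<lfloor>real n / t\<rfloor>) + real n)))"
proof (rule exI[of _ 100], intro allI)
  fix \<kappa> :: nat and c :: real
  show "\<exists>(\<kappa>'::nat) (c'::real). \<forall>Q. \<exists>Q'. \<forall>(\<alpha>::real) (q::real) (h::nat \<Rightarrow> real).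
     all_graphs_admit Q \<kappa> c \<alpha> q h \<longrightarrow>
     (\<forall>t::real. 1 \<le> t \<longrightarrow>
        all_graphs_admit Q' \<kappa>' c' (100 * (\<alpha> * t)) (100 * q)
          (\<lambda>n. 100 * (h (nat \<lfloor>real n / t\<rfloor>) + real n)))"
  proof (rule exI[of _ "\<kappa> + 10"], rule exI[of _ "5 * c + 43"], rule allI)
    fix Q
    show "\<exists>Q'. \<forall>(\<alpha>::real) (q::real) (h::nat \<Rightarrow> real).
     all_graphs_admit Q \<kappa> c \<alpha> q h \<longrightarrow>
     (\<forall>t::real. 1 \<le> t \<longrightarrow>
        all_graphs_admit Q' (\<kappa> + 10) (5 * c + 43) (100 * (\<alpha> * t)) (100 * q)
          (\<lambda>n. 100 * (h (nat \<lfloor>real n / t\<rfloor>) + real n)))"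
    proof (rule exI[of _ "query Q"], intro allI impI)
      fix \<alpha> q t :: real and h :: "nat \<Rightarrow> real"
      assume "all_graphs_admit Q \<kappa> c \<alpha> q h" "1 \<le> t"
      then show "all_graphs_admit (query Q) (\<kappa> + 10) (5 * c + 43) (100 * (\<alpha> * t)) (100 * q)
          (\<lambda>n. 100 * (h (nat \<lfloor>real n / t\<rfloor>) + real n))"
        using spanner_of_cluster_spanner unfolding all_graphs_admit_def[of "query Q"] by blast
    qed
  qed
qed

end
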